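(* Let $R$ be a unit-regular ring. Then: (i) $\mathrm{V}(R)=\mathrm{W}(R)=\mathrm{W}_{\mathrm M}(R)$ as ordered monoids (via the natural maps), so that the orders defined in $\mathrm{W}(R)$ and $\mathrm{W}_{\mathrm M}(R)$ agree with the algebraic order. (ii) $\mathrm{V}^*(R)=\mathrm{CP}(R)=\mathrm{S}(R)=\Lambda_{\mathrm W}(R)$ as semigroups (via the natural maps). The order $\precsim$ in $\mathrm{CP}(R)$ is given by: $P\precsim Q$ if and only if $P$ is isomorphic to a submodule of $Q$. Moreover, $\mathrm{S}(R)=\mathrm{CP}(R)=\Lambda(R)$ as ordered semigroups.
   Context: A unital ring $R$ is unit-regular if for each $x\in R$ there is an invertible $u\in R$ with $x=xux$. Modules are right modules. $M_\infty(R)$ is the ring of $\mathbb{N}\times\mathbb{N}$ matrices over $R$ with finitely many nonzero entries; finite rectangular matrices are identified with their extensions by zeros; $x\oplus y=\begin{pmatrix}x&0\\0&y\end{pmatrix}$ for finite matrices. Write $a\precsim_1b$ if $a=rbt$ for some $r,t\in M_\infty(R)$. $\mathrm{V}(R)$: monoid of Murray–von Neumann equivalence classes of idempotents in $M_\infty(R)$, with the algebraic order. $\mathrm{W}(R)$: $M_\infty(R)$ modulo the antisymmetrization of $\precsim_1$, with order induced by $\precsim_1$ and $[a]+[b]=[a\oplus b]$. $\mathrm{W}_{\mathrm M}(R)$: write $a\precsim_0b$ if either $a\precsim_1b$ or $a=\begin{pmatrix}c&0\\0&d\end{pmatrix}$ and $b=\begin{pmatrix}c&e\\0&d\end{pmatrix}$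 for some matrices $c,d,e$ (of compatible sizes); let $\precsim_{\mathrm M}$ be the transitive closure of $\precsim_0$; $\mathrm{W}_{\mathrm M}(R)$ is $M_\infty(R)$ modulo the antisymmetrization of $\precsim_{\mathrm M}$, with induced order and diagonal-sum addition. The natural maps $\mathrm{V}(R)\to\mathrm{W}(R)\to\mathrm{W}_{\mathrm M}(R)$ send the class of an element to the class of the same element. $\mathrm{V}^*(R)$: monoid of isomorphism classes of countably generated projective modules under direct sum. $\mathrm{CP}(R)$: for countably generated projective modules, $P\precsim Q$ if for every finitely generated submodule $X\subseteq P$ there are homomorphisms $\alpha\colon X\to Q$, $\beta\colon Q\to P$ with $\beta\alpha$ the inclusion $X\hookrightarrow P$; $\mathrm{CP}(R)$ is the set of classes under the antisymmetrization of $\precsim$, with induced order and $[P]+[Q]=[P\oplus Q]$. The natural map $\mathrm{V}^*(R)\to\mathrm{CP}(R)$ sends the isomorphism class of $P$ to $[P]$. $\Lambda(R)$: let $T(R)$ be the set of sequences $(a_n)$ in $M_\infty(R)$ with $a_n\precsim_1a_{n+1}$; $(a_n)\precsim(b_n)$ if for all $n$ there is $m$ with $a_n\precsim_1b_m$; $\Lambda(R)$ is $T(R)$ modulo the antisymmetrization of $\precsim$, with induced order and addition $[(u_n)]+[(u_n')]=[(u_n\oplus u_n')]$ for representatives by finite matrices $u_n\in M_{k_{n+1}\times k_n}(R)$ such that $u_n=v_{n+1}u_{n+1}z_{n+1}$ with $v_{n+1}\in M_{k_{n+1}\times k_{n+2}}(R)$, $z_{n+1}\in M_{k_{n+1}\times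 k_n}(R)$ (and similarly $u_n'$). $\mathrm{S}(R)$: submonoid of $\Lambda(R)$ of classes of sequences $(x_n)$ such that for all $n$ there is $y_{n+1}\in M_\infty(R)$ with $y_{n+1}x_{n+1}x_n=x_n$. $\mathrm{CP}(R)$ is identified with $\mathrm{S}(R)$ by the ordered monoid isomorphism $[P]\mapsto[(x_i)]$, where $P\cong\varinjlim_i(R^{n_i},x_i\cdot)$ with $x_i\in M_{n_{i+1}\times n_i}(R)$ and $y_{i+1}x_{i+1}x_i=x_i$ for suitable $y_{i+1}$. $\Lambda_{\mathrm W}(R)$: the monoid of countably generated intervals of $\mathrm{W}(R)$, i.e. upward directed, downward hereditary subsets having a countable cofinal subset, ordered by inclusion, with $I+J=\{z: z\le x+y,\ x\in I,\ y\in J\}$. It is identified with $\Lambda(R)$ by sending an interval with increasing cofinal sequence $([a_n])$ to $[(a_n)]$. *)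

theory Defs
  imports "HOL.Hull" "HOL-Algebra.Ring" "HOL-Library.Countable_Set"
begin

(* The sort {ring, monoid_mult} is that of arbitrary unital rings, the zero ring included
   (ring_1 would add 0 \<noteq> 1). *)

definition unit_regular :: "'a::{ring,monoid_mult} itself \<Rightarrow> bool" where
  "unit_regular _ \<longleftrightarrow> (\<forall>x::'a. \<exists>u. (\<exists>v. u * v = 1 \<and> v * u = 1) \<and> x = x * u * x)"


section \<open>Finitely supported infinite matrices\<close>

typedef (overloaded) 'a minf = "{f :: nat \<Rightarrow> nat \<Rightarrow> 'a::zero. finite {(i, j). f i j \<noteq> 0}}"
  morphisms entry Abs_minf
  by (rule exI[of _ "\<lambda>_ _. 0"]) simp

setup_lifting type_definition_minf

lemma finite_row: "finite {(i, j). f i j \<noteq> 0} \<Longrightarrow> finite {j. f i j \<noteq> 0}"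
  by (rule finite_subset[of _ "snd ` {(i, j). f i j \<noteq> 0}"]) force+

lemma finite_entry_row [simp]: "finite {j. entry a i j \<noteq> 0}"
  using entry[of a] by (auto intro: finite_row)

lemma minf_eqI: "(\<And>i j. entry a i j = entry b i j) \<Longrightarrow> a = b"
  by (metis entry_inject ext)

instantiation minf :: (ring) ring
begin

lift_definition zero_minf :: "'a minf" is "\<lambda>_ _. 0" by simp

lift_definition plus_minf :: "'a minf \<Rightarrow> 'a minf \<Rightarrow> 'a minf" is "\<lambda>a b i j. a i j + b i j"
  subgoal for a b
    by (rule finite_subset[of _ "{(i, j). a i j \<noteq> 0} \<union> {(i, j). b i j \<noteq> 0}"]) auto
  done

lift_definition uminus_minf :: "'a minf \<Rightarrow> 'a minf" is "\<lambda>a i j. - a i j" by simp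

lift_definition minus_minf :: "'a minf \<Rightarrow> 'a minf \<Rightarrow> 'a minf" is "\<lambda>a b i j. a i j - b i j"
  subgoal for a b
    by (rule finite_subset[of _ "{(i, j). a i j \<noteq> 0} \<union> {(i, j). b i j \<noteq> 0}"]) auto
  done

lift_definition times_minf :: "'a minf \<Rightarrow> 'a minf \<Rightarrow> 'a minf"
  is "\<lambda>a b i j. \<Sum>k | a i k \<noteq> 0. a i k * b k j"
  subgoal for a b
  proof (rule finite_subset[of _ "fst ` {(i, j). a i j \<noteq> 0} \<times> snd ` {(i, j). b i j \<noteq> 0}"])
    assume "finite {(i, j). a i j \<noteq> 0}" "finite {(i, j). b i j \<noteq> 0}"
    then show "finite (fst ` {(i, j). a i j \<noteq> 0} \<times> snd ` {(i, j). b i j \<noteq> 0})" by simp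
    show "{(i, j). (\<Sum>k | a i k \<noteq> 0. a i k * b k j) \<noteq> 0}
        \<subseteq> fst ` {(i, j). a i j \<noteq> 0} \<times> snd ` {(i, j). b i j \<noteq> 0}"
    proof (rule subrelI)
      fix i j assume "(i, j) \<in> {(i, j). (\<Sum>k | a i k \<noteq> 0. a i k * b k j) \<noteq> 0}"
      then have "(\<Sum>k | a i k \<noteq> 0. a i k * b k j) \<noteq> 0" by simp
      then obtain k where "a i k \<noteq> 0" "a i k * b k j \<noteq> 0"
        by (rule sum.not_neutral_contains_not_neutral) auto
      then have "a i k \<noteq> 0" "b k j \<noteq> 0" by auto
      then show "(i, j) \<in> fst ` {(i, j). a i j \<noteq> 0} \<times> snd ` {(i, j). b i j \<noteq> 0}" by force
    qed
  qed
  done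

lemma entry_times_superset:
  fixes a b :: "'a minf"
  assumes "finite K" "{k. entry a i k \<noteq> 0} \<subseteq> K"
  shows "entry (a * b) i j = (\<Sum>k\<in>K. entry a i k * entry b k j)"
  unfolding times_minf.rep_eq using assms by (intro sum.mono_neutral_left) auto

instance
proof
  fix a b c :: "'a minf"
  show "a + b + c = a + (b + c)" "a + b = b + a" "0 + a = a" "- a + a = 0" "a - b = a + - b"
    by (rule minf_eqI; simp add: plus_minf.rep_eq uminus_minf.rep_eq minus_minf.rep_eq
        zero_minf.rep_eq add.assoc add.commute)+
  show "a * (b + c) = a * b + a * c"
    by (rule minf_eqI) (simp add: plus_minf.rep_eq times_minf.rep_eq distrib_left sum.distrib)
  show "(a + b) * c = a * c + b * c"
  proof (rule minf_eqI)
    fix i j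
    let ?K = "{k. entry a i k \<noteq> 0} \<union> {k. entry b i k \<noteq> 0}"
    have "{k. entry (a + b) i k \<noteq> 0} \<subseteq> ?K" by (auto simp: plus_minf.rep_eq)
    then show "entry ((a + b) * c) i j = entry (a * c + b * c) i j"
      by (simp add: plus_minf.rep_eq entry_times_superset[where K = ?K] distrib_right
          flip: sum.distrib)
  qed
  show "a * b * c = a * (b * c)"
  proof (rule minf_eqI)
    fix i j
    let ?A = "{k. entry a i k \<noteq> 0}"
    let ?L = "\<Union>k\<in>?A. {l. entry b k l \<noteq> 0}"
    have "{l. entry (a * b) i l \<noteq> 0} \<subseteq> ?L"
    proof clarify
      fix l assume "entry (a * b) i l \<noteq> 0"
      then obtain k where "k \<in> ?A" "entry a i k * entry b k l \<noteq> 0"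
        unfolding times_minf.rep_eq by (meson sum.not_neutral_contains_not_neutral)
      then show "l \<in> ?L" by auto
    qed
    then have "entry (a * b * c) i j = (\<Sum>l\<in>?L. entry (a * b) i l * entry c l j)"
      by (intro entry_times_superset) auto
    also have "\<dots> = (\<Sum>l\<in>?L. \<Sum>k\<in>?A. entry a i k * entry b k l * entry c l j)"
      by (simp add: times_minf.rep_eq sum_distrib_right)
    also have "\<dots> = (\<Sum>k\<in>?A. \<Sum>l\<in>?L. entry a i k * entry b k l * entry c l j)"
      by (rule sum.swap)
    also have "\<dots> = (\<Sum>k\<in>?A. entry a i k * entry (b * c) k j)"
    proof (rule sum.cong)
      fix k assume "k \<in> ?A"
      then have "entry (b * c) k j = (\<Sum>l\<in>?L. entry b k l * entry c l j)"
        by (intro entry_times_superset) auto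
      then show "(\<Sum>l\<in>?L. entry a i k * entry b k l * entry c l j) = entry a i k * entry (b * c) k j"
        by (simp add: sum_distrib_left mult.assoc)
    qed simp
    finally show "entry (a * b * c) i j = entry (a * (b * c)) i j"
      by (simp add: times_minf.rep_eq)
  qed
qed

end

(* m x n matrices, identified with their extensions by zeros. *)
definition mats :: "nat \<Rightarrow> nat \<Rightarrow> 'a::zero minf set" where
  "mats m n = {x. \<forall>i j. entry x i j \<noteq> 0 \<longrightarrow> i < m \<and> j < n}"

(* The block matrix with rows (a b) and (c d), whose upper left block has size m x n;
   a, b, c are cut down to the size of their block. *)
lift_definition block ::
  "nat \<Rightarrow> nat \<Rightarrow> 'a::zero minf \<Rightarrow> 'a minf \<Rightarrow> 'a minf \<Rightarrow> 'a minf \<Rightarrow> 'a minf"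
  is "\<lambda>m n a b c d i j.
    if i < m then (if j < n then a i j else b i (j - n))
    else (if j < n then c (i - m) j else d (i - m) (j - n))"
proof -
  fix m n :: nat and a b c d :: "nat \<Rightarrow> nat \<Rightarrow> 'a"
  assume fin: "finite {(i, j). a i j \<noteq> 0}" "finite {(i, j). b i j \<noteq> 0}"
    "finite {(i, j). c i j \<noteq> 0}" "finite {(i, j). d i j \<noteq> 0}"
  let ?f = "\<lambda>i j. if i < m then (if j < n then a i j else b i (j - n))
    else (if j < n then c (i - m) j else d (i - m) (j - n))"
  let ?U = "{(i, j). a i j \<noteq> 0} \<union>
    (\<lambda>(i, j). (i, j + n)) ` {(i, j). b i j \<noteq> 0} \<union>
    (\<lambda>(i, j). (i + m, j)) ` {(i, j). c i j \<noteq> 0} \<union>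
    (\<lambda>(i, j). (i + m, j + n)) ` {(i, j). d i j \<noteq> 0}"
  have "{(i, j). ?f i j \<noteq> 0} \<subseteq> ?U"
  proof (rule subrelI)
    fix i j assume "(i, j) \<in> {(i, j). ?f i j \<noteq> 0}"
    then have *: "?f i j \<noteq> 0" by simp
    consider "i < m" "j < n" | j' where "i < m" "j = j' + n" | i' where "i = i' + m" "j < n"
      | i' j' where "i = i' + m" "j = j' + n"
      by (metis add.commute le_Suc_ex not_less)
    then show "(i, j) \<in> ?U" by cases (use * in auto)
  qed
  then show "finite {(i, j). ?f i j \<noteq> 0}" by (rule finite_subset) (use fin in simp)
qed

(* x \<oplus> y, where x is regarded as an m x n matrix (for x in mats m n). *)
definition diag_sum :: "nat \<Rightarrow> nat \<Rightarrow> 'a::ring minf \<Rightarrow> 'a minf \<Rightarrow> 'a minf" where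
  "diag_sum m n x y = block m n x 0 0 y"


section \<open>Ordered monoids and antisymmetrizations\<close>

(* Monoids are written multiplicatively, as in HOL-Algebra; mult is the addition of classes. *)
record 'b ordered_monoid = "'b monoid" +
  mle :: "'b \<Rightarrow> 'b \<Rightarrow> bool"

definition ordered_iso ::
  "('b, 'x) ordered_monoid_scheme \<Rightarrow> ('c, 'y) ordered_monoid_scheme \<Rightarrow> ('b \<Rightarrow> 'c) set" where
  "ordered_iso G H = {h \<in> iso G H. h \<one>\<^bsub>G\<^esub> = \<one>\<^bsub>H\<^esub> \<and>
     (\<forall>x\<in>carrier G. \<forall>y\<in>carrier G. mle G x y \<longleftrightarrow> mle H (h x) (h y))}"

definition algebraic_le :: "('b, 'x) monoid_scheme \<Rightarrow> 'b \<Rightarrow> 'b \<Rightarrow> bool" where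
  "algebraic_le G x y \<longleftrightarrow> (\<exists>z\<in>carrier G. y = x \<otimes>\<^bsub>G\<^esub> z)"

definition antisymmetrization :: "'x set \<Rightarrow> ('x \<Rightarrow> 'x \<Rightarrow> bool) \<Rightarrow> ('x \<times> 'x) set" where
  "antisymmetrization A lq = {(x, y). x \<in> A \<and> y \<in> A \<and> lq x y \<and> lq y x}"

(* In the monoids below, the elements are equivalence classes, and operations and orders on classes
   are given through all representatives. A natural map that sends the class of an element to the
   class of the same element is X \<mapsto> r `` X, for r the equivalence relation of the target. *)


section \<open>V(R), W(R), and the variant of W(R) with triangular comparison\<close>

definition idempotents :: "'a::ring minf set" where
  "idempotents = {e. e * e = e}"

definition V_rel :: "('a::ring minf \<times> 'a minf) set" where
  "V_rel = {(e, f). e \<in> idempotents \<and> f \<in> idempotents \<and> (\<exists>x y. e = x * y \<and> f = y * x)}"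

(* e is given a square size, so that the diagonal sum is again idempotent. *)
definition V_add :: "'a::ring minf set \<Rightarrow> 'a minf set \<Rightarrow> 'a minf set" where
  "V_add X Y = \<Union>{V_rel `` {diag_sum m m e f} | m e f. e \<in> X \<and> f \<in> Y \<and> e \<in> mats m m}"

definition V_monoid :: "'a::ring minf set ordered_monoid" where
  "V_monoid = \<lparr>carrier = idempotents // V_rel, mult = V_add, one = V_rel `` {0},
     mle = (\<lambda>X Y. \<exists>Z\<in>idempotents // V_rel. Y = V_add X Z)\<rparr>"

definition le1 :: "'a::ring minf \<Rightarrow> 'a minf \<Rightarrow> bool" (infix \<open>\<lesssim>\<^sub>1\<close> 50) where
  "a \<lesssim>\<^sub>1 b \<longleftrightarrow> (\<exists>r t. a = r * b * t)"

definition le0 :: "'a::ring minf \<Rightarrow> 'a minf \<Rightarrow> bool" (infix \<open>\<lesssim>\<^sub>0\<close> 50) where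
  "a \<lesssim>\<^sub>0 b \<longleftrightarrow> a \<lesssim>\<^sub>1 b \<or> (\<exists>m n c d e. a = block m n c 0 0 d \<and> b = block m n c e 0 d)"

definition leM :: "'a::ring minf \<Rightarrow> 'a minf \<Rightarrow> bool" (infix \<open>\<lesssim>\<^sub>M\<close> 50) where
  "leM = le0\<^sup>+\<^sup>+"

(* The common shape of W(R) and its variant, which differ in the preorder only. *)
definition matrix_class_monoid ::
  "('a::ring minf \<Rightarrow> 'a minf \<Rightarrow> bool) \<Rightarrow> 'a minf set ordered_monoid" where
  "matrix_class_monoid lq = (let r = antisymmetrization UNIV lq in
     \<lparr>carrier = UNIV // r,
      mult = (\<lambda>X Y. \<Union>{r `` {diag_sum m n a b} | m n a b. a \<in> X \<and> b \<in> Y \<and> a \<in> mats m n}),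
      one = r `` {0},
      mle = (\<lambda>X Y. \<exists>a\<in>X. \<exists>b\<in>Y. lq a b)\<rparr>)"

definition W_rel :: "('a::ring minf \<times> 'a minf) set" where
  "W_rel = antisymmetrization UNIV le1"

definition W_monoid :: "'a::ring minf set ordered_monoid" where
  "W_monoid = matrix_class_monoid le1"

definition WM_rel :: "('a::ring minf \<times> 'a minf) set" where
  "WM_rel = antisymmetrization UNIV leM"

definition WM_monoid :: "'a::ring minf set ordered_monoid" where
  "WM_monoid = matrix_class_monoid leM"


section \<open>Sequences of matrices, and intervals in W(R)\<close>

definition T_seqs :: "(nat \<Rightarrow> 'a::ring minf) set" where
  "T_seqs = {a. \<forall>n. a n \<lesssim>\<^sub>1 a (Suc n)}"

definition seq_le :: "(nat \<Rightarrow> 'a::ring minf) \<Rightarrow> (nat \<Rightarrow> 'a minf) \<Rightarrow> bool" where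
  "seq_le a b \<longleftrightarrow> (\<forall>n. \<exists>m. a n \<lesssim>\<^sub>1 b m)"

definition Lambda_rel :: "((nat \<Rightarrow> 'a::ring minf) \<times> (nat \<Rightarrow> 'a minf)) set" where
  "Lambda_rel = antisymmetrization T_seqs seq_le"

definition sized :: "(nat \<Rightarrow> nat) \<Rightarrow> (nat \<Rightarrow> 'a::ring minf) \<Rightarrow> bool" where
  "sized k u \<longleftrightarrow> (\<forall>n. u n \<in> mats (k (Suc n)) (k n) \<and>
     (\<exists>v \<in> mats (k (Suc n)) (k (Suc (Suc n))). \<exists>z \<in> mats (k (Suc n)) (k n).
        u n = v * u (Suc n) * z))"

definition Lambda_monoid :: "(nat \<Rightarrow> 'a::ring minf) set ordered_monoid" where
  "Lambda_monoid =
     \<lparr>carrier = T_seqs // Lambda_rel,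
      mult = (\<lambda>X Y. \<Union>{Lambda_rel `` {\<lambda>n. diag_sum (k (Suc n)) (k n) (u n) (u' n)} | u u' k k'.
        u \<in> X \<and> u' \<in> Y \<and> sized k u \<and> sized k' u'}),
      one = Lambda_rel `` {\<lambda>_. 0},
      mle = (\<lambda>X Y. \<exists>a\<in>X. \<exists>b\<in>Y. seq_le a b)\<rparr>"

definition S_monoid :: "(nat \<Rightarrow> 'a::ring minf) set ordered_monoid" where
  "S_monoid = Lambda_monoid \<lparr>carrier :=
     {Lambda_rel `` {x} | x. x \<in> T_seqs \<and> (\<forall>n. \<exists>y. y * x (Suc n) * x n = x n)}\<rparr>"

(* Upward directed sets are nonempty. *)
definition W_intervals :: "'a::ring minf set set set" where
  "W_intervals = {I. I \<subseteq> carrier W_monoid \<and> I \<noteq> {} \<and>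
     (\<forall>x\<in>I. \<forall>y\<in>I. \<exists>z\<in>I. mle W_monoid x z \<and> mle W_monoid y z) \<and>
     (\<forall>x\<in>I. \<forall>y\<in>carrier W_monoid. mle W_monoid y x \<longrightarrow> y \<in> I) \<and>
     (\<exists>C\<subseteq>I. countable C \<and> (\<forall>x\<in>I. \<exists>c\<in>C. mle W_monoid x c))}"

definition LambdaW_monoid :: "'a::ring minf set set ordered_monoid" where
  "LambdaW_monoid =
     \<lparr>carrier = W_intervals,
      mult = (\<lambda>I J. {z \<in> carrier W_monoid. \<exists>x\<in>I. \<exists>y\<in>J. mle W_monoid z (x \<otimes>\<^bsub>W_monoid\<^esub> y)}),
      one = {z \<in> carrier W_monoid. mle W_monoid z \<one>\<^bsub>W_monoid\<^esub>},
      mle = (\<subseteq>)\<rparr>"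

definition LambdaW_to_Lambda :: "'a::ring minf set set \<Rightarrow> (nat \<Rightarrow> 'a minf) set" where
  "LambdaW_to_Lambda I = \<Union>{Lambda_rel `` {a} | a. a \<in> T_seqs \<and>
     (\<forall>n. W_rel `` {a n} \<in> I) \<and> (\<forall>z\<in>I. \<exists>n. mle W_monoid z (W_rel `` {a n}))}"


section \<open>Right modules\<close>

(* As for the modules of HOL-Algebra, only the additive part of the ring record is used. *)
record ('a, 'm) rmod = "'m ring" +
  ract :: "'m \<Rightarrow> 'a \<Rightarrow> 'm" (infixl \<open>\<cdot>\<index>\<close> 70)

locale right_module = abelian_group M for M :: "('a::{ring,monoid_mult}, 'm) rmod" (structure) +
  assumes ract_closed [simp, intro]: "x \<in> carrier M \<Longrightarrow> x \<cdot> r \<in> carrier M"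
    and ract_add_left: "x \<in> carrier M \<Longrightarrow> y \<in> carrier M \<Longrightarrow> (x \<oplus> y) \<cdot> r = x \<cdot> r \<oplus> y \<cdot> r"
    and ract_add_right: "x \<in> carrier M \<Longrightarrow> x \<cdot> (r + s) = x \<cdot> r \<oplus> x \<cdot> s"
    and ract_mult: "x \<in> carrier M \<Longrightarrow> x \<cdot> (r * s) = x \<cdot> r \<cdot> s"
    and ract_one [simp]: "x \<in> carrier M \<Longrightarrow> x \<cdot> 1 = x"

definition rhom :: "('a, 'm) rmod \<Rightarrow> ('a, 'n) rmod \<Rightarrow> ('m \<Rightarrow> 'n) set" where
  "rhom M N = {f. f \<in> carrier M \<rightarrow> carrier N \<and>
     (\<forall>x\<in>carrier M. \<forall>y\<in>carrier M. f (x \<oplus>\<^bsub>M\<^esub> y) = f x \<oplus>\<^bsub>N\<^esub> f y) \<and>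
     (\<forall>x\<in>carrier M. \<forall>r. f (x \<cdot>\<^bsub>M\<^esub> r) = f x \<cdot>\<^bsub>N\<^esub> r)}"

definition rmod_iso :: "('a, 'm) rmod \<Rightarrow> ('a, 'n) rmod \<Rightarrow> bool" where
  "rmod_iso M N \<longleftrightarrow> (\<exists>f\<in>rhom M N. bij_betw f (carrier M) (carrier N))"

definition rsubmodule :: "('a, 'm) rmod \<Rightarrow> 'm set \<Rightarrow> bool" where
  "rsubmodule M X \<longleftrightarrow> X \<subseteq> carrier M \<and> \<zero>\<^bsub>M\<^esub> \<in> X \<and>
     (\<forall>x\<in>X. \<forall>y\<in>X. x \<oplus>\<^bsub>M\<^esub> y \<in> X) \<and> (\<forall>x\<in>X. \<forall>r. x \<cdot>\<^bsub>M\<^esub> r \<in> X)"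

definition rspan :: "('a, 'm) rmod \<Rightarrow> 'm set \<Rightarrow> 'm set" where
  "rspan M S = rsubmodule M hull S"

definition fg_submodule :: "('a, 'm) rmod \<Rightarrow> 'm set \<Rightarrow> bool" where
  "fg_submodule M X \<longleftrightarrow> (\<exists>S. finite S \<and> S \<subseteq> carrier M \<and> X = rspan M S)"

definition countably_generated :: "('a, 'm) rmod \<Rightarrow> bool" where
  "countably_generated M \<longleftrightarrow> (\<exists>S. countable S \<and> S \<subseteq> carrier M \<and> carrier M = rspan M S)"

definition direct_sum :: "('a, 'm) rmod \<Rightarrow> ('a, 'n) rmod \<Rightarrow> ('a, 'm \<times> 'n) rmod" where
  "direct_sum M N =
     \<lparr>carrier = carrier M \<times> carrier N, mult = undefined, one = undefined,
      zero = (\<zero>\<^bsub>M\<^esub>, \<zero>\<^bsub>N\<^esub>), add = (\<lambda>(x, y) (x', y'). (x \<oplus>\<^bsub>M\<^esub> x', y \<oplus>\<^bsub>N\<^esub> y')),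
      ract = (\<lambda>(x, y) r. (x \<cdot>\<^bsub>M\<^esub> r, y \<cdot>\<^bsub>N\<^esub> r))\<rparr>"

(* The free right module on I; the one on {..<n} consists of the columns of length n. *)
definition free_rmod :: "'i set \<Rightarrow> ('a::{ring,monoid_mult}, 'i \<Rightarrow> 'a) rmod" where
  "free_rmod I =
     \<lparr>carrier = {c. finite {i. c i \<noteq> 0} \<and> {i. c i \<noteq> 0} \<subseteq> I}, mult = undefined, one = undefined,
      zero = (\<lambda>_. 0), add = (\<lambda>c d i. c i + d i), ract = (\<lambda>c r i. c i * r)\<rparr>"

(* HOL cannot quantify over modules of all types. Lifting along surjections from modules on
   'm \<Rightarrow> 'a onto modules on 'm is enough: it covers the map from the free module on the carrier
   of P onto P, and so it gives lifting along all surjections (projective_lift below). *)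
definition projective :: "('a::{ring,monoid_mult}, 'm) rmod \<Rightarrow> bool" where
  "projective P \<longleftrightarrow> (\<forall>(M :: ('a, 'm \<Rightarrow> 'a) rmod) (N :: ('a, 'm) rmod) f g.
     right_module M \<and> right_module N \<and> f \<in> rhom M N \<and> f ` carrier M = carrier N \<and> g \<in> rhom P N
     \<longrightarrow> (\<exists>h\<in>rhom P M. \<forall>x\<in>carrier P. f (h x) = g x))"

definition cg_projective :: "('a::{ring,monoid_mult}, 'm) rmod set" where
  "cg_projective = {P. right_module P \<and> countably_generated P \<and> projective P}"

subsection \<open>Sequential direct limits\<close>

(* fold f [i..<k] is the transition map from stage i to stage k. *)
definition dlim_rel ::
  "(nat \<Rightarrow> ('a, 'm) rmod) \<Rightarrow> (nat \<Rightarrow> 'm \<Rightarrow> 'm) \<Rightarrow> ((nat \<times> 'm) \<times> (nat \<times> 'm)) set" where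
  "dlim_rel M f = {((i, v), (j, w)). v \<in> carrier (M i) \<and> w \<in> carrier (M j) \<and>
     (\<exists>k. i \<le> k \<and> j \<le> k \<and> fold f [i..<k] v = fold f [j..<k] w)}"

definition dlim ::
  "(nat \<Rightarrow> ('a, 'm) rmod) \<Rightarrow> (nat \<Rightarrow> 'm \<Rightarrow> 'm) \<Rightarrow> ('a, (nat \<times> 'm) set) rmod" where
  "dlim M f =
     \<lparr>carrier = (SIGMA i:UNIV. carrier (M i)) // dlim_rel M f, mult = undefined, one = undefined,
      zero = dlim_rel M f `` {(0, \<zero>\<^bsub>M 0\<^esub>)},
      add = (\<lambda>X Y. \<Union>{dlim_rel M f `` {(k, v \<oplus>\<^bsub>M k\<^esub> w)} | k v w. (k, v) \<in> X \<and> (k, w) \<in> Y}),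
      ract = (\<lambda>X r. \<Union>{dlim_rel M f `` {(k, v \<cdot>\<^bsub>M k\<^esub> r)} | k v. (k, v) \<in> X})\<rparr>"

definition mat_vec :: "'a::ring minf \<Rightarrow> (nat \<Rightarrow> 'a) \<Rightarrow> nat \<Rightarrow> 'a" where
  "mat_vec x v i = (\<Sum>k | v k \<noteq> 0. entry x i k * v k)"

definition is_limit_of ::
  "('a::{ring,monoid_mult}, 'm) rmod \<Rightarrow> (nat \<Rightarrow> nat) \<Rightarrow> (nat \<Rightarrow> 'a minf) \<Rightarrow> bool" where
  "is_limit_of P n x \<longleftrightarrow> rmod_iso P (dlim (\<lambda>i. free_rmod {..<n i}) (\<lambda>i. mat_vec (x i)))"


section \<open>Classes of countably generated projective modules\<close>

(* The classes are formed among modules carried by subsets of nat \<Rightarrow> 'a; up to isomorphism these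
   are all countably generated projective modules (cg_projective_representative below). *)

definition Vstar_rel ::
  "(('a::{ring,monoid_mult}, nat \<Rightarrow> 'a) rmod \<times> ('a, nat \<Rightarrow> 'a) rmod) set" where
  "Vstar_rel = {(P, Q). P \<in> cg_projective \<and> Q \<in> cg_projective \<and> rmod_iso P Q}"

definition Vstar_monoid :: "('a::{ring,monoid_mult}, nat \<Rightarrow> 'a) rmod set monoid" where
  "Vstar_monoid =
     \<lparr>carrier = cg_projective // Vstar_rel,
      mult = (\<lambda>X Y. {U \<in> cg_projective. \<exists>P\<in>X. \<exists>Q\<in>Y. rmod_iso U (direct_sum P Q)}),
      one = Vstar_rel `` {free_rmod {}}\<rparr>"

definition cp_le :: "('a, 'm) rmod \<Rightarrow> ('a, 'n) rmod \<Rightarrow> bool" (infix \<open>\<lesssim>\<^sub>C\<^sub>P\<close> 50) where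
  "P \<lesssim>\<^sub>C\<^sub>P Q \<longleftrightarrow> (\<forall>X. fg_submodule P X \<longrightarrow>
     (\<exists>\<alpha> \<in> rhom (P\<lparr>carrier := X\<rparr>) Q. \<exists>\<beta> \<in> rhom Q P. \<forall>x\<in>X. \<beta> (\<alpha> x) = x))"

definition CP_rel ::
  "(('a::{ring,monoid_mult}, nat \<Rightarrow> 'a) rmod \<times> ('a, nat \<Rightarrow> 'a) rmod) set" where
  "CP_rel = antisymmetrization cg_projective cp_le"

definition CP_monoid :: "('a::{ring,monoid_mult}, nat \<Rightarrow> 'a) rmod set ordered_monoid" where
  "CP_monoid =
     \<lparr>carrier = cg_projective // CP_rel,
      mult = (\<lambda>X Y. {U \<in> cg_projective. \<exists>P\<in>X. \<exists>Q\<in>Y.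
        U \<lesssim>\<^sub>C\<^sub>P direct_sum P Q \<and> direct_sum P Q \<lesssim>\<^sub>C\<^sub>P U}),
      one = CP_rel `` {free_rmod {}},
      mle = (\<lambda>X Y. \<exists>P\<in>X. \<exists>Q\<in>Y. P \<lesssim>\<^sub>C\<^sub>P Q)\<rparr>"

definition CP_to_S ::
  "('a::{ring,monoid_mult}, nat \<Rightarrow> 'a) rmod set \<Rightarrow> (nat \<Rightarrow> 'a minf) set" where
  "CP_to_S X = \<Union>{Lambda_rel `` {x} | P n x. P \<in> X \<and>
     (\<forall>i. x i \<in> mats (n (Suc i)) (n i) \<and>
       (\<exists>y \<in> mats (n (Suc i)) (n (Suc (Suc i))). y * x (Suc i) * x i = x i)) \<and>
     is_limit_of P n x}"

section \<open>Independence of the choice of types\<close>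

context right_module
begin

lemma ract_zero_right [simp]: "x \<in> carrier M \<Longrightarrow> x \<cdot> 0 = \<zero>"
proof -
  assume x: "x \<in> carrier M"
  then have "x \<cdot> 0 = x \<cdot> 0 \<oplus> x \<cdot> 0"
    using ract_add_right[of x 0 0] by simp
  with x show ?thesis by (metis ract_closed add.r_cancel_one')
qed

lemma ract_zero_left [simp]: "\<zero> \<cdot> r = \<zero>"
proof -
  have "\<zero> \<cdot> r = \<zero> \<cdot> r \<oplus> \<zero> \<cdot> r"
    using ract_add_left[of \<zero> \<zero> r] by simp
  then show ?thesis by (metis ract_closed zero_closed add.r_cancel_one')
qed

lemma ract_finsum:
  assumes "finite A" "b \<in> A \<rightarrow> carrier M"
  shows "finsum M b A \<cdot> r = finsum M (\<lambda>i. b i \<cdot> r) A"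
  using assms
proof (induction A)
  case (insert i A)
  then show ?case by (subst (1 2) finsum_insert) (auto simp: ract_add_left Pi_iff)
qed simp

definition lin :: "('i \<Rightarrow> 'm) \<Rightarrow> ('i \<Rightarrow> 'a) \<Rightarrow> 'm" where
  "lin b c = finsum M (\<lambda>i. b i \<cdot> c i) {i. c i \<noteq> 0}"

lemma lin_superset:
  assumes "b \<in> I \<rightarrow> carrier M" "finite A" "{i. c i \<noteq> 0} \<subseteq> A" "A \<subseteq> I"
  shows "lin b c = finsum M (\<lambda>i. b i \<cdot> c i) A"
  unfolding lin_def using assms by (intro add.finprod_mono_neutral_cong_left) (auto simp: Pi_iff subset_iff)

lemma lin_rhom:
  fixes b :: "'i \<Rightarrow> 'm"
  assumes b: "b \<in> I \<rightarrow> carrier M"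
  shows "lin b \<in> rhom (free_rmod I) M"
  unfolding rhom_def
proof (intro CollectI conjI ballI allI)
  show "lin b \<in> carrier (free_rmod I) \<rightarrow> carrier M"
    using b unfolding lin_def free_rmod_def by (auto intro!: finsum_closed)
next
  fix c d :: "'i \<Rightarrow> 'a" assume cd: "c \<in> carrier (free_rmod I)" "d \<in> carrier (free_rmod I)"
  let ?A = "{i. c i \<noteq> 0} \<union> {i. d i \<noteq> 0}"
  have A: "finite ?A" "?A \<subseteq> I" using cd by (auto simp: free_rmod_def)
  have "lin b (\<lambda>i. c i + d i) = finsum M (\<lambda>i. b i \<cdot> (c i + d i)) ?A"
    by (rule lin_superset[OF b A(1) _ A(2)]) auto
  also have "\<dots> = finsum M (\<lambda>i. b i \<cdot> c i \<oplus> b i \<cdot> d i) ?A"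
    using b A(2) by (intro finsum_cong') (auto simp: ract_add_right Pi_iff subset_iff)
  also have "\<dots> = finsum M (\<lambda>i. b i \<cdot> c i) ?A \<oplus> finsum M (\<lambda>i. b i \<cdot> d i) ?A"
    using b A(2) by (intro finsum_addf) auto
  also have "finsum M (\<lambda>i. b i \<cdot> c i) ?A = lin b c"
    by (rule lin_superset[OF b A(1) _ A(2), symmetric]) auto
  also have "finsum M (\<lambda>i. b i \<cdot> d i) ?A = lin b d"
    by (rule lin_superset[OF b A(1) _ A(2), symmetric]) auto
  finally show "lin b (c \<oplus>\<^bsub>free_rmod I\<^esub> d) = lin b c \<oplus> lin b d"
    by (simp add: free_rmod_def)
next
  fix c :: "'i \<Rightarrow> 'a" and r assume c: "c \<in> carrier (free_rmod I)"
  let ?A = "{i. c i \<noteq> 0}"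
  have A: "finite ?A" "?A \<subseteq> I" using c by (auto simp: free_rmod_def)
  have "lin b (\<lambda>i. c i * r) = finsum M (\<lambda>i. b i \<cdot> (c i * r)) ?A"
    by (rule lin_superset[OF b A(1) _ A(2)]) auto
  also have "\<dots> = finsum M (\<lambda>i. (b i \<cdot> c i) \<cdot> r) ?A"
    using b A(2) by (intro finsum_cong') (auto simp: ract_mult Pi_iff subset_iff)
  also have "\<dots> = lin b c \<cdot> r"
    unfolding lin_def using A b by (subst ract_finsum) auto
  finally show "lin b (c \<cdot>\<^bsub>free_rmod I\<^esub> r) = lin b c \<cdot> r"
    by (simp add: free_rmod_def)
qed

lemma lin_single:
  assumes "b i \<in> carrier M"
  shows "lin b (\<lambda>j. if j = i then 1 else 0) = b i"
proof -
  have "lin b (\<lambda>j. if j = i then 1 else 0) = finsum M (\<lambda>j. b j \<cdot> (if j = i then 1 else 0)) {i}"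
    using assms by (intro lin_superset[where I = "{i}"]) auto
  then show ?thesis using assms by simp
qed

end

lemma right_module_free: "right_module (free_rmod I :: ('a::{ring,monoid_mult}, 'i \<Rightarrow> 'a) rmod)"
proof -
  let ?F = "free_rmod I :: ('a, 'i \<Rightarrow> 'a) rmod"
  have cl: "(\<lambda>i. c i + d i) \<in> carrier ?F" if "c \<in> carrier ?F" "d \<in> carrier ?F" for c d
  proof -
    have "{i. c i + d i \<noteq> 0} \<subseteq> {i. c i \<noteq> 0} \<union> {i. d i \<noteq> 0}" by auto
    with that show ?thesis unfolding free_rmod_def by (auto intro: finite_subset)
  qed
  have "abelian_group ?F"
  proof (rule abelian_groupI)
    fix c assume c: "c \<in> carrier ?F"
    then have "(\<lambda>i. - c i) \<in> carrier ?F" by (simp add: free_rmod_def)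
    moreover have "(\<lambda>i. - c i) \<oplus>\<^bsub>?F\<^esub> c = \<zero>\<^bsub>?F\<^esub>" by (simp add: free_rmod_def)
    ultimately show "\<exists>d\<in>carrier ?F. d \<oplus>\<^bsub>?F\<^esub> c = \<zero>\<^bsub>?F\<^esub>" by blast
  qed (use cl in \<open>auto simp: free_rmod_def add_ac\<close>)
  moreover have "(\<lambda>i. c i * r) \<in> carrier ?F" if "c \<in> carrier ?F" for c r
    using that unfolding free_rmod_def
    by (auto intro: finite_subset[of _ "{i. c i \<noteq> 0}"])
  ultimately show ?thesis
    unfolding right_module_def right_module_axioms_def
    by (simp add: free_rmod_def distrib_left distrib_right mult.assoc)
qed

lemma rhom_comp: "f \<in> rhom M N \<Longrightarrow> g \<in> rhom N L \<Longrightarrow> (\<lambda>x. g (f x)) \<in> rhom M L"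
  by (auto simp: rhom_def Pi_iff)

lemma rhom_closed: "f \<in> rhom M N \<Longrightarrow> x \<in> carrier M \<Longrightarrow> f x \<in> carrier N"
  and rhom_add: "f \<in> rhom M N \<Longrightarrow> x \<in> carrier M \<Longrightarrow> y \<in> carrier M
    \<Longrightarrow> f (x \<oplus>\<^bsub>M\<^esub> y) = f x \<oplus>\<^bsub>N\<^esub> f y"
  and rhom_ract: "f \<in> rhom M N \<Longrightarrow> x \<in> carrier M \<Longrightarrow> f (x \<cdot>\<^bsub>M\<^esub> r) = f x \<cdot>\<^bsub>N\<^esub> r"
  by (auto simp: rhom_def)

lemma rhom_zero:
  assumes "right_module M" "right_module N" "f \<in> rhom M N"
  shows "f \<zero>\<^bsub>M\<^esub> = \<zero>\<^bsub>N\<^esub>"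
proof -
  interpret M: right_module M by fact
  interpret N: right_module N by fact
  have "f (\<zero>\<^bsub>M\<^esub> \<cdot>\<^bsub>M\<^esub> 0) = f \<zero>\<^bsub>M\<^esub> \<cdot>\<^bsub>N\<^esub> 0" "f \<zero>\<^bsub>M\<^esub> \<in> carrier N"
    using assms(3) M.zero_closed unfolding rhom_def by blast+
  then show ?thesis by simp
qed

lemma projective_lift:
  fixes P :: "('a::{ring,monoid_mult}, 'm) rmod" and M :: "('a, 'x) rmod" and N :: "('a, 'y) rmod"
  assumes P: "right_module P" "projective P" and M: "right_module M" and N: "right_module N"
    and f: "f \<in> rhom M N" "f ` carrier M = carrier N" and g: "g \<in> rhom P N"
  shows "\<exists>h\<in>rhom P M. \<forall>x\<in>carrier P. f (h x) = g x"
proof -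
  interpret P: right_module P by fact
  interpret M: right_module M by fact
  interpret N: right_module N by fact
  let ?I = "carrier P"
  let ?F = "free_rmod ?I :: ('a, 'm \<Rightarrow> 'a) rmod"
  have pi: "P.lin (\<lambda>x. x) \<in> rhom ?F P" by (rule P.lin_rhom) auto
  have surj: "P.lin (\<lambda>x. x) ` carrier ?F = carrier P"
  proof
    show "P.lin (\<lambda>x. x) ` carrier ?F \<subseteq> carrier P" using pi by (auto simp: rhom_def)
    show "carrier P \<subseteq> P.lin (\<lambda>x. x) ` carrier ?F"
    proof
      fix x assume x: "x \<in> carrier P"
      then have "x = P.lin (\<lambda>x. x) (\<lambda>j. if j = x then 1 else 0)"
        by (simp add: P.lin_single)
      moreover have "(\<lambda>j. if j = x then 1 else 0) \<in> carrier ?F"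
        using x by (auto simp: free_rmod_def)
      ultimately show "x \<in> P.lin (\<lambda>x. x) ` carrier ?F" by (rule image_eqI)
    qed
  qed
  have idP: "(\<lambda>x. x) \<in> rhom P P" by (auto simp: rhom_def)
  have "\<exists>h\<in>rhom P ?F. \<forall>x\<in>carrier P. P.lin (\<lambda>x. x) (h x) = x"
    by (rule P(2)[unfolded projective_def, rule_format, where N = P])
      (intro conjI right_module_free P(1) pi surj idP)
  then obtain s where s: "s \<in> rhom P ?F" "\<And>x. x \<in> carrier P \<Longrightarrow> P.lin (\<lambda>x. x) (s x) = x"
    by blast
  define m where "m x = inv_into (carrier M) f (g x)" for x
  have gx: "g x \<in> f ` carrier M" if "x \<in> carrier P" for x
    using rhom_closed[OF g that] f(2) by simp
  have m: "m \<in> ?I \<rightarrow> carrier M" "\<And>x. x \<in> ?I \<Longrightarrow> f (m x) = g x"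
    using inv_into_into[OF gx] f_inv_into_f[OF gx] by (simp_all add: m_def)
  have f0: "f \<zero>\<^bsub>M\<^esub> = \<zero>\<^bsub>N\<^esub>" and g0: "g \<zero>\<^bsub>P\<^esub> = \<zero>\<^bsub>N\<^esub>"
    using rhom_zero[OF M N f(1)] rhom_zero[OF P(1) N g] by simp_all
  have hom_sum: "f (finsum M (\<lambda>x. m x \<cdot>\<^bsub>M\<^esub> c x) A) = g (finsum P (\<lambda>x. x \<cdot>\<^bsub>P\<^esub> c x) A)"
    if "finite A" "A \<subseteq> ?I" for A and c :: "'m \<Rightarrow> 'a"
    using that
  proof (induction A)
    case empty
    show ?case by (simp add: f0 g0)
  next
    case (insert x A)
    have 1: "m x \<in> carrier M" "x \<in> ?I" "(\<lambda>x. m x \<cdot>\<^bsub>M\<^esub> c x) \<in> A \<rightarrow> carrier M"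
      "(\<lambda>x. x \<cdot>\<^bsub>P\<^esub> c x) \<in> A \<rightarrow> carrier P"
      using insert m(1) by auto
    have "finsum M (\<lambda>x. m x \<cdot>\<^bsub>M\<^esub> c x) (insert x A)
        = m x \<cdot>\<^bsub>M\<^esub> c x \<oplus>\<^bsub>M\<^esub> finsum M (\<lambda>x. m x \<cdot>\<^bsub>M\<^esub> c x) A"
      by (rule M.finsum_insert[OF insert.hyps 1(3) M.ract_closed[OF 1(1)]])
    then have "f (finsum M (\<lambda>x. m x \<cdot>\<^bsub>M\<^esub> c x) (insert x A))
        = f (m x) \<cdot>\<^bsub>N\<^esub> c x \<oplus>\<^bsub>N\<^esub> f (finsum M (\<lambda>x. m x \<cdot>\<^bsub>M\<^esub> c x) A)"
      using 1 M.finsum_closed[OF 1(3)] by (simp add: rhom_add[OF f(1)] rhom_ract[OF f(1)])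
    also have "\<dots> = g x \<cdot>\<^bsub>N\<^esub> c x \<oplus>\<^bsub>N\<^esub> g (finsum P (\<lambda>x. x \<cdot>\<^bsub>P\<^esub> c x) A)"
      using insert.IH insert.prems m(2)[OF 1(2)] by simp
    also have "\<dots> = g (x \<cdot>\<^bsub>P\<^esub> c x \<oplus>\<^bsub>P\<^esub> finsum P (\<lambda>x. x \<cdot>\<^bsub>P\<^esub> c x) A)"
      using 1 P.finsum_closed[OF 1(4)] by (simp add: rhom_add[OF g] rhom_ract[OF g])
    also have "x \<cdot>\<^bsub>P\<^esub> c x \<oplus>\<^bsub>P\<^esub> finsum P (\<lambda>x. x \<cdot>\<^bsub>P\<^esub> c x) A
        = finsum P (\<lambda>x. x \<cdot>\<^bsub>P\<^esub> c x) (insert x A)"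
      by (rule P.finsum_insert[OF insert.hyps 1(4) P.ract_closed[OF 1(2)], symmetric])
    finally show ?case .
  qed
  show ?thesis
  proof (rule bexI[of _ "\<lambda>x. M.lin m (s x)"], rule ballI)
    show "(\<lambda>x. M.lin m (s x)) \<in> rhom P M"
      by (rule rhom_comp[OF s(1) M.lin_rhom[OF m(1)]])
    fix x assume x: "x \<in> carrier P"
    have "s x \<in> carrier ?F" by (rule rhom_closed[OF s(1) x])
    then have "finite {i. s x i \<noteq> 0}" "{i. s x i \<noteq> 0} \<subseteq> ?I" by (simp_all add: free_rmod_def)
    from hom_sum[OF this, of "s x"] show "f (M.lin m (s x)) = g x"
      unfolding M.lin_def[symmetric] P.lin_def[symmetric] s(2)[OF x] .
  qed
qed

lemma rhom_inv:
  assumes P: "right_module P" and f: "f \<in> rhom P Q" "bij_betw f (carrier P) (carrier Q)"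
  shows "inv_into (carrier P) f \<in> rhom Q P"
proof -
  interpret P: right_module P by fact
  let ?g = "inv_into (carrier P) f"
  have g: "?g y \<in> carrier P" "f (?g y) = y" if "y \<in> carrier Q" for y
    using that f(2) by (auto simp: bij_betw_def inv_into_into f_inv_into_f)
  have gf: "?g (f x) = x" if "x \<in> carrier P" for x
    using that f(2) by (simp add: bij_betw_def)
  have "?g (x \<oplus>\<^bsub>Q\<^esub> y) = ?g x \<oplus>\<^bsub>P\<^esub> ?g y" if "x \<in> carrier Q" "y \<in> carrier Q" for x y
  proof -
    have "f (?g x \<oplus>\<^bsub>P\<^esub> ?g y) = x \<oplus>\<^bsub>Q\<^esub> y" using f(1) g that by (auto simp: rhom_def)
    then show ?thesis using gf[of "?g x \<oplus>\<^bsub>P\<^esub> ?g y"] g that by auto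
  qed
  moreover have "?g (x \<cdot>\<^bsub>Q\<^esub> r) = ?g x \<cdot>\<^bsub>P\<^esub> r" if "x \<in> carrier Q" for x r
  proof -
    have "f (?g x \<cdot>\<^bsub>P\<^esub> r) = x \<cdot>\<^bsub>Q\<^esub> r" using f(1) g that by (auto simp: rhom_def)
    then show ?thesis using gf[of "?g x \<cdot>\<^bsub>P\<^esub> r"] g that by auto
  qed
  ultimately show ?thesis using g by (auto simp: rhom_def)
qed

lemma rspan_least: "rsubmodule M X \<Longrightarrow> S \<subseteq> X \<Longrightarrow> rspan M S \<subseteq> X"
  unfolding rspan_def by (rule hull_minimal)

lemma rsubmodule_rspan:
  assumes "right_module M" "S \<subseteq> carrier M"
  shows "rsubmodule M (rspan M S)" "S \<subseteq> rspan M S"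
proof -
  interpret right_module M by fact
  have "rsubmodule M (carrier M)" by (auto simp: rsubmodule_def)
  then have "rspan M S \<subseteq> carrier M" using assms by (intro rspan_least)
  then show "rsubmodule M (rspan M S)"
    by (auto simp: rspan_def hull_def rsubmodule_def)
  show "S \<subseteq> rspan M S" unfolding rspan_def by (rule hull_subset)
qed

(* Every countably generated projective module P has an isomorphic copy carried by nat \<Rightarrow> 'a. *)
lemma cg_projective_representative:
  fixes P :: "('a::{ring,monoid_mult}, 'm) rmod"
  assumes "P \<in> cg_projective"
  shows "\<exists>Q :: ('a, nat \<Rightarrow> 'a) rmod. Q \<in> cg_projective \<and> rmod_iso P Q"
proof -
  have P: "right_module P" "countably_generated P" "projective P"
    using assms by (auto simp: cg_projective_def)
  interpret P: right_module P by fact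
  obtain S where S: "countable S" "S \<subseteq> carrier P" "carrier P = rspan P S"
    using P(2) by (auto simp: countably_generated_def)
  define b where "b = from_nat_into (insert \<zero>\<^bsub>P\<^esub> S)"
  have rb: "range b = insert \<zero>\<^bsub>P\<^esub> S"
    unfolding b_def using S(1) by (intro range_from_nat_into) auto
  let ?F = "free_rmod UNIV :: ('a, nat \<Rightarrow> 'a) rmod"
  interpret F: right_module ?F by (rule right_module_free)
  have b: "b \<in> UNIV \<rightarrow> carrier P"
    using rb S(2) by (metis P.zero_closed Pi_I insert_iff rangeI subsetD)
  have lin: "P.lin b \<in> rhom ?F P" by (rule P.lin_rhom[OF b])
  have "\<zero>\<^bsub>P\<^esub> = P.lin b (\<zero>\<^bsub>?F\<^esub>)" by (simp add: P.lin_def free_rmod_def)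
  then have zero: "\<zero>\<^bsub>P\<^esub> \<in> P.lin b ` carrier ?F" by (metis F.zero_closed imageI)
  have sub: "rsubmodule P (P.lin b ` carrier ?F)"
    unfolding rsubmodule_def
  proof (intro conjI ballI allI)
    show "P.lin b ` carrier ?F \<subseteq> carrier P" using lin by (auto simp: rhom_def)
    show "\<zero>\<^bsub>P\<^esub> \<in> P.lin b ` carrier ?F" using zero by simp
  next
    fix x y assume "x \<in> P.lin b ` carrier ?F" "y \<in> P.lin b ` carrier ?F"
    then obtain c d where "c \<in> carrier ?F" "d \<in> carrier ?F" "x = P.lin b c" "y = P.lin b d" by blast
    moreover from this have "P.lin b (c \<oplus>\<^bsub>?F\<^esub> d) = P.lin b c \<oplus>\<^bsub>P\<^esub> P.lin b d"
      using lin by (auto simp: rhom_def)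
    ultimately show "x \<oplus>\<^bsub>P\<^esub> y \<in> P.lin b ` carrier ?F" by (metis F.a_closed imageI)
  next
    fix x r assume "x \<in> P.lin b ` carrier ?F"
    then obtain c where "c \<in> carrier ?F" "x = P.lin b c" by blast
    moreover from this have "P.lin b (c \<cdot>\<^bsub>?F\<^esub> r) = P.lin b c \<cdot>\<^bsub>P\<^esub> r"
      using lin by (auto simp: rhom_def)
    ultimately show "x \<cdot>\<^bsub>P\<^esub> r \<in> P.lin b ` carrier ?F" by (metis F.ract_closed imageI)
  qed
  have "x \<in> P.lin b ` carrier ?F" if "x \<in> S" for x
  proof -
    have "x \<in> range b" using that rb by simp
    then obtain i where "x = b i" by blast
    moreover have "b i \<in> carrier P" using b by auto
    ultimately show ?thesis
      using P.lin_single[of b i]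
      by (intro image_eqI[where x = "\<lambda>j. if j = i then 1 else 0"]) (auto simp: free_rmod_def)
  qed
  then have "rspan P S \<subseteq> P.lin b ` carrier ?F" by (intro rspan_least sub) auto
  then have "\<forall>x\<in>carrier P. \<exists>y. P.lin b y = x" using S(3) by auto
  then obtain c where c: "\<And>x. x \<in> carrier P \<Longrightarrow> P.lin b (c x) = x" by metis
  have inj: "inj_on c (carrier P)" by (rule inj_on_inverseI[of _ "P.lin b"]) (rule c)
  define d where "d = inv_into (carrier P) c"
  have dc [simp]: "d (c x) = x" if "x \<in> carrier P" for x
    using that inj by (simp add: d_def)
  define Q :: "('a, nat \<Rightarrow> 'a) rmod" where "Q =
    \<lparr>carrier = c ` carrier P, mult = undefined, one = undefined, zero = c \<zero>\<^bsub>P\<^esub>,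
     add = (\<lambda>x y. c (d x \<oplus>\<^bsub>P\<^esub> d y)), ract = (\<lambda>x r. c (d x \<cdot>\<^bsub>P\<^esub> r))\<rparr>"
  have ch: "c \<in> rhom P Q" by (auto simp: rhom_def Q_def)
  have bij: "bij_betw c (carrier P) (carrier Q)" using inj by (simp add: bij_betw_def Q_def)
  have "abelian_group Q"
  proof (rule abelian_groupI)
    fix x assume "x \<in> carrier Q"
    then obtain x' where "x = c x'" "x' \<in> carrier P" by (auto simp: Q_def)
    then have "c (\<ominus>\<^bsub>P\<^esub> x') \<in> carrier Q" "c (\<ominus>\<^bsub>P\<^esub> x') \<oplus>\<^bsub>Q\<^esub> x = \<zero>\<^bsub>Q\<^esub>"
      by (auto simp: Q_def P.l_neg)
    then show "\<exists>y\<in>carrier Q. y \<oplus>\<^bsub>Q\<^esub> x = \<zero>\<^bsub>Q\<^esub>" by blast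
  qed (auto simp: Q_def P.a_assoc P.a_comm P.a_lcomm)
  then have Q: "right_module Q"
    unfolding right_module_def right_module_axioms_def
    by (auto simp: Q_def P.ract_add_left P.ract_add_right P.ract_mult)
  interpret Q: right_module Q by fact
  have dh: "d \<in> rhom Q P" unfolding d_def by (rule rhom_inv[OF P(1) ch bij])
  have cd: "c (d x) = x" if "x \<in> carrier Q" for x using that by (auto simp: Q_def)
  have "countably_generated Q"
  proof -
    have cS: "c ` S \<subseteq> carrier Q" using S(2) by (auto simp: Q_def)
    let ?X = "{x \<in> carrier P. c x \<in> rspan Q (c ` S)}"
    note r = rsubmodule_rspan[OF Q cS]
    have "\<zero>\<^bsub>Q\<^esub> \<in> rspan Q (c ` S)" using r(1) by (simp add: rsubmodule_def)
    then have "c \<zero>\<^bsub>P\<^esub> \<in> rspan Q (c ` S)" by (simp add: Q_def)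
    then have "rsubmodule P ?X"
      using r(1) ch by (auto simp: rsubmodule_def rhom_def)
    then have "rspan P S \<subseteq> ?X"
      using S(2) r(2) by (intro rspan_least) auto
    then have "carrier P \<subseteq> ?X" using S(3) by simp
    then have "carrier Q \<subseteq> rspan Q (c ` S)" by (auto simp: Q_def)
    with r(1) have "carrier Q = rspan Q (c ` S)" by (auto simp: rsubmodule_def)
    moreover have "countable (c ` S)" using S(1) by (rule countable_image)
    ultimately show ?thesis using cS unfolding countably_generated_def by blast
  qed
  moreover have "projective Q"
    unfolding projective_def
  proof (intro allI impI, elim conjE)
    fix M :: "('a, (nat \<Rightarrow> 'a) \<Rightarrow> 'a) rmod" and N :: "('a, nat \<Rightarrow> 'a) rmod" and f g
    assume *: "right_module M" "right_module N" "f \<in> rhom M N" "f ` carrier M = carrier N"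
      "g \<in> rhom Q N"
    obtain h where h: "h \<in> rhom P M" "\<forall>x\<in>carrier P. f (h x) = g (c x)"
      using projective_lift[OF P(1,3) *(1-4) rhom_comp[OF ch *(5)]] by blast
    show "\<exists>h\<in>rhom Q M. \<forall>x\<in>carrier Q. f (h x) = g x"
    proof (intro bexI[of _ "\<lambda>x. h (d x)"] ballI)
      show "f (h (d x)) = g x" if "x \<in> carrier Q" for x
      proof -
        have "d x \<in> carrier P" using that dh by (auto simp: rhom_def)
        then show ?thesis using h(2) cd[OF that] by metis
      qed
    qed (rule rhom_comp[OF dh h(1)])
  qed
  ultimately show ?thesis
    using Q ch bij unfolding cg_projective_def rmod_iso_def by blast
qed

end

theory Submission
  imports Defs
begin

text \<open>
  Over a regular ring every finitely supported matrix is regular, so each class of \<open>W(R)\<close> contains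
  an idempotent, and every sequence in \<open>T(R)\<close> is equivalent to an increasing sequence
  \<open>e 0 \<le> e 1 \<le> \<dots>\<close> of idempotents; the countably generated projective modules are, up to isomorphism,
  the unions of the images of such sequences. The triangular comparison adds nothing to \<open>\<lesssim>\<^sub>1\<close>, because
  \<open>diag(c, d)\<close> arises from the triangular matrix with blocks \<open>c, e, d\<close> by multiplication on both sides
  as soon as \<open>d = d d' d\<close>.

  Unit-regularity enters through cancellation: a unit-regular corner has stable range one, so it cancels
  (Evans), and hence so does every idempotent. Cancellation makes mutually comparable idempotents
  equivalent, and it extends a partial isomorphism between two increasing sequences of idempotents to
  any later term. A back-and-forth construction then turns mutual comparison of modules into an
  isomorphism, and its forth half turns comparison into an embedding.
\<close>

section \<open>Matrix units and embeddings\<close>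

text \<open>The ring of finitely supported matrices has no identity, so \<open>1 - e\<close> is
  never available. The truncations \<open>unit_mat n\<close> serve as local units, complements are
  formed inside a larger idempotent, and \<open>embed_mat\<close> moves matrices to unoccupied rows
  and columns whenever orthogonality is wanted. For this reason cancellation is reduced to
  \<open>unit_mat n\<close>, a sum of \<open>n\<close> orthogonal corners, each a copy of the base
  ring. Those corners are the one place where inverses, and not just regularity, are used.

  Equivalence of idempotents stage by stage would not identify two unions: the isomorphisms chosen
  at successive stages must restrict to one another. Hence cancellation is applied to complements,
  so that a given partial isomorphism is extended and not merely replaced.

  Modules may live on unrelated carrier types, and a direct sum changes the type. All statements on
  modules are therefore translated into \<open>seq_le\<close> between idempotent sequences by the
  predicate \<open>represents\<close>; transitivity, additivity and well-definedness are then proved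
  for sequences.\<close>

lift_definition unit_mat :: "nat \<Rightarrow> 'a::{ring,monoid_mult} minf"
  is "\<lambda>n i j. if i = j \<and> i < n then 1 else 0"
  subgoal for n by (rule finite_subset[of _ "{..<n} \<times> {..<n}"]) auto
  done

lift_definition single :: "nat \<Rightarrow> nat \<Rightarrow> 'a \<Rightarrow> 'a::zero minf"
  is "\<lambda>p q r i j. if i = p \<and> j = q then r else 0"
  subgoal for p q r by (rule finite_subset[of _ "{(p, q)}"]) auto
  done

text \<open>For injective \<open>\<sigma>\<close> and \<open>\<tau>\<close> this moves the entry
  \<open>(i, j)\<close> to \<open>(\<sigma> i, \<tau> j)\<close>. It stands for multiplication by
  infinite 0-1 matrices, which do not belong to the ring; \<open>embed_mult\<close> supplies the
  calculus that such products would give.\<close>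

lift_definition embed_mat :: "(nat \<Rightarrow> nat) \<Rightarrow> (nat \<Rightarrow> nat) \<Rightarrow> 'a minf \<Rightarrow> 'a::zero minf"
  is "\<lambda>\<sigma> \<tau> a i j. if i \<in> range \<sigma> \<and> j \<in> range \<tau> then a (inv_into UNIV \<sigma> i) (inv_into UNIV \<tau> j) else 0"
  subgoal for \<sigma> \<tau> a
  proof (rule finite_subset[of _ "(\<lambda>(i, j). (\<sigma> i, \<tau> j)) ` {(i, j). a i j \<noteq> 0}"])
    show "{(i, j). (if i \<in> range \<sigma> \<and> j \<in> range \<tau> then a (inv_into UNIV \<sigma> i) (inv_into UNIV \<tau> j) else 0) \<noteq> 0}
        \<subseteq> (\<lambda>(i, j). (\<sigma> i, \<tau> j)) ` {(i, j). a i j \<noteq> 0}"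
    proof (rule subrelI)
      fix i j assume *: "(i, j) \<in> {(i, j). (if i \<in> range \<sigma> \<and> j \<in> range \<tau>
        then a (inv_into UNIV \<sigma> i) (inv_into UNIV \<tau> j) else 0) \<noteq> 0}"
      then have "\<sigma> (inv_into UNIV \<sigma> i) = i" "\<tau> (inv_into UNIV \<tau> j) = j"
        by (auto intro!: f_inv_into_f split: if_splits)
      with * show "(i, j) \<in> (\<lambda>(i, j). (\<sigma> i, \<tau> j)) ` {(i, j). a i j \<noteq> 0}"
        by (intro image_eqI[where x = "(inv_into UNIV \<sigma> i, inv_into UNIV \<tau> j)"])
          (auto split: if_splits)
    qed
  qed simp
  done

abbreviation shift :: "nat \<Rightarrow> nat \<Rightarrow> nat" where
  "shift n \<equiv> (\<lambda>i. i + n)"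

lemma inj_shift: "inj (shift n)"
  by (simp add: inj_on_def)

lemma range_shift: "range (shift n) = {n..}"
  by (auto simp: image_iff) (metis add.commute le_Suc_ex)

lemma inv_shift: "n \<le> i \<Longrightarrow> inv_into UNIV (shift n) i = i - n"
  using inv_f_f[OF inj_shift, of n "i - n"] by simp

lemma entry_embed_shift:
  "entry (embed_mat (shift m) (shift n) a) i j
    = (if m \<le> i \<and> n \<le> j then entry a (i - m) (j - n) else 0)"
  by (simp add: embed_mat.rep_eq range_shift inv_shift)

text \<open>The lower bound \<open>n0\<close> is what later lets increasing sizes be chosen for a
  whole sequence of matrices.\<close>

lemma ex_mats: "\<exists>n\<ge>n0. a \<in> mats n n"
proof -
  let ?S = "{(i, j). entry a i j \<noteq> 0}"
  have "finite ?S" using entry[of a] by simp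
  then have "finite (fst ` ?S \<union> snd ` ?S)" by simp
  then obtain n where n: "\<forall>x\<in>fst ` ?S \<union> snd ` ?S. x < n"
    using finite_nat_set_iff_bounded by blast
  have "i < n \<and> j < n" if "entry a i j \<noteq> 0" for i j
  proof -
    have "(i, j) \<in> ?S" using that by simp
    then have "i \<in> fst ` ?S" "j \<in> snd ` ?S" by (metis image_eqI fst_conv, metis image_eqI snd_conv)
    then show ?thesis using n by blast
  qed
  then have "a \<in> mats (max n n0) (max n n0)" by (simp add: mats_def less_max_iff_disj)
  then show ?thesis by (intro exI[of _ "max n n0"]) simp
qed

lemma mats_mono: "a \<in> mats m n \<Longrightarrow> m \<le> m' \<Longrightarrow> n \<le> n' \<Longrightarrow> a \<in> mats m' n'"
  by (fastforce simp: mats_def)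

lemma entry_unit_mult: "entry (unit_mat m * a) i j = (if i < m then entry a i j else 0)"
  by (subst entry_times_superset[where K = "{i}"]) (auto simp: unit_mat.rep_eq split: if_splits)

lemma entry_mult_unit: "entry (a * unit_mat n) i j = (if j < n then entry a i j else 0)"
proof -
  have "entry (a * unit_mat n) i j = (\<Sum>k\<in>insert j {k. entry a i k \<noteq> 0}. entry a i k * entry (unit_mat n) k j)"
    by (rule entry_times_superset) auto
  also have "\<dots> = (\<Sum>k\<in>{j}. entry a i k * entry (unit_mat n) k j)"
    by (rule sum.mono_neutral_right) (auto simp: unit_mat.rep_eq)
  finally show ?thesis by (simp add: unit_mat.rep_eq)
qed

text \<open>Support conditions become equations with local units, so block arguments can be carried
  out by associativity.\<close>

lemma mats_iff: "a \<in> mats m n \<longleftrightarrow> unit_mat m * a = a \<and> a * unit_mat n = a"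
proof
  assume "a \<in> mats m n"
  then show "unit_mat m * a = a \<and> a * unit_mat n = a"
    by (intro conjI minf_eqI) (auto simp: entry_unit_mult entry_mult_unit mats_def)
next
  assume *: "unit_mat m * a = a \<and> a * unit_mat n = a"
  have "entry (unit_mat m * a * unit_mat n) i j \<noteq> 0 \<longrightarrow> i < m \<and> j < n" for i j
    by (simp add: entry_unit_mult entry_mult_unit)
  then show "a \<in> mats m n" using * by (simp add: mats_def)
qed

lemma unit_mat_idem: "unit_mat n * unit_mat n = unit_mat n"
  by (rule minf_eqI) (simp add: entry_unit_mult unit_mat.rep_eq)

lemma mats_sandwich:
  fixes a b x :: "'a::{ring,monoid_mult} minf"
  assumes "a \<in> mats l m" "b \<in> mats m' n"
  shows "a * x * b \<in> mats l n"
proof -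
  have "unit_mat l * (a * x * b) = (unit_mat l * a) * x * b"
    "a * x * b * unit_mat n = a * x * (b * unit_mat n)" by (simp_all only: mult.assoc)
  then show ?thesis using assms by (simp add: mats_iff)
qed

lemma mats_mult:
  fixes a b :: "'a::{ring,monoid_mult} minf"
  assumes "a \<in> mats l m" "b \<in> mats m' n"
  shows "a * b \<in> mats l n"
  using mats_sandwich[OF assms, of "unit_mat m"] assms by (simp add: mats_iff)

lemma unit_mat_mats: "unit_mat n \<in> mats n n"
  by (simp add: mats_iff unit_mat_idem)

lemma mats_cut: "unit_mat m * a * unit_mat n \<in> mats m n"
  by (rule mats_sandwich[OF unit_mat_mats unit_mat_mats])

lemma mats_diff: "(a::'a::ring minf) \<in> mats m n \<Longrightarrow> b \<in> mats m n \<Longrightarrow> a - b \<in> mats m n"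
  by (auto simp: mats_def minus_minf.rep_eq) (metis diff_0_right diff_self)+

text \<open>The map \<open>\<tau>\<close> reindexes the summation variable, which is why its
  injectivity is the one asked for. If the inner maps have disjoint ranges, the product vanishes
  (\<open>embed_orth\<close>).\<close>

lemma embed_mult:
  assumes "inj \<tau>"
  shows "embed_mat \<sigma> \<tau> a * embed_mat \<tau> \<rho> b = embed_mat \<sigma> \<rho> (a * b)"
proof (rule minf_eqI)
  fix i j
  show "entry (embed_mat \<sigma> \<tau> a * embed_mat \<tau> \<rho> b) i j = entry (embed_mat \<sigma> \<rho> (a * b)) i j"
  proof (cases "i \<in> range \<sigma>")
    case True
    let ?K = "{k. entry a (inv_into UNIV \<sigma> i) k \<noteq> 0}"
    have "entry (embed_mat \<sigma> \<tau> a * embed_mat \<tau> \<rho> b) i j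
        = (\<Sum>k\<in>\<tau> ` ?K. entry (embed_mat \<sigma> \<tau> a) i k * entry (embed_mat \<tau> \<rho> b) k j)"
      by (rule entry_times_superset) (use assms True in \<open>auto simp: embed_mat.rep_eq split: if_splits\<close>)
    also have "\<dots> = (\<Sum>k\<in>?K. entry (embed_mat \<sigma> \<tau> a) i (\<tau> k) * entry (embed_mat \<tau> \<rho> b) (\<tau> k) j)"
      by (rule sum.reindex_cong[of \<tau>]) (use assms in \<open>auto simp: inj_on_def\<close>)
    also have "\<dots> = entry (embed_mat \<sigma> \<rho> (a * b)) i j"
      using True assms by (simp add: embed_mat.rep_eq times_minf.rep_eq)
    finally show ?thesis .
  next
    case False
    then show ?thesis by (simp add: embed_mat.rep_eq times_minf.rep_eq)
  qed
qed

lemma embed_id [simp]: "embed_mat id id a = a"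
  by (rule minf_eqI) (simp add: embed_mat.rep_eq)

lemma embed_orth:
  assumes "range \<tau> \<inter> range \<tau>' = {}"
  shows "embed_mat \<sigma> \<tau> a * embed_mat \<tau>' \<rho> b = 0"
proof (rule minf_eqI)
  fix i j
  have "(\<Sum>k | entry (embed_mat \<sigma> \<tau> a) i k \<noteq> 0. entry (embed_mat \<sigma> \<tau> a) i k * entry (embed_mat \<tau>' \<rho> b) k j) = 0"
    by (rule sum.neutral) (use assms in \<open>auto simp: embed_mat.rep_eq\<close>)
  then show "entry (embed_mat \<sigma> \<tau> a * embed_mat \<tau>' \<rho> b) i j = entry 0 i j"
    by (simp add: times_minf.rep_eq zero_minf.rep_eq)
qed

lemma embed_0 [simp]: "embed_mat \<sigma> \<tau> 0 = 0"
  by (rule minf_eqI) (simp add: embed_mat.rep_eq zero_minf.rep_eq)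

lemma
  fixes a :: "'a::{ring,monoid_mult} minf"
  shows mats_mult_shift: "a \<in> mats m n \<Longrightarrow> a * embed_mat (shift n) \<tau> b = 0"
    and shift_mult_mats: "a \<in> mats m n \<Longrightarrow> embed_mat \<sigma> (shift m) b * a = 0"
proof -
  have "unit_mat n * embed_mat (shift n) \<tau> b = 0" for b :: "'a minf"
    by (rule minf_eqI) (simp add: entry_unit_mult embed_mat.rep_eq zero_minf.rep_eq range_shift)
  moreover have "embed_mat \<sigma> (shift m) b * unit_mat m = 0" for b :: "'a minf"
    by (rule minf_eqI) (simp add: entry_mult_unit embed_mat.rep_eq zero_minf.rep_eq range_shift)
  ultimately have "a * unit_mat n * embed_mat (shift n) \<tau> b = 0"
    "embed_mat \<sigma> (shift m) b * (unit_mat m * a) = 0"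
    by (simp only: mult.assoc mult_zero_right, simp only: mult_zero_left flip: mult.assoc)
  then show "a \<in> mats m n \<Longrightarrow> a * embed_mat (shift n) \<tau> b = 0"
    "a \<in> mats m n \<Longrightarrow> embed_mat \<sigma> (shift m) b * a = 0"
    by (simp_all add: mats_iff)
qed

lemma diag_sum_eq: "a \<in> mats m n \<Longrightarrow> diag_sum m n a b = a + embed_mat (shift m) (shift n) b"
  by (rule minf_eqI)
    (auto simp: diag_sum_def block.rep_eq plus_minf.rep_eq entry_embed_shift zero_minf.rep_eq mats_def)

text \<open>The cuts repeat those built into \<open>block\<close>: the upper left block is truncated
  on both sides, the upper right one in its rows, the lower right one not at all.\<close>

lemma block_eq:
  fixes c d e :: "'a::{ring,monoid_mult} minf"
  shows "block m n c e 0 d = unit_mat m * c * unit_mat n + unit_mat m * embed_mat id (shift n) e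
    + embed_mat (shift m) (shift n) d"
  by (rule minf_eqI)
    (auto simp: block.rep_eq plus_minf.rep_eq entry_embed_shift zero_minf.rep_eq entry_unit_mult
      entry_mult_unit embed_mat.rep_eq range_shift inv_shift mult.assoc)


section \<open>Regularity of matrices\<close>

text \<open>This is McCoy's lemma. It lets a quasi-inverse be assembled while a matrix is cleared
  piece by piece.\<close>

lemma regular_reduce:
  fixes a x y :: "'b::ring"
  assumes "a - a * x * a = (a - a * x * a) * y * (a - a * x * a)"
  shows "\<exists>z. a = a * z * a"
proof
  have "a = (a - a * x * a) * y * (a - a * x * a) + a * x * a" by (subst assms[symmetric]) simp
  also have "\<dots> = a * (x + y - x * a * y - y * a * x + x * a * y * a * x) * a"
    by (simp add: algebra_simps)
  finally show "a = a * (x + y - x * a * y - y * a * x + x * a * y * a * x) * a" .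
qed

lemma entry_mult_single: "entry (a * single p q r) i j = (if j = q then entry a i p * r else 0)"
proof -
  have "entry (a * single p q r) i j
      = (\<Sum>k\<in>insert p {k. entry a i k \<noteq> 0}. entry a i k * entry (single p q r) k j)"
    by (rule entry_times_superset) auto
  also have "\<dots> = (\<Sum>k\<in>{p}. entry a i k * entry (single p q r) k j)"
    by (rule sum.mono_neutral_right) (auto simp: single.rep_eq)
  finally show ?thesis by (simp add: single.rep_eq)
qed

lemma entry_single_mult: "entry (single p q r * a) i j = (if i = p then r * entry a q j else 0)"
  by (subst entry_times_superset[where K = "{q}"]) (auto simp: single.rep_eq split: if_splits)

text \<open>Let \<open>x\<close> have a quasi-inverse \<open>u\<close> of the last entry in position
  \<open>(j, m)\<close>. Then \<open>a * x * a\<close> has entries \<open>a i j * u * a m k\<close>,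
  so subtracting it from \<open>a\<close> clears the last row. McCoy's lemma closes the induction on
  the number of rows.\<close>

lemma column_regular:
  fixes a :: "'a::{ring,monoid_mult} minf"
  assumes R: "\<And>x::'a. \<exists>u. x = x * u * x" and "a \<in> mats m n" "\<And>i k. entry a i k \<noteq> 0 \<Longrightarrow> k = j"
  shows "\<exists>z. a = a * z * a"
  using assms(2,3)
proof (induction m arbitrary: a)
  case 0
  then have "a = 0" by (intro minf_eqI) (auto simp: mats_def zero_minf.rep_eq)
  then show ?case by simp
next
  case (Suc m)
  obtain u where u: "entry a m j = entry a m j * u * entry a m j" using R by blast
  let ?x = "single j m u"
  have ax: "entry (a * ?x * a) i k = entry a i j * u * entry a m k" for i k
    by (subst entry_times_superset[where K = "{m}"]) (auto simp: entry_mult_single split: if_splits)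
  have 1: "a - a * ?x * a \<in> mats m n"
    unfolding mats_def
  proof (intro CollectI allI impI)
    fix i k assume *: "entry (a - a * ?x * a) i k \<noteq> 0"
    then have "entry a i k \<noteq> 0 \<or> entry a i j \<noteq> 0 \<and> entry a m k \<noteq> 0"
      by (auto simp: minus_minf.rep_eq ax)
    moreover from this have "k = j" using Suc.prems(2) by blast
    ultimately have "i < Suc m" "k < n" using Suc.prems(1) by (auto simp: mats_def)
    moreover have "i \<noteq> m" using * u[symmetric] \<open>k = j\<close> by (auto simp: minus_minf.rep_eq ax)
    ultimately show "i < m \<and> k < n" by simp
  qed
  have "\<exists>z. a - a * ?x * a = (a - a * ?x * a) * z * (a - a * ?x * a)"
  proof (rule Suc.IH[OF 1])
    fix i k assume "entry (a - a * ?x * a) i k \<noteq> 0"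
    then have "entry a i k \<noteq> 0 \<or> entry a m k \<noteq> 0"
      by (auto simp: minus_minf.rep_eq ax)
    then show "k = j" using Suc.prems(2) by blast
  qed
  then show ?case by (elim exE) (rule regular_reduce)
qed

text \<open>Columns are cleared from the right. The square shape is given up at the start, so that
  the row bound stays fixed while the column bound is the induction variable.\<close>

lemma minf_regular:
  fixes a :: "'a::{ring,monoid_mult} minf"
  assumes R: "\<And>x::'a. \<exists>u. x = x * u * x"
  shows "\<exists>z. a = a * z * a"
proof -
  obtain m where "a \<in> mats m m" using ex_mats[of 0 a] by blast
  then have "\<exists>n. a \<in> mats m n" by blast
  then obtain n where "a \<in> mats m n" by blast
  then show ?thesis
  proof (induction n arbitrary: a)
    case 0
    then have "a = 0" by (intro minf_eqI) (auto simp: mats_def zero_minf.rep_eq)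
    then show ?case by simp
  next
    case (Suc n)
    let ?E = "single n n (1::'a)"
    let ?c = "a * ?E"
    obtain y where y: "?c = ?c * y * ?c"
    proof -
      have "?c \<in> mats m (Suc n)"
        using Suc.prems by (auto simp: mats_def entry_mult_single split: if_splits)
      then have "\<exists>z. ?c = ?c * z * ?c"
        by (rule column_regular[OF R, of _ _ _ n]) (simp add: entry_mult_single split: if_splits)
      then show ?thesis using that by blast
    qed
    \<comment> \<open>Since \<open>a * ?E\<close> is the last column \<open>?c\<close>, the
      remainder times \<open>?E\<close> is \<open>?c - ?c * y * ?c\<close>, hence zero: the last
      column of the remainder vanishes.\<close>
    let ?x = "?E * y"
    have "(a - a * ?x * a) * ?E = ?c - ?c * y * ?c" by (simp add: left_diff_distrib mult.assoc)
    also have "\<dots> = 0" by (subst y[symmetric]) simp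
    finally have "(a - a * ?x * a) * ?E = 0" .
    then have "entry ((a - a * ?x * a) * ?E) i n = 0" for i by (simp add: zero_minf.rep_eq)
    then have 0: "entry (a - a * ?x * a) i n = 0" for i by (simp add: entry_mult_single)
    have "a - a * ?x * a \<in> mats m (Suc n)"
      by (rule mats_diff[OF Suc.prems mats_sandwich[OF Suc.prems Suc.prems]])
    then have *: "entry (a - a * ?x * a) i j \<noteq> 0 \<Longrightarrow> i < m \<and> j < Suc n" for i j
      unfolding mats_def by blast
    have "a - a * ?x * a \<in> mats m n"
      unfolding mats_def
    proof (intro CollectI allI impI)
      fix i j assume "entry (a - a * ?x * a) i j \<noteq> 0"
      with * 0 have "i < m" "j < Suc n" "j \<noteq> n" by metis+
      then show "i < m \<and> j < n" by simp
    qed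
    from Suc.IH[OF this] show ?case by (elim exE) (rule regular_reduce)
  qed
qed

section \<open>Idempotents and cancellation\<close>

text \<open>A local unit of \<open>a\<close> takes the place of the missing identity.\<close>

lemma le1_refl: "a \<lesssim>\<^sub>1 (a :: 'a::{ring,monoid_mult} minf)"
proof -
  obtain n where "a \<in> mats n n" using ex_mats by blast
  then have "a = unit_mat n * a * unit_mat n" by (simp add: mats_iff)
  then show ?thesis unfolding le1_def by blast
qed

lemma le1_trans [trans]: "a \<lesssim>\<^sub>1 b \<Longrightarrow> b \<lesssim>\<^sub>1 c \<Longrightarrow> a \<lesssim>\<^sub>1 c"
proof -
  assume "a \<lesssim>\<^sub>1 b" "b \<lesssim>\<^sub>1 c"
  then obtain r t r' t' where "a = r * b * t" "b = r' * c * t'" unfolding le1_def by blast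
  then have "a = (r * r') * c * (t' * t)" by (simp add: mult.assoc)
  then show ?thesis unfolding le1_def by blast
qed

lemma le1I: "a = r * b * t \<Longrightarrow> a \<lesssim>\<^sub>1 b"
  unfolding le1_def by blast

lemma embed_le1:
  fixes a :: "'a::{ring,monoid_mult} minf"
  assumes "inj \<sigma>" "inj \<tau>"
  shows "embed_mat \<sigma> \<tau> a \<lesssim>\<^sub>1 a" "a \<lesssim>\<^sub>1 embed_mat \<sigma> \<tau> a"
proof -
  obtain n where "a \<in> mats n n" using ex_mats by blast
  then have a: "unit_mat n * a * unit_mat n = a" by (simp add: mats_iff)
  have 1: "embed_mat \<sigma> id (unit_mat n) * embed_mat id id a * embed_mat id \<tau> (unit_mat n)
      = embed_mat \<sigma> \<tau> (unit_mat n * a * unit_mat n)"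
    by (subst embed_mult embed_mult, simp)+ simp
  have 2: "embed_mat id \<sigma> (unit_mat n) * embed_mat \<sigma> \<tau> a * embed_mat \<tau> id (unit_mat n)
      = embed_mat id id (unit_mat n * a * unit_mat n)"
    by (subst embed_mult, rule assms)+ (rule refl)
  show "embed_mat \<sigma> \<tau> a \<lesssim>\<^sub>1 a" by (rule le1I[OF 1[symmetric, unfolded a embed_id]])
  show "a \<lesssim>\<^sub>1 embed_mat \<sigma> \<tau> a" by (rule le1I[OF 2[symmetric, unfolded a embed_id]])
qed

section \<open>Factorizations through idempotents, and orthogonal sums\<close>

lemma absorb_right: "a * b = a \<Longrightarrow> b * c = b \<Longrightarrow> a * c = (a :: 'b::semigroup_mult)"
  and absorb_left: "b * a = a \<Longrightarrow> c * b = b \<Longrightarrow> c * a = (a :: 'b::semigroup_mult)"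
  by (metis mult.assoc)+

lemma annihilate_right: "a * b = a \<Longrightarrow> b * c = 0 \<Longrightarrow> a * c = (0 :: 'b::ring)"
  and annihilate_left: "b * a = a \<Longrightarrow> c * b = 0 \<Longrightarrow> c * a = (0 :: 'b::ring)"
  by (metis mult.assoc mult_zero_right, metis mult.assoc mult_zero_left)

text \<open>The given factors are trimmed to \<open>e * r * f\<close> and \<open>f * t * e\<close>.
  Then \<open>u\<close> embeds the image of \<open>e\<close> into that of \<open>f\<close> with left
  inverse \<open>v\<close>, and \<open>u * v\<close> is a copy of \<open>e\<close> below
  \<open>f\<close>.\<close>

lemma idem_le1_factor:
  assumes "e * e = e" "f * f = f" "e \<lesssim>\<^sub>1 f"
  shows "\<exists>u v. v * u = e \<and> f * u = u \<and> u * e = u \<and> e * v = v \<and> v * f = v"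
proof -
  obtain r t where e: "e = r * f * t" using assms(3) unfolding le1_def by blast
  have "(e * r * f) * (f * t * e) = e * (r * (f * f) * t) * e" by (simp only: mult.assoc)
  then have "(e * r * f) * (f * t * e) = e" using assms by (simp flip: e)
  moreover have "f * (f * t * e) = f * t * e" "e * (e * r * f) = e * r * f"
    by (simp_all add: assms flip: mult.assoc)
  moreover have "f * t * e * e = f * t * e" "e * r * f * f = e * r * f"
    by (simp_all add: assms mult.assoc)
  ultimately show ?thesis by blast
qed

definition orth :: "'b::ring \<Rightarrow> 'b \<Rightarrow> bool" where
  "orth x y \<longleftrightarrow> x * y = 0 \<and> y * x = 0"

lemma orth_add_idem: "e * e = e \<Longrightarrow> f * f = f \<Longrightarrow> orth e f \<Longrightarrow> (e + f) * (e + f) = e + (f::'b::ring)"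
  by (simp add: orth_def algebra_simps)

lemma orth_add_le1:
  assumes "e * e = e" "c * c = c" "orth e c" "e' * e' = e'" "c' * c' = c'" "orth e' c'"
    and "e \<lesssim>\<^sub>1 e'" "c \<lesssim>\<^sub>1 c'"
  shows "e + c \<lesssim>\<^sub>1 e' + c'"
proof -
  obtain u v where u: "v * u = e" "e' * u = u" "u * e = u" "e * v = v" "v * e' = v"
    using idem_le1_factor[of e e'] assms by blast
  obtain w z where w: "z * w = c" "c' * w = w" "w * c = w" "c * z = z" "z * c' = z"
    using idem_le1_factor[of c c'] assms by blast
  have vc: "v * c' = 0" by (rule annihilate_right[OF u(5)]) (use assms(6) in \<open>simp add: orth_def\<close>)
  have ze: "z * e' = 0" by (rule annihilate_right[OF w(5)]) (use assms(6) in \<open>simp add: orth_def\<close>)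
  have vw: "v * w = 0" by (rule annihilate_left[OF w(2) vc])
  have zu: "z * u = 0" by (rule annihilate_left[OF u(2) ze])
  have "(v + z) * (e' + c') * (u + w) = e + c"
    by (simp add: distrib_left distrib_right u w vc ze vw zu)
  then show ?thesis by (intro le1I[OF sym])
qed

text \<open>Evans cancellation. With respect to \<open>\<epsilon> + C\<close> and \<open>\<epsilon> + D\<close>, the matrix \<open>u\<close> has the blocks
  \<open>a, b, c, d\<close>. Stable range one turns the corner \<open>a\<close> into a unit of the corner ring of \<open>\<epsilon>\<close>
  by a row operation, and the Schur complement of that unit carries \<open>C\<close> to \<open>D\<close>.\<close>

lemma corner_cancel:
  fixes \<epsilon> C D u v :: "'b::ring"
  assumes idem: "\<epsilon> * \<epsilon> = \<epsilon>" "C * C = C" "D * D = D" "orth \<epsilon> C" "orth \<epsilon> D"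
    and ur: "\<And>a. \<epsilon> * a * \<epsilon> = a \<Longrightarrow> \<exists>x y. \<epsilon> * x = x \<and> x * \<epsilon> = x \<and> \<epsilon> * y = y \<and> y * \<epsilon> = y \<and>
      x * y = \<epsilon> \<and> y * x = \<epsilon> \<and> a = a * x * a"
    and uv: "v * u = \<epsilon> + C" "(\<epsilon> + D) * u = u" "u * (\<epsilon> + C) = u" "(\<epsilon> + C) * v = v" "v * (\<epsilon> + D) = v"
  shows "\<exists>x y. C = x * D * y"
proof -
  have o: "\<epsilon> * C = 0" "C * \<epsilon> = 0" "\<epsilon> * D = 0" "D * \<epsilon> = 0" using idem by (auto simp: orth_def)
  have o': "\<epsilon> * (C * x) = 0" "C * (\<epsilon> * x) = 0" "\<epsilon> * (D * x) = 0" "D * (\<epsilon> * x) = 0"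
    "\<epsilon> * (\<epsilon> * x) = \<epsilon> * x" "C * (C * x) = C * x" "D * (D * x) = D * x" for x
    using o idem by (simp_all flip: mult.assoc)
  define a b c d where abcd: "a = \<epsilon> * u * \<epsilon>" "b = \<epsilon> * u * C" "c = D * u * \<epsilon>" "d = D * u * C"
  define a' b' c' d' where abcd': "a' = \<epsilon> * v * \<epsilon>" "b' = \<epsilon> * v * D" "c' = C * v * \<epsilon>" "d' = C * v * D"
  have vu: "x * v * (\<epsilon> + D) * u * y = x * (\<epsilon> + C) * y" for x y
  proof -
    have "x * v * (\<epsilon> + D) * u * y = x * ((v * (\<epsilon> + D)) * u) * y" by (simp only: mult.assoc)
    then show ?thesis by (simp only: uv)
  qed
  have e1: "a' * a + b' * c = \<epsilon>"
    using vu[of \<epsilon> \<epsilon>] unfolding abcd abcd' by (simp add: algebra_simps o o' idem)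
  have e2: "c' * a + d' * c = 0"
    using vu[of C \<epsilon>] unfolding abcd abcd' by (simp add: algebra_simps o o' idem)
  have e3: "c' * b + d' * d = C"
    using vu[of C C] unfolding abcd abcd' by (simp add: algebra_simps o o' idem)
  have "\<epsilon> * a * \<epsilon> = a" by (simp add: abcd mult.assoc o' idem)
  from ur[OF this] obtain x y where x: "\<epsilon> * x = x" "x * \<epsilon> = x" "\<epsilon> * y = y" "y * \<epsilon> = y"
    "x * y = \<epsilon>" "y * x = \<epsilon>" and a: "a * x * a = a" by metis
  have corner: "\<epsilon> * a = a" "a * \<epsilon> = a" "\<epsilon> * b' = b'" "c * \<epsilon> = c" "c' * \<epsilon> = c'" "d' * D = d'" "b' * D = b'"
    by (simp_all add: abcd abcd' mult.assoc o' idem)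
  \<comment> \<open>With \<open>y\<close> the inverse of \<open>x\<close>, the corner
    \<open>a = y * h\<close> is a unit times an idempotent, and \<open>\<epsilon> - h\<close> is
    annihilated by \<open>a\<close>.\<close>
  define h where "h = x * a"
  have h: "h * h = h" "\<epsilon> * h = h" "h * \<epsilon> = h" "y * h = a" "a * h = a"
  proof -
    have "h * h = x * (a * x * a)" "y * h = (y * x) * a" "\<epsilon> * h = (\<epsilon> * x) * a" "h * \<epsilon> = x * (a * \<epsilon>)"
      "a * h = a * x * a" unfolding h_def by (simp_all only: mult.assoc)
    then show "h * h = h" "\<epsilon> * h = h" "h * \<epsilon> = h" "y * h = a" "a * h = a"
      by (simp_all add: x a corner h_def)
  qed
  \<comment> \<open>By \<open>e1\<close>, \<open>a' * a + \<beta> = \<epsilon>\<close>, so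
    \<open>\<beta>\<close> fixes \<open>\<epsilon> - h\<close>, the part that \<open>a\<close>
    annihilates. Adding \<open>t * \<beta>\<close> to \<open>a = y * h\<close> supplies the missing
    \<open>y * (\<epsilon> - h)\<close>. This is stable range one made explicit.\<close>
  define t where "t = y * (\<epsilon> - h)"
  define \<beta> where "\<beta> = b' * c"
  have \<beta>: "\<beta> = \<epsilon> - a' * a" "\<epsilon> * \<beta> = \<beta>" "\<beta> * \<epsilon> = \<beta>"
  proof -
    show "\<beta> = \<epsilon> - a' * a" using e1 by (simp add: \<beta>_def algebra_simps)
    show "\<epsilon> * \<beta> = \<beta>" "\<beta> * \<epsilon> = \<beta>" unfolding \<beta>_def
      by (simp add: corner flip: mult.assoc) (simp add: corner mult.assoc)
  qed
  have \<beta>h: "\<beta> * (\<epsilon> - h) = \<epsilon> - h"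
    by (simp add: \<beta> algebra_simps idem h corner)
  \<comment> \<open>The error term of that repair: \<open>w\<close> turns out to be
    \<open>y * (\<epsilon> + N)\<close> with \<open>N * N = 0\<close>, which dictates the inverse
    \<open>(\<epsilon> - N) * x\<close>.\<close>
  define N where "N = (\<epsilon> - h) * \<beta> * h"
  define w where "w = a + t * \<beta>"
  define w' where "w' = (\<epsilon> - N) * x"
  have ww': "w * w' = \<epsilon>"
  proof -
    have "h * (\<epsilon> - h) = 0" by (simp add: algebra_simps h)
    then have "h * ((\<epsilon> - h) * z) = 0" for z by (simp flip: mult.assoc)
    then have NN: "N * N = 0" by (simp add: N_def mult.assoc)
    have "(\<epsilon> - h) * \<beta> = (\<epsilon> - h) * (\<beta> * h + \<beta> * (\<epsilon> - h))"
      by (simp add: \<beta>(3) flip: distrib_left)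
    also have "\<dots> = N + (\<epsilon> - h)"
      unfolding \<beta>h distrib_left N_def by (simp add: algebra_simps h idem)
    finally have "w = y * h + y * (N + (\<epsilon> - h))"
      by (simp add: w_def t_def h mult.assoc)
    then have w: "w = y * (\<epsilon> + N)" by (simp add: add.commute flip: distrib_left)
    have "\<epsilon> * (h * z) = h * z" "\<epsilon> * (\<beta> * z) = \<beta> * z" for z by (simp_all add: h \<beta>(2) flip: mult.assoc)
    then have N: "\<epsilon> * N = N" "N * \<epsilon> = N" by (simp_all add: N_def algebra_simps h)
    have "w * w' = y * ((\<epsilon> + N) * (\<epsilon> - N)) * x" by (simp only: w w'_def mult.assoc)
    also have "(\<epsilon> + N) * (\<epsilon> - N) = \<epsilon>" by (simp add: algebra_simps idem N NN)
    finally show ?thesis by (simp add: x)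
  qed
  \<comment> \<open>Adding \<open>t * b'\<close> times the second block row of \<open>u\<close> to
    the first turns \<open>a\<close> into \<open>w\<close> and \<open>b\<close> into
    \<open>b1\<close>; the inverse operation on the columns of \<open>v\<close> turns
    \<open>d'\<close> into \<open>d1\<close>. Eliminating \<open>c'\<close> through the unit
    \<open>w\<close> then leaves \<open>d1\<close> times the Schur complement
    \<open>d - c * w' * b1\<close>.\<close>
  define d1 where "d1 = d' - c' * t * b'"
  have f1: "c' * w + d1 * c = 0"
    using e2 by (simp add: w_def d1_def \<beta>_def algebra_simps)
  define b1 where "b1 = b + t * b' * d"
  have f2: "c' * b1 + d1 * d = C"
    using e3 by (simp add: b1_def d1_def algebra_simps)
  have "c' = c' * w * w'" using ww' corner(5) by (simp add: mult.assoc)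
  also have "\<dots> = - (d1 * c * w')" using f1 by (metis add_eq_0_iff minus_mult_left minus_minus)
  finally have c': "c' = - (d1 * c * w')" .
  have "d1 * D = d1" by (simp add: d1_def algebra_simps corner)
  then have "d1 * D * (d - c * w' * b1) = d1 * d + (- (d1 * c * w')) * b1"
    by (simp add: algebra_simps)
  also have "\<dots> = C" using f2 by (simp flip: c') (simp add: add.commute)
  finally show ?thesis by metis
qed

section \<open>From corners to cancellation of arbitrary idempotents\<close>

definition cancels :: "'a::{ring,monoid_mult} minf \<Rightarrow> bool" where
  "cancels p \<longleftrightarrow> (\<forall>C D. C * C = C \<longrightarrow> D * D = D \<longrightarrow> orth p C \<longrightarrow> orth p D \<longrightarrow>
     p + C \<lesssim>\<^sub>1 p + D \<longrightarrow> C \<lesssim>\<^sub>1 D)"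

text \<open>Multiplying by \<open>p\<close> or \<open>q\<close> shows that whatever is orthogonal to
  \<open>p + q\<close> is orthogonal to each summand. So \<open>p\<close> is cancelled with
  \<open>q + C\<close> and \<open>q + D\<close> as complements, and then \<open>q\<close>.\<close>

lemma cancels_add:
  assumes "p * p = p" "q * q = q" "orth p q" "cancels p" "cancels q"
  shows "cancels (p + q)"
  unfolding cancels_def
proof (intro allI impI)
  fix C D assume CD: "C * C = C" "D * D = D" "orth (p + q) C" "orth (p + q) D"
    "p + q + C \<lesssim>\<^sub>1 p + q + D"
  have *: "orth p X" "orth q X" if "orth (p + q) X" for X
  proof -
    have "p * ((p + q) * X) = p * X" "q * ((p + q) * X) = q * X" "(X * (p + q)) * p = X * p"
      "(X * (p + q)) * q = X * q"
      using assms by (simp_all add: orth_def distrib_left distrib_right mult.assoc)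
        (simp_all add: orth_def flip: mult.assoc)
    with that show "orth p X" "orth q X" by (simp_all add: orth_def)
  qed
  have "orth p (q + C)" "orth p (q + D)"
    using *(1)[OF CD(3)] *(1)[OF CD(4)] assms(3) by (simp_all add: orth_def distrib_left distrib_right)
  moreover have "(q + C) * (q + C) = q + C" "(q + D) * (q + D) = q + D"
    using *(2)[OF CD(3)] *(2)[OF CD(4)] CD assms by (simp_all add: orth_add_idem)
  moreover have "p + (q + C) \<lesssim>\<^sub>1 p + (q + D)" using CD(5) by (simp add: add.assoc)
  ultimately have "q + C \<lesssim>\<^sub>1 q + D" using assms(4) by (simp add: cancels_def)
  then show "C \<lesssim>\<^sub>1 D" using assms(5) *(2)[OF CD(3)] *(2)[OF CD(4)] CD by (simp add: cancels_def)
qed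

context
  assumes ur: "unit_regular TYPE('a::{ring,monoid_mult})"
begin

lemma regular: "\<exists>z. a = a * z * (a :: 'a minf)"
  by (rule minf_regular) (use ur in \<open>auto simp: unit_regular_def\<close>)

text \<open>The corner at a diagonal matrix unit is a copy of the base ring, so its unit-regularity
  provides exactly the hypothesis of \<open>corner_cancel\<close>.\<close>

lemma cancels_single: "cancels (single i i (1::'a))"
  unfolding cancels_def
proof (intro allI impI)
  let ?E = "single i i (1::'a)"
  fix C D assume CD: "C * C = C" "D * D = D" "orth ?E C" "orth ?E D" "?E + C \<lesssim>\<^sub>1 ?E + D"
  have EE: "?E * ?E = ?E" by (rule minf_eqI) (auto simp: entry_mult_single single.rep_eq)
  have mult: "single i i r * single i i s = single i i (r * s)" for r s :: 'a
    by (rule minf_eqI) (auto simp: entry_mult_single single.rep_eq)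
  have "(?E + C) * (?E + C) = ?E + C" "(?E + D) * (?E + D) = ?E + D"
    using CD EE by (simp_all add: orth_add_idem)
  from idem_le1_factor[OF this CD(5)] obtain u v where uv: "v * u = ?E + C" "(?E + D) * u = u"
    "u * (?E + C) = u" "(?E + C) * v = v" "v * (?E + D) = v" by blast
  have "\<exists>x y. C = x * D * y"
  proof (rule corner_cancel[OF EE CD(1-4) _ uv])
    fix a assume a: "?E * a * ?E = a"
    have "a = single i i (entry a i i)"
    proof (rule minf_eqI)
      fix p q
      have "entry (?E * a * ?E) p q = entry (single i i (entry a i i)) p q"
        by (auto simp: entry_mult_single entry_single_mult single.rep_eq)
      then show "entry a p q = entry (single i i (entry a i i)) p q" by (simp add: a)
    qed
    then obtain r where r: "a = single i i r" by blast
    obtain u v where "u * v = 1" "v * u = 1" "r = r * u * r" using ur unfolding unit_regular_def by blast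
    then show "\<exists>x y. ?E * x = x \<and> x * ?E = x \<and> ?E * y = y \<and> y * ?E = y \<and>
      x * y = ?E \<and> y * x = ?E \<and> a = a * x * a"
      by (intro exI[of _ "single i i u"] exI[of _ "single i i v"]) (simp add: r mult)
  qed
  then show "C \<lesssim>\<^sub>1 D" unfolding le1_def .
qed

lemma cancels_unit_mat: "cancels (unit_mat n :: 'a minf)"
proof (induction n)
  case 0
  have "unit_mat 0 = (0 :: 'a minf)" by (rule minf_eqI) (simp add: unit_mat.rep_eq zero_minf.rep_eq)
  then show ?case by (simp add: cancels_def)
next
  case (Suc n)
  have "unit_mat (Suc n) = unit_mat n + single n n (1::'a)"
    by (rule minf_eqI) (auto simp: unit_mat.rep_eq single.rep_eq plus_minf.rep_eq)
  moreover have "single n n (1::'a) * single n n 1 = single n n 1"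
    by (rule minf_eqI) (auto simp: entry_mult_single single.rep_eq)
  moreover have "orth (unit_mat n) (single n n (1::'a))"
    unfolding orth_def
    by (intro conjI minf_eqI) (auto simp: entry_mult_single entry_single_mult unit_mat.rep_eq zero_minf.rep_eq)
  ultimately show ?case using Suc cancels_single by (simp add: cancels_add unit_mat_idem)
qed

text \<open>To cancel \<open>e\<close> it is enlarged to \<open>unit_mat n\<close> by adding
  \<open>unit_mat n - e\<close>. This complement need not be orthogonal to \<open>C\<close> or
  \<open>D\<close>, so both are first shifted by \<open>n\<close>. The assumption
  \<open>f \<lesssim>\<^sub>1 e\<close> allows \<open>f\<close> on the right to be replaced by
  \<open>e\<close>.\<close>

lemma idem_cancel:
  fixes e f C D :: "'a minf"
  assumes idem: "e * e = e" "f * f = f" "C * C = C" "D * D = D" and orth: "orth e C" "orth f D"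
    and le: "f \<lesssim>\<^sub>1 e" "e + C \<lesssim>\<^sub>1 f + D"
  shows "C \<lesssim>\<^sub>1 D"
proof -
  obtain n where n: "e \<in> mats n n" using ex_mats by blast
  let ?s = "embed_mat (shift n) (shift n) :: 'a minf \<Rightarrow> _"
  let ?p = "unit_mat n - e"
  have s_idem: "?s X * ?s X = ?s X" if "X * X = X" for X
    using that by (simp add: embed_mult[OF inj_shift])
  have s_orth: "orth x (?s X)" if "x \<in> mats n n" for x X
    using that by (simp add: orth_def mats_mult_shift shift_mult_mats)
  have e: "unit_mat n * e = e" "e * unit_mat n = e" using n by (simp_all add: mats_iff)
  have p: "?p * ?p = ?p" "orth ?p e"
    using idem by (simp_all add: algebra_simps orth_def e unit_mat_idem)
  have pm: "?p \<in> mats n n" by (intro mats_diff unit_mat_mats n)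
  have "e + ?s C \<lesssim>\<^sub>1 e + C"
    using idem orth n by (intro orth_add_le1 s_idem s_orth le1_refl embed_le1 inj_shift)
  also note le(2)
  also have "f + D \<lesssim>\<^sub>1 e + ?s D"
    using idem orth n le(1) by (intro orth_add_le1 s_idem s_orth embed_le1 inj_shift)
  finally have le': "e + ?s C \<lesssim>\<^sub>1 e + ?s D" .
  have es: "(e + ?s X) * (e + ?s X) = e + ?s X" if "X * X = X" for X
    by (rule orth_add_idem[OF idem(1) s_idem[OF that] s_orth[OF n]])
  have po: "orth ?p (e + ?s X)" for X
    using p(2) s_orth[OF pm, of X] by (simp add: orth_def distrib_left distrib_right)
  have "?p + (e + ?s C) \<lesssim>\<^sub>1 ?p + (e + ?s D)"
    by (rule orth_add_le1[OF p(1) es[OF idem(3)] po p(1) es[OF idem(4)] po le1_refl le'])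
  then have "unit_mat n + ?s C \<lesssim>\<^sub>1 unit_mat n + ?s D" by simp
  then have "?s C \<lesssim>\<^sub>1 ?s D"
    using cancels_unit_mat[of n] idem s_idem s_orth[OF unit_mat_mats] by (simp add: cancels_def)
  from le1_trans[OF le1_trans[OF embed_le1(2) this] embed_le1(1)] show ?thesis
    by (simp add: inj_shift)
qed

text \<open>The complement of the image of \<open>e\<close> in \<open>f\<close> is \<open>\<lesssim>\<^sub>1 0\<close> by cancellation.\<close>

lemma idem_equiv:
  fixes e f :: "'a minf"
  assumes idem: "e * e = e" "f * f = f" and le: "e \<lesssim>\<^sub>1 f" "f \<lesssim>\<^sub>1 e"
  shows "\<exists>x y. e = x * y \<and> f = y * x"
proof -
  obtain u v where uv: "v * u = e" "f * u = u" "u * e = u" "e * v = v" "v * f = v"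
    using idem_le1_factor[OF idem le(1)] by blast
  let ?g = "u * v"
  have g: "?g * ?g = ?g" "f * ?g = ?g" "?g * f = ?g"
  proof -
    have "?g * ?g = u * (v * u) * v" "f * ?g = (f * u) * v" "?g * f = u * (v * f)"
      by (simp_all only: mult.assoc)
    then show "?g * ?g = ?g" "f * ?g = ?g" "?g * f = ?g" by (simp_all add: uv)
  qed
  have "f - ?g \<lesssim>\<^sub>1 0"
  proof (rule idem_cancel[of ?g ?g])
    have "e = v * ?g * u" using uv idem by (simp flip: mult.assoc)
    then have "e \<lesssim>\<^sub>1 ?g" by (rule le1I)
    then show "?g + (f - ?g) \<lesssim>\<^sub>1 ?g + 0" using le(2) by (simp add: le1_trans)
  qed (use g idem in \<open>simp_all add: orth_def algebra_simps le1_refl\<close>)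
  then have "f = u * v" by (auto simp: le1_def)
  with uv(1) show ?thesis by blast
qed

text \<open>As \<open>p\<close> and \<open>q\<close> are equivalent, cancellation gives a comparison
  \<open>w\<close>, \<open>z\<close> of the complements \<open>p' - p\<close> and
  \<open>q' - q\<close>. The mixed products vanish by orthogonality, so \<open>u + w\<close> and
  \<open>v + z\<close> extend the given pair, and \<open>u' * v'\<close> is an idempotent between
  \<open>q\<close> and \<open>q'\<close>.\<close>

lemma idem_extend:
  fixes p q p' q' u v :: "'a minf"
  assumes p: "p * p = p" "p' * p' = p'" "p * p' = p" "p' * p = p"
    and q: "q * q = q" "q' * q' = q'" "q * q' = q" "q' * q = q"
    and uv: "v * u = p" "u * v = q" "u * p = u" "v * q = v"
    and le: "p' \<lesssim>\<^sub>1 q'"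
  shows "\<exists>u' v'. v' * u' = p' \<and> u' * p' = u' \<and> v' * (u' * v') = v' \<and> u' * p = u \<and> v' * q = v \<and>
    q' * (u' * v') = u' * v' \<and> u' * v' * q' = u' * v' \<and> q * (u' * v') = q \<and> u' * v' * q = q"
proof -
  let ?C = "p' - p" and ?D = "q' - q"
  have C: "?C * ?C = ?C" "orth p ?C" and D: "?D * ?D = ?D" "orth q ?D"
    using p q by (simp_all add: orth_def algebra_simps)
  have "?C \<lesssim>\<^sub>1 ?D"
  proof (rule idem_cancel[of p q])
    have "q = u * p * v" using uv by simp
    then show "q \<lesssim>\<^sub>1 p" by (rule le1I)
  qed (use C D p q le in simp_all)
  from idem_le1_factor[OF C(1) D(1) this]
  obtain w z where w: "z * w = ?C" "?D * w = w" "w * ?C = w" "?C * z = z" "z * ?D = z" by blast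
  have "p * v = v * (u * v)" "q * u = u * (v * u)"
    by (simp_all only: mult.assoc flip: uv(1,2))
  then have pv: "p * v = v" "q * u = u" using uv by simp_all
  have qD: "q * ?D = 0" "?D * q = 0" and pC: "p * ?C = 0" "?C * p = 0"
    using C(2) D(2) by (simp_all add: orth_def)
  have qw: "q * w = 0" by (rule annihilate_left[OF w(2) qD(1)])
  have zq: "z * q = 0" by (rule annihilate_right[OF w(5) qD(2)])
  have wp: "w * p = 0" by (rule annihilate_right[OF w(3) pC(2)])
  have pz: "p * z = 0" by (rule annihilate_left[OF w(4) pC(1)])
  have 0: "v * w = 0" "z * u = 0" "w * v = 0" "u * z = 0"
    by (rule annihilate_right[OF uv(4) qw] annihilate_left[OF pv(2) zq]
        annihilate_left[OF pv(1) wp] annihilate_right[OF uv(3) pz])+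
  have "?C * p' = ?C" "p' * ?C = ?C" "q' * ?D = ?D" "?D * q' = ?D" using p q by (simp_all add: algebra_simps)
  then have "w * p' = w" "p' * z = z" "q' * w = w" "z * q' = z"
    using absorb_right absorb_left w(2-5) by blast+
  moreover have "u * p' = u" "p' * v = v" "q' * u = u" "v * q' = v"
    using absorb_right absorb_left uv(3,4) pv p(3,4) q(3,4) by blast+
  ultimately have 1: "(u + w) * p' = u + w" "p' * (v + z) = v + z" "q' * (u + w) = u + w" "(v + z) * q' = v + z"
    by (simp_all add: distrib_left distrib_right)
  have 2: "(v + z) * (u + w) = p'" "(u + w) * p = u" "(v + z) * q = v" "q * (u + w) = u" "p * (v + z) = v"
    by (simp_all add: 0 pv qw zq wp pz distrib_left distrib_right uv w)
  have 3: "u * (v + z) = q" "(u + w) * v = q" using 0 uv by (simp_all add: distrib_left distrib_right)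
  show ?thesis
  proof (rule exI[of _ "u + w"], rule exI[of _ "v + z"], intro conjI)
    show "(v + z) * ((u + w) * (v + z)) = v + z" by (simp only: 1 2 flip: mult.assoc)
    show "q' * ((u + w) * (v + z)) = (u + w) * (v + z)" by (simp only: 1 2 flip: mult.assoc)
    show "(u + w) * (v + z) * q' = (u + w) * (v + z)" by (simp only: 1 2 mult.assoc)
    show "q * ((u + w) * (v + z)) = q" by (simp only: 2 3 flip: mult.assoc)
    show "(u + w) * (v + z) * q = q" by (simp only: 2 3 mult.assoc)
  qed (use 1 2 in simp_all)
qed

end

section \<open>The monoids of matrix classes\<close>

lemma equiv_antisymmetrization:
  assumes "\<And>x. x \<in> A \<Longrightarrow> lq x x" "\<And>x y z. x \<in> A \<Longrightarrow> y \<in> A \<Longrightarrow> z \<in> A \<Longrightarrow> lq x y \<Longrightarrow> lq y z \<Longrightarrow> lq x z"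
  shows "equiv A (antisymmetrization A lq)"
  unfolding antisymmetrization_def
proof (rule equivI)
  show "trans {(x, y). x \<in> A \<and> y \<in> A \<and> lq x y \<and> lq y x}"
    by (rule transI) (use assms(2) in blast)
qed (use assms(1) in \<open>auto simp: refl_on_def sym_def\<close>)

text \<open>Operations on classes are unions over all representatives; well-definedness means that
  the family is nonempty and constant.\<close>

lemma Union_eqI: "S \<noteq> {} \<Longrightarrow> (\<And>X. X \<in> S \<Longrightarrow> X = K) \<Longrightarrow> \<Union>S = K"
  by blast

lemma equiv_class_image: "equiv B s \<Longrightarrow> r \<subseteq> s \<Longrightarrow> (x, x) \<in> r \<Longrightarrow> s `` (r `` {x}) = s `` {x}"
  unfolding equiv_def sym_def trans_def by blast

lemma orth_sandwich:
  fixes a b r s t u :: "'b::ring"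
  assumes "r * b = 0" "s * a = 0" "b * t = 0" "a * u = 0"
  shows "(r + s) * (a + b) * (t + u) = r * a * t + s * b * u"
  using assms by (simp add: distrib_left distrib_right) (simp add: mult.assoc)

text \<open>The sizes on the two sides are unrelated, so this also shows that the class of a
  diagonal sum does not depend on the size assigned to its first block.\<close>

lemma diag_sum_le1:
  fixes a b :: "'a::{ring,monoid_mult} minf"
  assumes "a \<in> mats m n" "a' \<in> mats m' n'" "a \<lesssim>\<^sub>1 a'" "b \<lesssim>\<^sub>1 b'"
  shows "diag_sum m n a b \<lesssim>\<^sub>1 diag_sum m' n' a' b'"
proof -
  obtain r t where a: "a = r * a' * t" using assms(3) unfolding le1_def by blast
  obtain r' t' where b: "b = r' * b' * t'" using assms(4) unfolding le1_def by blast
  let ?R = "unit_mat m * r * unit_mat m'" and ?T = "unit_mat n' * t * unit_mat n"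
  let ?r = "embed_mat (shift m) (shift m') r'" and ?t = "embed_mat (shift n') (shift n) t'"
  let ?b = "embed_mat (shift m') (shift n') b'"
  have "?R * a' * ?T = unit_mat m * r * (unit_mat m' * a' * unit_mat n') * t * unit_mat n"
    by (simp only: mult.assoc)
  also have "\<dots> = unit_mat m * (r * a' * t) * unit_mat n" using assms(2) by (simp add: mats_iff mult.assoc)
  also have "\<dots> = a" using assms(1) by (simp add: mats_iff flip: a)
  finally have 1: "?R * a' * ?T = a" .
  have 2: "?r * ?b * ?t = embed_mat (shift m) (shift n) b"
    by (simp add: embed_mult[OF inj_shift] b)
  have "?R * ?b = 0" "?r * a' = 0" "?b * ?T = 0" "a' * ?t = 0"
    by (rule mats_mult_shift shift_mult_mats mats_cut assms)+
  then have "(?R + ?r) * (a' + ?b) * (?T + ?t) = ?R * a' * ?T + ?r * ?b * ?t"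
    by (rule orth_sandwich)
  then show ?thesis
    unfolding diag_sum_eq[OF assms(1)] diag_sum_eq[OF assms(2)] 1 2 by (intro le1I[OF sym])
qed

lemma le1_diag_sum:
  fixes a b :: "'a::{ring,monoid_mult} minf"
  assumes "a \<in> mats m n"
  shows "a \<lesssim>\<^sub>1 diag_sum m n a b"
proof (rule le1I[of _ "unit_mat m" _ "unit_mat n"])
  have "unit_mat m * embed_mat (shift m) (shift n) b = 0" by (rule mats_mult_shift[OF unit_mat_mats])
  then show "a = unit_mat m * diag_sum m n a b * unit_mat n"
    using assms by (simp add: diag_sum_eq mats_iff distrib_left)
qed

lemma diag_sum_idem:
  fixes e f :: "'a::{ring,monoid_mult} minf"
  assumes "e \<in> mats m m" "e * e = e" "f * f = f"
  shows "diag_sum m m e f * diag_sum m m e f = diag_sum m m e f"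
    "e * diag_sum m m e f = e" "diag_sum m m e f * e = e"
  using assms by (simp_all add: diag_sum_eq distrib_left distrib_right mats_mult_shift
      shift_mult_mats embed_mult[OF inj_shift])

lemma equiv_W: "equiv UNIV (W_rel :: ('a::{ring,monoid_mult} minf \<times> _) set)"
  unfolding W_rel_def by (rule equiv_antisymmetrization) (auto intro: le1_refl le1_trans)

lemma W_rel_iff: "(a, b) \<in> W_rel \<longleftrightarrow> a \<lesssim>\<^sub>1 b \<and> b \<lesssim>\<^sub>1 a"
  by (simp add: W_rel_def antisymmetrization_def)

abbreviation W_class :: "'a::ring minf \<Rightarrow> 'a minf set" where
  "W_class a \<equiv> W_rel `` {a}"

lemma W_class_eq_iff:
  fixes a b :: "'a::{ring,monoid_mult} minf"
  shows "W_class a = W_class b \<longleftrightarrow> a \<lesssim>\<^sub>1 b \<and> b \<lesssim>\<^sub>1 a"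
  using eq_equiv_class_iff[OF equiv_W] by (simp add: W_rel_iff)

lemma W_carrier: "carrier W_monoid = range W_class"
  by (auto simp: W_monoid_def matrix_class_monoid_def Let_def quotient_def simp flip: W_rel_def)

lemma W_one: "\<one>\<^bsub>W_monoid\<^esub> = W_class 0"
  by (simp add: W_monoid_def matrix_class_monoid_def Let_def flip: W_rel_def)

lemma W_mle:
  fixes a b :: "'a::{ring,monoid_mult} minf"
  shows "mle W_monoid (W_class a) (W_class b) \<longleftrightarrow> a \<lesssim>\<^sub>1 b"
proof -
  have "mle W_monoid (W_class a) (W_class b) \<longleftrightarrow> (\<exists>a'\<in>W_class a. \<exists>b'\<in>W_class b. a' \<lesssim>\<^sub>1 b')"
    by (simp add: W_monoid_def matrix_class_monoid_def Let_def flip: W_rel_def)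
  also have "\<dots> \<longleftrightarrow> a \<lesssim>\<^sub>1 b"
  proof
    assume "\<exists>a'\<in>W_class a. \<exists>b'\<in>W_class b. a' \<lesssim>\<^sub>1 b'"
    then obtain a' b' where "a \<lesssim>\<^sub>1 a'" "a' \<lesssim>\<^sub>1 b'" "b' \<lesssim>\<^sub>1 b" by (auto simp: W_rel_iff)
    then show "a \<lesssim>\<^sub>1 b" by (blast intro: le1_trans)
  next
    assume "a \<lesssim>\<^sub>1 b"
    moreover have "a \<in> W_class a" "b \<in> W_class b" by (simp_all add: W_rel_iff le1_refl)
    ultimately show "\<exists>a'\<in>W_class a. \<exists>b'\<in>W_class b. a' \<lesssim>\<^sub>1 b'" by blast
  qed
  finally show ?thesis .
qed

lemma W_mult:
  fixes a b :: "'a::{ring,monoid_mult} minf"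
  assumes "a \<in> mats m n"
  shows "W_class a \<otimes>\<^bsub>W_monoid\<^esub> W_class b = W_class (diag_sum m n a b)"
proof -
  have "W_class a \<otimes>\<^bsub>W_monoid\<^esub> W_class b = \<Union>{W_class (diag_sum m n a' b') | m n a' b'.
      a' \<in> W_class a \<and> b' \<in> W_class b \<and> a' \<in> mats m n}"
    by (simp add: W_monoid_def matrix_class_monoid_def Let_def flip: W_rel_def)
  also have "\<dots> = W_class (diag_sum m n a b)"
  proof (rule Union_eqI)
    show "{W_class (diag_sum m n a' b') | m n a' b'. a' \<in> W_class a \<and> b' \<in> W_class b \<and> a' \<in> mats m n} \<noteq> {}"
      using assms le1_refl[of a] le1_refl[of b] by (auto simp: W_rel_iff)
  next
    fix X assume "X \<in> {W_class (diag_sum m n a' b') | m n a' b'. a' \<in> W_class a \<and> b' \<in> W_class b \<and> a' \<in> mats m n}"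
    then obtain m' n' a' b' where X: "X = W_class (diag_sum m' n' a' b')"
      and *: "a' \<in> W_class a" "b' \<in> W_class b" "a' \<in> mats m' n'" by blast
    then have "diag_sum m' n' a' b' \<lesssim>\<^sub>1 diag_sum m n a b" "diag_sum m n a b \<lesssim>\<^sub>1 diag_sum m' n' a' b'"
      using assms by (auto simp: W_rel_iff intro!: diag_sum_le1)
    then show "X = W_class (diag_sum m n a b)" unfolding X W_class_eq_iff by blast
  qed
  finally show ?thesis .
qed

text \<open>Right multiplication by \<open>q + d' * d\<close> replaces \<open>e\<close> by
  \<open>e * d' * d\<close>, which is a left multiple of \<open>d\<close>. A row operation with
  coefficient \<open>- e * d'\<close> can then remove it; \<open>p\<close> and \<open>d * d'\<close>
  preserve the diagonal blocks.\<close>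

lemma triangular_split:
  fixes c d e d' p q :: "'b::ring"
  assumes "c * q = c" "p * c = c" "p * e = e" "e * q = 0" "d' * e = 0" "d * d' * d = d"
    "d * q = 0" "p * d = 0" "c * d' = 0" "d' * c = 0"
  shows "(p + d * d' - e * d') * (c + e + d) * (q + d' * d) = c + d"
proof -
  have "(c + e + d) * (q + d' * d) = c * q + c * d' * d + e * q + e * d' * d + d * q + d * d' * d"
    by (simp add: algebra_simps)
  then have 1: "(c + e + d) * (q + d' * d) = c + e * d' * d + d" using assms by simp
  have "(p + d * d' - e * d') * (c + e * d' * d + d) = p * c + p * e * d' * d + p * d + d * (d' * c)
      + d * (d' * e) * d' * d + d * d' * d - e * (d' * c) - e * (d' * e) * d' * d - e * d' * d"
    by (simp add: algebra_simps)
  then show ?thesis unfolding mult.assoc[of _ "c + e + d"] 1 by (simp add: assms)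
qed

section \<open>Comparison of matrix classes over a unit-regular ring\<close>

context
  assumes ur: "unit_regular TYPE('a::{ring,monoid_mult})"
begin

text \<open>For a quasi-inverse \<open>z\<close> of \<open>a\<close>, the idempotent
  \<open>a * z\<close> and \<open>a\<close> are left-right multiples of each other.\<close>

lemma le1_idem_rep: "\<exists>e. e * e = e \<and> a \<lesssim>\<^sub>1 e \<and> e \<lesssim>\<^sub>1 (a :: 'a minf)"
proof -
  obtain z where z: "a * z * a = a" using regular[OF ur, of a] by metis
  let ?e = "a * z"
  have "?e * ?e = a * z * a * z" by (simp only: mult.assoc)
  then have e: "?e * ?e = ?e" by (simp only: z)
  have "a = ?e * ?e * a" by (simp only: e z)
  moreover have "?e = ?e * a * z" by (simp only: z)
  ultimately show ?thesis using e le1I by metis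
qed

text \<open>The complement is \<open>f - u * v\<close>, where \<open>u * v\<close> is the copy of
  \<open>e\<close> inside \<open>f\<close>; it is shifted behind the block of \<open>e\<close> to
  become a diagonal summand.\<close>

lemma idem_le1_complement:
  fixes e f :: "'a minf"
  assumes "e * e = e" "f * f = f" "e \<lesssim>\<^sub>1 f" "e \<in> mats m m"
  shows "\<exists>q. q * q = q \<and> f \<lesssim>\<^sub>1 diag_sum m m e q \<and> diag_sum m m e q \<lesssim>\<^sub>1 f"
proof -
  obtain u v where uv: "v * u = e" "f * u = u" "u * e = u" "e * v = v" "v * f = v"
    using idem_le1_factor[OF assms(1-3)] by blast
  let ?g = "u * v"
  have "?g * ?g = u * (v * u) * v" "f * ?g = (f * u) * v" "?g * f = u * (v * f)"
    by (simp_all only: mult.assoc)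
  then have g: "?g * ?g = ?g" "f * ?g = ?g" "?g * f = ?g" by (simp_all add: uv)
  have q: "(f - ?g) * (f - ?g) = f - ?g" "orth ?g (f - ?g)"
    using g assms(2) by (simp_all add: orth_def algebra_simps)
  have "?g = u * e * v" "e = v * ?g * u"
    using assms(1) by (simp_all add: uv) (simp add: uv flip: mult.assoc)
  then have le: "?g \<lesssim>\<^sub>1 e" "e \<lesssim>\<^sub>1 ?g" by (blast intro: le1I)+
  let ?s = "embed_mat (shift m) (shift m) (f - ?g)"
  have s: "?s * ?s = ?s" "orth e ?s"
    using assms(4) q(1) by (simp_all add: orth_def mats_mult_shift shift_mult_mats embed_mult[OF inj_shift])
  have "?g + (f - ?g) \<lesssim>\<^sub>1 e + ?s" "e + ?s \<lesssim>\<^sub>1 ?g + (f - ?g)"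
    using g q s assms(1) le by (intro orth_add_le1 embed_le1 inj_shift; simp)+
  then show ?thesis using q(1) by (intro exI[of _ "f - ?g"]) (simp add: diag_sum_eq[OF assms(4)])
qed

lemma triangular_le1:
  fixes c d e :: "'a minf"
  shows "block m n c 0 0 d \<lesssim>\<^sub>1 block m n c e 0 d"
proof -
  obtain d' where d: "d * d' * d = d" using regular[OF ur, of d] by metis
  let ?c = "unit_mat m * c * unit_mat n" and ?e = "unit_mat m * embed_mat id (shift n) e"
  let ?d = "embed_mat (shift m) (shift n) d" and ?d' = "embed_mat (shift n) (shift m) d'"
  have "(unit_mat m + ?d * ?d' - ?e * ?d') * (?c + ?e + ?d) * (unit_mat n + ?d' * ?d) = ?c + ?d"
  proof (rule triangular_split)
    show "?c * unit_mat n = ?c" "unit_mat m * ?c = ?c"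
      using mats_cut[of m c n] unfolding mats_iff by simp_all
    show "unit_mat m * ?e = ?e" by (simp add: unit_mat_idem flip: mult.assoc)
    have "embed_mat id (shift n) e * unit_mat n = 0"
      by (rule shift_mult_mats[OF unit_mat_mats])
    then show "?e * unit_mat n = 0" by (simp add: mult.assoc)
    have "?d' * unit_mat m = 0" by (rule shift_mult_mats[OF unit_mat_mats])
    then show "?d' * ?e = 0" by (simp flip: mult.assoc)
    show "?d * ?d' * ?d = ?d" by (simp add: embed_mult[OF inj_shift] d)
  qed (rule mats_mult_shift shift_mult_mats mats_cut unit_mat_mats)+
  then show ?thesis by (intro le1I[OF sym]) (simp add: block_eq)
qed

lemma leM_eq: "leM = (le1 :: 'a minf \<Rightarrow> 'a minf \<Rightarrow> bool)"
proof -
  have "le0 = (le1 :: 'a minf \<Rightarrow> 'a minf \<Rightarrow> bool)"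
    unfolding le0_def fun_eq_iff using triangular_le1 by blast
  moreover have "a \<lesssim>\<^sub>1 b" if "le1\<^sup>+\<^sup>+ a b" for a b :: "'a minf"
    using that by induction (auto intro: le1_trans)
  ultimately show ?thesis by (intro ext iffI) (auto simp: leM_def)
qed

text \<open>From left to right this is formal. The converse is \<open>idem_equiv\<close>: here
  cancellation makes the relations of \<open>V_monoid\<close> and \<open>W_monoid\<close> agree on
  idempotents.\<close>

lemma V_rel_iff: "(e :: 'a minf, f) \<in> V_rel \<longleftrightarrow> e * e = e \<and> f * f = f \<and> e \<lesssim>\<^sub>1 f \<and> f \<lesssim>\<^sub>1 e"
proof (safe)
  assume "(e, f) \<in> V_rel"
  then obtain x y where "e * e = e" "f * f = f" and xy: "e = x * y" "f = y * x"
    by (auto simp: V_rel_def idempotents_def)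
  then show "e * e = e" "f * f = f" by blast+
  \<comment> \<open>The cube of \<open>x * y\<close> regroups to contain \<open>y * x\<close> in the
    middle, and symmetrically.\<close>
  have "e = (e * e) * e" "f = (f * f) * f" by (simp_all only: \<open>e * e = e\<close> \<open>f * f = f\<close>)
  then have "e = x * f * (y * e)" "f = y * e * (x * f)"
    unfolding xy by (simp_all only: mult.assoc)
  then show "e \<lesssim>\<^sub>1 f" "f \<lesssim>\<^sub>1 e" by (blast intro: le1I)+
qed (use idem_equiv[OF ur, of e f] in \<open>auto simp: V_rel_def idempotents_def\<close>)

lemma equiv_V: "equiv idempotents (V_rel :: ('a minf \<times> _) set)"
proof -
  have "V_rel = antisymmetrization idempotents (le1 :: 'a minf \<Rightarrow> _)"
    by (auto simp: V_rel_iff antisymmetrization_def idempotents_def)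
  moreover have "equiv idempotents (antisymmetrization idempotents (le1 :: 'a minf \<Rightarrow> _))"
    by (rule equiv_antisymmetrization) (auto intro: le1_refl le1_trans)
  ultimately show ?thesis by simp
qed

lemma V_class_eq_iff:
  fixes e f :: "'a minf"
  assumes "e * e = e" "f * f = f"
  shows "V_rel `` {e} = V_rel `` {f} \<longleftrightarrow> e \<lesssim>\<^sub>1 f \<and> f \<lesssim>\<^sub>1 e"
  using assms eq_equiv_class_iff[OF equiv_V, of e f] by (simp add: V_rel_iff idempotents_def)

lemma V_add_class:
  fixes e f :: "'a minf"
  assumes "e * e = e" "f * f = f" "e \<in> mats m m"
  shows "V_add (V_rel `` {e}) (V_rel `` {f}) = V_rel `` {diag_sum m m e f}"
  unfolding V_add_def
proof (rule Union_eqI)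
  show "{V_rel `` {diag_sum m m e' f'} | m e' f'. e' \<in> V_rel `` {e} \<and> f' \<in> V_rel `` {f} \<and> e' \<in> mats m m} \<noteq> {}"
    using assms le1_refl[of e] le1_refl[of f] by (auto simp: V_rel_iff)
next
  fix X assume "X \<in> {V_rel `` {diag_sum m m e' f'} | m e' f'. e' \<in> V_rel `` {e} \<and> f' \<in> V_rel `` {f} \<and> e' \<in> mats m m}"
  then obtain m' e' f' where X: "X = V_rel `` {diag_sum m' m' e' f'}"
    and *: "e' \<in> V_rel `` {e}" "f' \<in> V_rel `` {f}" "e' \<in> mats m' m'" by blast
  then have ef: "e' * e' = e'" "f' * f' = f'" by (auto simp: V_rel_iff)
  have "diag_sum m' m' e' f' \<lesssim>\<^sub>1 diag_sum m m e f" "diag_sum m m e f \<lesssim>\<^sub>1 diag_sum m' m' e' f'"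
    using * assms by (auto simp: V_rel_iff intro!: diag_sum_le1)
  then show "X = V_rel `` {diag_sum m m e f}"
    unfolding X V_class_eq_iff[OF diag_sum_idem(1)[OF *(3) ef] diag_sum_idem(1)[OF assms(3,1,2)]] by blast
qed

lemma W_class_V_class:
  fixes e :: "'a minf"
  assumes "e * e = e"
  shows "W_rel `` (V_rel `` {e}) = W_class e"
  using assms by (intro equiv_class_image[OF equiv_W]) (auto simp: V_rel_iff W_rel_iff le1_refl)

lemma V_carrier: "carrier V_monoid = {V_rel `` {e} | e :: 'a minf. e * e = e}"
  by (auto simp: V_monoid_def quotient_def idempotents_def)

text \<open>Surjectivity is \<open>le1_idem_rep\<close> and injectivity is \<open>V_rel_iff\<close>.
  The orders match because comparable idempotents differ by a diagonal summand.\<close>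

lemma V_W_iso: "(\<lambda>X. W_rel `` X) \<in> ordered_iso (V_monoid :: 'a minf set ordered_monoid) W_monoid"
  unfolding ordered_iso_def iso_def hom_def mem_Collect_eq
proof (intro conjI ballI)
  let ?h = "\<lambda>X. W_rel `` X" and ?V = "V_monoid :: 'a minf set ordered_monoid"
  have mult: "V_rel `` {e} \<otimes>\<^bsub>?V\<^esub> V_rel `` {f} = V_rel `` {diag_sum m m e f}"
    if "e * e = e" "f * f = f" "e \<in> mats m m" for e f :: "'a minf" and m
    using V_add_class[OF that] by (simp add: V_monoid_def)
  show "?h \<in> carrier ?V \<rightarrow> carrier W_monoid"
    by (auto simp: V_carrier W_carrier W_class_V_class)
  show "?h (X \<otimes>\<^bsub>?V\<^esub> Y) = ?h X \<otimes>\<^bsub>W_monoid\<^esub> ?h Y" if XY: "X \<in> carrier ?V" "Y \<in> carrier ?V" for X Y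
  proof -
    obtain e f where ef: "e * e = e" "f * f = f" "X = V_rel `` {e}" "Y = V_rel `` {f}"
      using XY by (auto simp: V_carrier)
    obtain m where m: "e \<in> mats m m" using ex_mats by blast
    show ?thesis
      using ef m by (simp add: mult W_class_V_class diag_sum_idem W_mult[OF m])
  qed
  show "bij_betw ?h (carrier ?V) (carrier W_monoid)"
    unfolding bij_betw_def
  proof
    show "inj_on ?h (carrier ?V)"
    proof (rule inj_onI)
      fix X Y assume XY: "X \<in> carrier ?V" "Y \<in> carrier ?V" "?h X = ?h Y"
      then obtain e f where ef: "e * e = e" "f * f = f" "X = V_rel `` {e}" "Y = V_rel `` {f}"
        by (auto simp: V_carrier)
      from XY(3) show "X = Y"
        by (simp add: ef W_class_V_class W_class_eq_iff V_class_eq_iff)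
    qed
    show "?h ` carrier ?V = carrier W_monoid"
    proof (intro equalityI subsetI)
      fix Y assume "Y \<in> carrier (W_monoid :: 'a minf set ordered_monoid)"
      then obtain a where "Y = W_class a" by (auto simp: W_carrier)
      moreover obtain e where "e * e = e" "a \<lesssim>\<^sub>1 e" "e \<lesssim>\<^sub>1 a" using le1_idem_rep by blast
      ultimately have "Y = ?h (V_rel `` {e})" "V_rel `` {e} \<in> carrier ?V"
        by (simp add: W_class_V_class W_class_eq_iff, unfold V_carrier, blast)
      then show "Y \<in> ?h ` carrier ?V" by blast
    qed (auto simp: V_carrier W_carrier W_class_V_class)
  qed
  show "?h \<one>\<^bsub>?V\<^esub> = \<one>\<^bsub>W_monoid\<^esub>"
    by (simp add: V_monoid_def W_class_V_class W_one)
  show "mle ?V X Y \<longleftrightarrow> mle W_monoid (?h X) (?h Y)" if XY: "X \<in> carrier ?V" "Y \<in> carrier ?V" for X Y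
  proof -
    obtain e f where ef: "e * e = e" "f * f = f" "X = V_rel `` {e}" "Y = V_rel `` {f}"
      using XY by (auto simp: V_carrier)
    obtain m where m: "e \<in> mats m m" using ex_mats by blast
    have "mle ?V X Y \<longleftrightarrow> (\<exists>Z\<in>carrier ?V. Y = V_add X Z)" by (simp add: V_monoid_def)
    also have "\<dots> \<longleftrightarrow> (\<exists>q. q * q = q \<and> V_rel `` {f} = V_rel `` {diag_sum m m e q})"
      using V_add_class[OF ef(1) _ m] unfolding V_carrier ef by auto
    also have "\<dots> \<longleftrightarrow> (\<exists>q. q * q = q \<and> f \<lesssim>\<^sub>1 diag_sum m m e q \<and> diag_sum m m e q \<lesssim>\<^sub>1 f)"
      using V_class_eq_iff[OF ef(2) diag_sum_idem(1)[OF m ef(1)]] by auto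
    also have "\<dots> \<longleftrightarrow> e \<lesssim>\<^sub>1 f"
      using idem_le1_complement[OF ef(1,2) _ m] le1_diag_sum[OF m] le1_trans by blast
    also have "\<dots> \<longleftrightarrow> mle W_monoid (?h X) (?h Y)"
      by (simp add: ef W_class_V_class W_mle)
    finally show ?thesis .
  qed
qed

text \<open>Both classes are first given idempotent representatives, since
  \<open>idem_le1_complement\<close> produces a complement for those.\<close>

lemma W_mle_algebraic:
  fixes X Y :: "'a minf set"
  assumes "X \<in> carrier W_monoid" "Y \<in> carrier W_monoid"
  shows "mle W_monoid X Y \<longleftrightarrow> algebraic_le W_monoid X Y"
proof -
  obtain a b where ab: "X = W_class a" "Y = W_class b" using assms by (auto simp: W_carrier)
  obtain e where e: "e * e = e" "a \<lesssim>\<^sub>1 e" "e \<lesssim>\<^sub>1 a" using le1_idem_rep by blast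
  obtain f where f: "f * f = f" "b \<lesssim>\<^sub>1 f" "f \<lesssim>\<^sub>1 b" using le1_idem_rep by blast
  have XY: "X = W_class e" "Y = W_class f" using e f by (simp_all add: ab W_class_eq_iff)
  obtain m where m: "e \<in> mats m m" using ex_mats by blast
  have "algebraic_le W_monoid X Y \<longleftrightarrow> (\<exists>q. f \<lesssim>\<^sub>1 diag_sum m m e q \<and> diag_sum m m e q \<lesssim>\<^sub>1 f)"
    by (auto simp: algebraic_le_def W_carrier XY W_mult[OF m] W_class_eq_iff)
  also have "\<dots> \<longleftrightarrow> e \<lesssim>\<^sub>1 f"
    using idem_le1_complement[OF e(1) f(1) _ m] le1_diag_sum[OF m] le1_trans by blast
  finally show ?thesis by (simp add: XY W_mle)
qed

lemma W_WM: "WM_monoid = (W_monoid :: 'a minf set ordered_monoid)" "WM_rel = (W_rel :: ('a minf \<times> _) set)"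
  by (simp_all add: WM_monoid_def W_monoid_def WM_rel_def W_rel_def leM_eq)

text \<open>The two monoids are literally equal, and a class is saturated under its own relation, so
  the natural map is the identity on the carrier.\<close>

lemma W_WM_iso: "(\<lambda>X. WM_rel `` X) \<in> ordered_iso (W_monoid :: 'a minf set ordered_monoid) WM_monoid"
proof -
  let ?W = "W_monoid :: 'a minf set ordered_monoid"
  have id: "W_rel `` X = X" if "X \<in> carrier ?W" for X
    using that equiv_W by (auto simp: W_carrier intro!: equiv_class_image[OF equiv_W] simp: W_rel_iff le1_refl)
  have "X \<otimes>\<^bsub>?W\<^esub> Y \<in> carrier ?W" if XY: "X \<in> carrier ?W" "Y \<in> carrier ?W" for X Y
  proof -
    obtain a b where ab: "X = W_class a" "Y = W_class b" using XY unfolding W_carrier by blast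
    obtain m where "a \<in> mats m m" using ex_mats by blast
    then show ?thesis by (simp add: ab W_mult W_carrier)
  qed
  moreover have "bij_betw (\<lambda>X. W_rel `` X) (carrier ?W) (carrier ?W)"
    by (rule bij_betw_cong[THEN iffD2, OF _ bij_betw_id]) (simp add: id)
  moreover have "\<one>\<^bsub>?W\<^esub> \<in> carrier ?W" by (simp add: W_one W_carrier)
  ultimately show ?thesis
    by (simp add: W_WM ordered_iso_def iso_def hom_def id)
qed

end

section \<open>Sequences and intervals\<close>

lemma T_seqs_mono:
  fixes a :: "nat \<Rightarrow> 'a::{ring,monoid_mult} minf"
  assumes "a \<in> T_seqs" "i \<le> j"
  shows "a i \<lesssim>\<^sub>1 a j"
  using assms(2)
proof (induction rule: dec_induct)
  case (step n)
  moreover have "a n \<lesssim>\<^sub>1 a (Suc n)" using assms(1) by (simp add: T_seqs_def)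
  ultimately show ?case by (blast intro: le1_trans)
qed (rule le1_refl)

lemma T_seqs_le:
  fixes a :: "nat \<Rightarrow> 'a::{ring,monoid_mult} minf"
  shows "a \<in> T_seqs \<Longrightarrow> z \<lesssim>\<^sub>1 a i \<Longrightarrow> i \<le> j \<Longrightarrow> z \<lesssim>\<^sub>1 a j"
  by (rule le1_trans[OF _ T_seqs_mono])

lemma seq_le_refl: "seq_le a (a :: nat \<Rightarrow> 'a::{ring,monoid_mult} minf)"
  unfolding seq_le_def using le1_refl by blast

lemma seq_le_trans: "seq_le a b \<Longrightarrow> seq_le b c \<Longrightarrow> seq_le a (c :: nat \<Rightarrow> 'a::ring minf)"
  unfolding seq_le_def by (meson le1_trans)

lemma equiv_Lambda: "equiv T_seqs (Lambda_rel :: ((nat \<Rightarrow> 'a::{ring,monoid_mult} minf) \<times> _) set)"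
  unfolding Lambda_rel_def by (rule equiv_antisymmetrization) (auto intro: seq_le_refl seq_le_trans)

lemma Lambda_rel_iff: "(a, b) \<in> Lambda_rel \<longleftrightarrow> a \<in> T_seqs \<and> b \<in> T_seqs \<and> seq_le a b \<and> seq_le b a"
  by (simp add: Lambda_rel_def antisymmetrization_def)

abbreviation Lambda_class :: "(nat \<Rightarrow> 'a::ring minf) \<Rightarrow> (nat \<Rightarrow> 'a minf) set" where
  "Lambda_class a \<equiv> Lambda_rel `` {a}"

lemma Lambda_class_eq_iff:
  fixes a b :: "nat \<Rightarrow> 'a::{ring,monoid_mult} minf"
  assumes "a \<in> T_seqs" "b \<in> T_seqs"
  shows "Lambda_class a = Lambda_class b \<longleftrightarrow> seq_le a b \<and> seq_le b a"
  using eq_equiv_class_iff[OF equiv_Lambda assms] assms by (simp add: Lambda_rel_iff)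

lemma Lambda_carrier: "carrier Lambda_monoid = Lambda_class ` T_seqs"
  by (auto simp: Lambda_monoid_def quotient_def)

lemma Lambda_mle:
  fixes a b :: "nat \<Rightarrow> 'a::{ring,monoid_mult} minf"
  assumes "a \<in> T_seqs" "b \<in> T_seqs"
  shows "mle Lambda_monoid (Lambda_class a) (Lambda_class b) \<longleftrightarrow> seq_le a b"
proof -
  have "mle Lambda_monoid (Lambda_class a) (Lambda_class b) \<longleftrightarrow>
      (\<exists>a'\<in>Lambda_class a. \<exists>b'\<in>Lambda_class b. seq_le a' b')"
    by (simp add: Lambda_monoid_def)
  also have "\<dots> \<longleftrightarrow> seq_le a b"
  proof
    assume "\<exists>a'\<in>Lambda_class a. \<exists>b'\<in>Lambda_class b. seq_le a' b'"
    then obtain a' b' where "seq_le a a'" "seq_le a' b'" "seq_le b' b" by (auto simp: Lambda_rel_iff)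
    then show "seq_le a b" by (blast intro: seq_le_trans)
  next
    assume "seq_le a b"
    moreover have "a \<in> Lambda_class a" "b \<in> Lambda_class b"
      using assms by (simp_all add: Lambda_rel_iff seq_le_refl)
    ultimately show "\<exists>a'\<in>Lambda_class a. \<exists>b'\<in>Lambda_class b. seq_le a' b'" by blast
  qed
  finally show ?thesis .
qed

text \<open>Square sizes bounding the terms are chosen to increase, so \<open>a n\<close> counts as
  a \<open>k (Suc n)\<close> by \<open>k n\<close> matrix padded with zeros, and the factors
  \<open>r\<close>, \<open>t\<close> can be cut to the prescribed sizes. The sequence itself is
  kept.\<close>

lemma sized_exists:
  fixes a :: "nat \<Rightarrow> 'a::{ring,monoid_mult} minf"
  assumes "a \<in> T_seqs"
  shows "\<exists>k. sized k a \<and> (\<forall>n. a n \<in> mats (k n) (k n))"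
proof -
  have "\<exists>k. \<forall>n. (a n \<in> mats (k n) (k n)) \<and> k n \<le> k (Suc n)"
    by (rule dependent_nat_choice) (use ex_mats in blast)+
  then obtain k where k: "\<And>n. a n \<in> mats (k n) (k n)" "\<And>n. k n \<le> k (Suc n)" by blast
  have "sized k a"
    unfolding sized_def
  proof (intro allI conjI)
    fix n
    show "a n \<in> mats (k (Suc n)) (k n)" by (rule mats_mono[OF k(1) k(2)]) simp
    obtain r t where rt: "a n = r * a (Suc n) * t" using assms unfolding T_seqs_def le1_def by blast
    let ?U = "unit_mat (k (Suc n)) :: 'a minf" and ?V = "unit_mat (k (Suc (Suc n))) :: 'a minf"
    have 1: "?U * a n = a n" "?U * a (Suc n) = a (Suc n)" "a (Suc n) * ?U = a (Suc n)"
      using k[of n] k(1)[of "Suc n"] mats_mono[OF k(1) k(2), of n "k (Suc n)"]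
      by (auto simp: mats_iff intro: mats_mono)
    have 2: "a n * unit_mat (k n) = a n" "?V * a (Suc n) = a (Suc n)"
      using k(1)[of n] mats_mono[OF k(1) k(2) order_refl, of "Suc n"] by (auto simp: mats_iff)
    have "(?U * r * ?V) * a (Suc n) * (?U * t * unit_mat (k n))
        = ?U * r * (?V * a (Suc n) * ?U) * t * unit_mat (k n)" by (simp only: mult.assoc)
    also have "\<dots> = ?U * (r * a (Suc n) * t) * unit_mat (k n)"
      by (simp only: 1 2) (simp only: mult.assoc)
    also have "\<dots> = a n" by (simp only: 1 2 flip: rt)
    finally have "a n = (?U * r * ?V) * a (Suc n) * (?U * t * unit_mat (k n))" by (rule sym)
    then show "\<exists>v\<in>mats (k (Suc n)) (k (Suc (Suc n))). \<exists>z\<in>mats (k (Suc n)) (k n).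
        a n = v * a (Suc n) * z"
      using mats_cut by blast
  qed
  with k(1) show ?thesis by blast
qed

lemma sized_T_seqs: "sized k u \<Longrightarrow> u \<in> T_seqs"
  unfolding sized_def T_seqs_def le1_def by blast

abbreviation seq_sum :: "(nat \<Rightarrow> nat) \<Rightarrow> (nat \<Rightarrow> 'a::ring minf) \<Rightarrow> (nat \<Rightarrow> 'a minf) \<Rightarrow> nat \<Rightarrow> 'a minf" where
  "seq_sum k u u' \<equiv> (\<lambda>n. diag_sum (k (Suc n)) (k n) (u n) (u' n))"

lemma seq_sum_le:
  fixes u u' w w' :: "nat \<Rightarrow> 'a::{ring,monoid_mult} minf"
  assumes "sized k u" "sized l w" "w' \<in> T_seqs" "seq_le u w" "seq_le u' w'"
  shows "seq_le (seq_sum k u u') (seq_sum l w w')"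
  unfolding seq_le_def
proof
  fix n
  obtain i j where ij: "u n \<lesssim>\<^sub>1 w i" "u' n \<lesssim>\<^sub>1 w' j" using assms(4,5) unfolding seq_le_def by blast
  have "u n \<lesssim>\<^sub>1 w (max i j)" "u' n \<lesssim>\<^sub>1 w' (max i j)"
    by (rule T_seqs_le[OF sized_T_seqs[OF assms(2)] ij(1)] T_seqs_le[OF assms(3) ij(2)], simp)+
  then show "\<exists>m. seq_sum k u u' n \<lesssim>\<^sub>1 seq_sum l w w' m"
    using assms(1,2) by (intro exI[of _ "max i j"] diag_sum_le1) (auto simp: sized_def)
qed

lemma seq_sum_T_seqs:
  fixes u u' :: "nat \<Rightarrow> 'a::{ring,monoid_mult} minf"
  assumes "sized k u" "u' \<in> T_seqs"
  shows "seq_sum k u u' \<in> T_seqs"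
  unfolding T_seqs_def
proof (intro CollectI allI)
  fix n
  show "seq_sum k u u' n \<lesssim>\<^sub>1 seq_sum k u u' (Suc n)"
    using assms sized_T_seqs[OF assms(1)]
    by (intro diag_sum_le1) (auto simp: sized_def T_seqs_def)
qed

text \<open>The sum is taken over all sized representatives; by \<open>seq_sum_le\<close> neither
  they nor their sizes influence the resulting class.\<close>

lemma Lambda_mult:
  fixes u u' :: "nat \<Rightarrow> 'a::{ring,monoid_mult} minf"
  assumes "sized k u" "u' \<in> T_seqs"
  shows "Lambda_class u \<otimes>\<^bsub>Lambda_monoid\<^esub> Lambda_class u' = Lambda_class (seq_sum k u u')"
proof -
  let ?S = "{Lambda_class (seq_sum k w w') | w w' k k'. w \<in> Lambda_class u \<and> w' \<in> Lambda_class u' \<and>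
    sized k w \<and> sized k' w'}"
  have "Lambda_class u \<otimes>\<^bsub>Lambda_monoid\<^esub> Lambda_class u' = \<Union>?S" by (simp add: Lambda_monoid_def)
  also have "\<dots> = Lambda_class (seq_sum k u u')"
  proof (rule Union_eqI)
    obtain k' where "sized k' u'" using sized_exists[OF assms(2)] by blast
    moreover have "u \<in> Lambda_class u" "u' \<in> Lambda_class u'"
      using assms sized_T_seqs[OF assms(1)] by (simp_all add: Lambda_rel_iff seq_le_refl)
    ultimately have "Lambda_class (seq_sum k u u') \<in> ?S" using assms(1) by blast
    then show "?S \<noteq> {}" by blast
  next
    fix X assume "X \<in> ?S"
    then obtain w w' l where X: "X = Lambda_class (seq_sum l w w')"
      and *: "w \<in> Lambda_class u" "w' \<in> Lambda_class u'" "sized l w" by blast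
    then have "seq_le (seq_sum l w w') (seq_sum k u u')" "seq_le (seq_sum k u u') (seq_sum l w w')"
      using assms by (auto simp: Lambda_rel_iff intro!: seq_sum_le)
    moreover have "w' \<in> T_seqs" using * by (simp add: Lambda_rel_iff)
    ultimately show "X = Lambda_class (seq_sum k u u')"
      unfolding X using * assms by (subst Lambda_class_eq_iff) (auto intro: seq_sum_T_seqs)
  qed
  finally show ?thesis .
qed

section \<open>Countably generated intervals and their cofinal sequences\<close>

definition W_interval :: "(nat \<Rightarrow> 'a::{ring,monoid_mult} minf) \<Rightarrow> 'a minf set set" where
  "W_interval a = {W_class z | z. \<exists>n. z \<lesssim>\<^sub>1 a n}"

lemma W_class_in_interval:
  fixes z :: "'a::{ring,monoid_mult} minf"
  shows "W_class z \<in> W_interval a \<longleftrightarrow> (\<exists>n. z \<lesssim>\<^sub>1 a n)"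
  unfolding W_interval_def mem_Collect_eq W_class_eq_iff by (blast intro: le1_trans le1_refl)

lemma W_interval_subset_iff:
  fixes a b :: "nat \<Rightarrow> 'a::{ring,monoid_mult} minf"
  shows "W_interval a \<subseteq> W_interval b \<longleftrightarrow> seq_le a b"
proof
  assume "W_interval a \<subseteq> W_interval b"
  moreover have "W_class (a n) \<in> W_interval a" for n
    unfolding W_class_in_interval using le1_refl by blast
  ultimately show "seq_le a b" unfolding seq_le_def using W_class_in_interval by blast
next
  assume "seq_le a b"
  then show "W_interval a \<subseteq> W_interval b"
    unfolding W_interval_def seq_le_def by (blast intro: le1_trans)
qed

lemma W_interval_in_intervals:
  fixes a :: "nat \<Rightarrow> 'a::{ring,monoid_mult} minf"
  assumes "a \<in> T_seqs"
  shows "W_interval a \<in> W_intervals"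
  unfolding W_intervals_def
proof (intro CollectI conjI ballI impI)
  have in_I: "W_class (a n) \<in> W_interval a" for n
    unfolding W_class_in_interval using le1_refl by blast
  show "W_interval a \<subseteq> carrier W_monoid" by (auto simp: W_interval_def W_carrier)
  show "W_interval a \<noteq> {}" using in_I by blast
  show "\<exists>C\<subseteq>W_interval a. countable C \<and> (\<forall>x\<in>W_interval a. \<exists>c\<in>C. mle W_monoid x c)"
    using in_I by (intro exI[of _ "range (\<lambda>n. W_class (a n))"]) (auto simp: W_interval_def W_mle)
next
  fix x y assume "x \<in> W_interval a" "y \<in> W_interval a"
  then obtain z w m n where xy: "x = W_class z" "y = W_class w" "z \<lesssim>\<^sub>1 a m" "w \<lesssim>\<^sub>1 a n"
    by (auto simp: W_interval_def)
  have "z \<lesssim>\<^sub>1 a (max m n)" "w \<lesssim>\<^sub>1 a (max m n)"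
    by (rule T_seqs_le[OF assms xy(3)] T_seqs_le[OF assms xy(4)], simp)+
  then show "\<exists>z\<in>W_interval a. mle W_monoid x z \<and> mle W_monoid y z"
    by (intro bexI[of _ "W_class (a (max m n))"]) (auto simp: xy W_mle W_class_in_interval intro: le1_refl)
next
  fix x y assume "x \<in> W_interval a" "y \<in> carrier W_monoid" "mle W_monoid y x"
  then obtain z w n where "x = W_class z" "y = W_class w" "z \<lesssim>\<^sub>1 a n" "w \<lesssim>\<^sub>1 z"
    by (auto simp: W_interval_def W_carrier W_mle)
  then show "y \<in> W_interval a" by (auto simp: W_class_in_interval intro: le1_trans)
qed

text \<open>Directedness lets each new term dominate both its predecessor and the next element of an
  enumeration of the countable cofinal set, so the sequence is increasing and cofinal.\<close>

lemma W_interval_exists: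
  fixes I :: "'a::{ring,monoid_mult} minf set set"
  assumes "I \<in> W_intervals"
  shows "\<exists>a\<in>T_seqs. I = W_interval a"
proof -
  have sub: "I \<subseteq> carrier W_monoid" and ne: "I \<noteq> {}"
    and dir: "\<And>x y. x \<in> I \<Longrightarrow> y \<in> I \<Longrightarrow> \<exists>z\<in>I. mle W_monoid x z \<and> mle W_monoid y z"
    and her: "\<And>x y. x \<in> I \<Longrightarrow> y \<in> carrier W_monoid \<Longrightarrow> mle W_monoid y x \<Longrightarrow> y \<in> I"
    using assms unfolding W_intervals_def by blast+
  obtain C where C: "C \<subseteq> I" "countable C" "\<forall>x\<in>I. \<exists>c\<in>C. mle W_monoid x c"
    using assms unfolding W_intervals_def by blast
  have "C \<noteq> {}" using ne C(3) by blast
  define c where "c = from_nat_into C"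
  have c: "range c = C" unfolding c_def using C(2) \<open>C \<noteq> {}\<close> by (rule range_from_nat_into[rotated])
  have cI: "c n \<in> I" for n using c C(1) by blast
  have rep: "\<exists>a. x = W_class a" if "x \<in> I" for x using that sub by (auto simp: W_carrier)
  have "\<exists>a. \<forall>n. (W_class (a n) \<in> I \<and> mle W_monoid (c n) (W_class (a n))) \<and> a n \<lesssim>\<^sub>1 a (Suc n)"
  proof (rule dependent_nat_choice)
    obtain z where "z \<in> I" "mle W_monoid (c 0) z" using dir[OF cI cI, of 0 0] by blast
    then show "\<exists>a. W_class a \<in> I \<and> mle W_monoid (c 0) (W_class a)" using rep by blast
  next
    fix a n assume a: "W_class a \<in> I \<and> mle W_monoid (c n) (W_class a)"
    obtain z where "z \<in> I" "mle W_monoid (c (Suc n)) z" "mle W_monoid (W_class a) z"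
      using dir[OF cI, of "W_class a" "Suc n"] a by blast
    moreover from this obtain b where "z = W_class b" using rep by blast
    ultimately show "\<exists>b. (W_class b \<in> I \<and> mle W_monoid (c (Suc n)) (W_class b)) \<and> a \<lesssim>\<^sub>1 b"
      by (auto simp: W_mle)
  qed
  then obtain a where a: "\<And>n. W_class (a n) \<in> I" "\<And>n. mle W_monoid (c n) (W_class (a n))"
    "\<And>n. a n \<lesssim>\<^sub>1 a (Suc n)" by blast
  have "I = W_interval a"
  proof (intro equalityI subsetI)
    fix x assume x: "x \<in> I"
    then obtain n where n: "mle W_monoid x (c n)" using C(3) c by blast
    obtain z w where "x = W_class z" "c n = W_class w" using rep x cI by meson
    with n a(2)[of n] show "x \<in> W_interval a"
      by (auto simp: W_mle W_class_in_interval intro: le1_trans)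
  next
    fix x assume "x \<in> W_interval a"
    then obtain z n where "x = W_class z" "z \<lesssim>\<^sub>1 a n" by (auto simp: W_interval_def)
    then show "x \<in> I" by (intro her[OF a(1)]) (auto simp: W_carrier W_mle)
  qed
  moreover have "a \<in> T_seqs" using a(3) by (simp add: T_seqs_def)
  ultimately show ?thesis by blast
qed

lemma LambdaW_to_Lambda_interval:
  fixes a :: "nat \<Rightarrow> 'a::{ring,monoid_mult} minf"
  assumes "a \<in> T_seqs"
  shows "LambdaW_to_Lambda (W_interval a) = Lambda_class a"
  unfolding LambdaW_to_Lambda_def
proof (rule Union_eqI)
  let ?S = "{Lambda_class b | b. b \<in> T_seqs \<and> (\<forall>n. W_class (b n) \<in> W_interval a) \<and>
    (\<forall>z\<in>W_interval a. \<exists>n. mle W_monoid z (W_class (b n)))}"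
  have cofinal: "(\<forall>n. W_class (b n) \<in> W_interval a) \<longleftrightarrow> seq_le b a"
    "(\<forall>z\<in>W_interval a. \<exists>n. mle W_monoid z (W_class (b n))) \<longleftrightarrow> seq_le a b" for b
  proof -
    show "(\<forall>n. W_class (b n) \<in> W_interval a) \<longleftrightarrow> seq_le b a"
      by (simp add: W_class_in_interval seq_le_def)
    show "(\<forall>z\<in>W_interval a. \<exists>n. mle W_monoid z (W_class (b n))) \<longleftrightarrow> seq_le a b"
    proof
      assume *: "\<forall>z\<in>W_interval a. \<exists>n. mle W_monoid z (W_class (b n))"
      have "W_class (a n) \<in> W_interval a" for n
        unfolding W_class_in_interval using le1_refl by blast
      with * show "seq_le a b" unfolding seq_le_def by (metis W_mle)
    next
      assume "seq_le a b"
      then show "\<forall>z\<in>W_interval a. \<exists>n. mle W_monoid z (W_class (b n))"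
        unfolding W_interval_def seq_le_def by (auto simp: W_mle) (blast intro: le1_trans)
    qed
  qed
  have "Lambda_class a \<in> ?S" unfolding cofinal using assms seq_le_refl by blast
  then show "?S \<noteq> {}" by blast
  fix X assume "X \<in> ?S"
  then show "X = Lambda_class a" unfolding cofinal using assms Lambda_class_eq_iff by blast
qed

lemma LambdaW_carrier: "carrier LambdaW_monoid = W_interval ` T_seqs"
  using W_interval_exists W_interval_in_intervals by (auto simp: LambdaW_monoid_def)

lemma LambdaW_mult:
  fixes a b :: "nat \<Rightarrow> 'a::{ring,monoid_mult} minf"
  assumes "sized k a" "b \<in> T_seqs"
  shows "W_interval a \<otimes>\<^bsub>LambdaW_monoid\<^esub> W_interval b = W_interval (seq_sum k a b)"
proof (intro equalityI subsetI)
  have k: "a n \<in> mats (k (Suc n)) (k n)" for n using assms(1) by (simp add: sized_def)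
  fix x assume "x \<in> W_interval a \<otimes>\<^bsub>LambdaW_monoid\<^esub> W_interval b"
  then obtain z u w i j where x: "x = W_class z" "mle W_monoid (W_class z) (W_class u \<otimes>\<^bsub>W_monoid\<^esub> W_class w)"
    "u \<lesssim>\<^sub>1 a i" "w \<lesssim>\<^sub>1 b j"
    by (auto simp: LambdaW_monoid_def W_interval_def W_carrier)
  obtain m where m: "u \<in> mats m m" using ex_mats by blast
  have "z \<lesssim>\<^sub>1 diag_sum m m u w" using x(2) by (simp add: W_mult[OF m] W_mle)
  also have "diag_sum m m u w \<lesssim>\<^sub>1 seq_sum k a b (max i j)"
  proof (rule diag_sum_le1[OF m k])
    show "u \<lesssim>\<^sub>1 a (max i j)" by (rule T_seqs_le[OF sized_T_seqs[OF assms(1)] x(3)]) simp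
    show "w \<lesssim>\<^sub>1 b (max i j)" by (rule T_seqs_le[OF assms(2) x(4)]) simp
  qed
  finally show "x \<in> W_interval (seq_sum k a b)" unfolding x(1) W_class_in_interval by blast
next
  have k: "a n \<in> mats (k (Suc n)) (k n)" for n using assms(1) by (simp add: sized_def)
  fix x assume "x \<in> W_interval (seq_sum k a b)"
  then obtain z n where x: "x = W_class z" "z \<lesssim>\<^sub>1 seq_sum k a b n" by (auto simp: W_interval_def)
  then have "mle W_monoid x (W_class (a n) \<otimes>\<^bsub>W_monoid\<^esub> W_class (b n))"
    by (simp add: W_mult[OF k] W_mle)
  moreover have "W_class (a n) \<in> W_interval a" "W_class (b n) \<in> W_interval b"
    unfolding W_class_in_interval using le1_refl by blast+
  ultimately show "x \<in> W_interval a \<otimes>\<^bsub>LambdaW_monoid\<^esub> W_interval b"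
    using x(1) by (auto simp: LambdaW_monoid_def W_carrier)
qed

lemma LambdaW_Lambda_iso:
  "LambdaW_to_Lambda \<in> ordered_iso (LambdaW_monoid :: 'a::{ring,monoid_mult} minf set set ordered_monoid) Lambda_monoid"
  unfolding ordered_iso_def iso_def hom_def mem_Collect_eq
proof (intro conjI ballI)
  let ?L = "LambdaW_monoid :: 'a minf set set ordered_monoid"
  note L = LambdaW_carrier Lambda_carrier LambdaW_to_Lambda_interval
  show "LambdaW_to_Lambda \<in> carrier ?L \<rightarrow> carrier Lambda_monoid" by (auto simp: L)
  show "LambdaW_to_Lambda (I \<otimes>\<^bsub>?L\<^esub> J) = LambdaW_to_Lambda I \<otimes>\<^bsub>Lambda_monoid\<^esub> LambdaW_to_Lambda J"
    if IJ: "I \<in> carrier ?L" "J \<in> carrier ?L" for I J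
  proof -
    obtain a b where ab: "I = W_interval a" "J = W_interval b" "a \<in> T_seqs" "b \<in> T_seqs"
      using IJ by (auto simp: L)
    obtain k where k: "sized k a" using sized_exists[OF ab(3)] by blast
    show ?thesis
      unfolding ab(1,2) LambdaW_mult[OF k ab(4)] LambdaW_to_Lambda_interval[OF ab(3)]
        LambdaW_to_Lambda_interval[OF ab(4)] Lambda_mult[OF k ab(4)]
      by (rule LambdaW_to_Lambda_interval[OF seq_sum_T_seqs[OF k ab(4)]])
  qed
  show "bij_betw LambdaW_to_Lambda (carrier ?L) (carrier Lambda_monoid)"
    unfolding bij_betw_def
  proof
    show "inj_on LambdaW_to_Lambda (carrier ?L)"
    proof (rule inj_onI)
      fix I J assume IJ: "I \<in> carrier ?L" "J \<in> carrier ?L" "LambdaW_to_Lambda I = LambdaW_to_Lambda J"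
      obtain a b where ab: "I = W_interval a" "J = W_interval b" "a \<in> T_seqs" "b \<in> T_seqs"
        using IJ by (auto simp: L)
      have "seq_le a b \<and> seq_le b a"
        using IJ(3) Lambda_class_eq_iff[OF ab(3,4)] by (simp add: ab LambdaW_to_Lambda_interval)
      then show "I = J" unfolding ab using W_interval_subset_iff by blast
    qed
    show "LambdaW_to_Lambda ` carrier ?L = carrier Lambda_monoid"
      by (simp add: L image_image)
  qed
  have zero: "(\<lambda>_. 0 :: 'a minf) \<in> T_seqs" by (simp add: T_seqs_def le1_refl)
  have "\<one>\<^bsub>?L\<^esub> = W_interval (\<lambda>_. 0)"
    by (auto simp: LambdaW_monoid_def W_interval_def W_one W_carrier W_mle)
  then show "LambdaW_to_Lambda \<one>\<^bsub>?L\<^esub> = \<one>\<^bsub>Lambda_monoid\<^esub>"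
    by (simp add: LambdaW_to_Lambda_interval[OF zero]) (simp add: Lambda_monoid_def)
  show "mle ?L I J \<longleftrightarrow> mle Lambda_monoid (LambdaW_to_Lambda I) (LambdaW_to_Lambda J)"
    if IJ: "I \<in> carrier ?L" "J \<in> carrier ?L" for I J
  proof -
    obtain a b where ab: "I = W_interval a" "J = W_interval b" "a \<in> T_seqs" "b \<in> T_seqs"
      using IJ by (auto simp: L)
    have "mle ?L I J \<longleftrightarrow> I \<subseteq> J" by (simp add: LambdaW_monoid_def)
    then show ?thesis by (simp add: ab LambdaW_to_Lambda_interval Lambda_mle W_interval_subset_iff)
  qed
qed


section \<open>Increasing sequences of idempotents\<close>

text \<open>The usual order of idempotents along the sequence; the case \<open>i = j\<close>
  contains idempotency.\<close>

definition idem_chain :: "(nat \<Rightarrow> 'b::ring) \<Rightarrow> bool" where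
  "idem_chain e \<longleftrightarrow> (\<forall>i j. i \<le> j \<longrightarrow> e i * e j = e i \<and> e j * e i = e i)"

lemma idem_chainI:
  fixes e :: "nat \<Rightarrow> 'b::ring"
  assumes "\<And>n. e n * e n = e n" "\<And>n. e n * e (Suc n) = e n" "\<And>n. e (Suc n) * e n = e n"
  shows "idem_chain e"
proof -
  have "e i * e j = e i \<and> e j * e i = e i" if "i \<le> j" for i j
    using that
  proof (induction rule: dec_induct)
    case (step n)
    then show ?case
      using absorb_right[of "e i" "e n" "e (Suc n)"] absorb_left[of "e n" "e i" "e (Suc n)"]
        assms by auto
  qed (simp add: assms)
  then show ?thesis by (simp add: idem_chain_def)
qed

lemma idem_chain_mult: "idem_chain e \<Longrightarrow> e i * e j = e (min i j)"
  by (cases "i \<le> j") (auto simp: idem_chain_def min_def)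

lemma idem_chain_T_seqs:
  assumes "idem_chain (e :: nat \<Rightarrow> 'a::ring minf)"
  shows "e \<in> T_seqs"
  unfolding T_seqs_def
proof (intro CollectI allI)
  fix n
  have "e n = e n * e (Suc n) * e n" using idem_chain_mult[OF assms] by simp
  then show "e n \<lesssim>\<^sub>1 e (Suc n)" by (rule le1I)
qed

context
  assumes ur: "unit_regular TYPE('a::{ring,monoid_mult})"
begin

text \<open>An idempotent equivalent to the next term is replaced by
  \<open>diag_sum m m e q\<close>, in which the previous idempotent \<open>e\<close> sits as a
  corner. This turns comparability into actual containment.\<close>

lemma idem_chain_exists:
  fixes x :: "nat \<Rightarrow> 'a minf"
  assumes "x \<in> T_seqs"
  shows "\<exists>e. idem_chain e \<and> seq_le x e \<and> seq_le e x"
proof -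
  let ?P = "\<lambda>n e. e * e = e \<and> e \<lesssim>\<^sub>1 x n \<and> x n \<lesssim>\<^sub>1 e"
  have "\<exists>e. \<forall>n. ?P n (e n) \<and> (e n * e (Suc n) = e n \<and> e (Suc n) * e n = e n)"
  proof (rule dependent_nat_choice)
    show "\<exists>e. ?P 0 e" using le1_idem_rep[OF ur, of "x 0"] by blast
  next
    fix e n assume e: "?P n e"
    obtain f where f: "?P (Suc n) f" using le1_idem_rep[OF ur, of "x (Suc n)"] by blast
    have "x n \<lesssim>\<^sub>1 x (Suc n)" using assms by (simp add: T_seqs_def)
    then have ef: "e \<lesssim>\<^sub>1 f" using e f by (blast intro: le1_trans)
    obtain m where m: "e \<in> mats m m" using ex_mats by blast
    obtain q where q: "q * q = q" "f \<lesssim>\<^sub>1 diag_sum m m e q" "diag_sum m m e q \<lesssim>\<^sub>1 f"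
      using idem_le1_complement[OF ur _ _ ef m] e f by blast
    have "?P (Suc n) (diag_sum m m e q)"
      using diag_sum_idem(1)[OF m _ q(1)] e f q by (blast intro: le1_trans)
    moreover have "e * diag_sum m m e q = e \<and> diag_sum m m e q * e = e"
      using diag_sum_idem(2,3)[OF m _ q(1)] e by blast
    ultimately show "\<exists>e'. ?P (Suc n) e' \<and> (e * e' = e \<and> e' * e = e)" by blast
  qed
  then obtain e where e: "\<And>n. ?P n (e n)" "\<And>n. e n * e (Suc n) = e n" "\<And>n. e (Suc n) * e n = e n"
    by blast
  have "idem_chain e" using e by (intro idem_chainI) blast+
  then show ?thesis using e(1) unfolding seq_le_def by blast
qed

text \<open>A chain of idempotents satisfies the splitting condition with
  \<open>y = e (Suc n)\<close>, and every class contains such a chain.\<close>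

lemma S_eq_Lambda: "S_monoid = (Lambda_monoid :: (nat \<Rightarrow> 'a minf) set ordered_monoid)"
proof -
  have "{Lambda_class x | x. x \<in> T_seqs \<and> (\<forall>n. \<exists>y. y * x (Suc n) * x n = x n)}
      = carrier (Lambda_monoid :: (nat \<Rightarrow> 'a minf) set ordered_monoid)"
    unfolding Lambda_carrier
  proof (intro equalityI subsetI)
    fix X assume "X \<in> Lambda_class ` (T_seqs :: (nat \<Rightarrow> 'a minf) set)"
    then obtain x where x: "x \<in> T_seqs" "X = Lambda_class x" by blast
    obtain e where e: "idem_chain e" "seq_le x e" "seq_le e x" using idem_chain_exists[OF x(1)] by blast
    have "X = Lambda_class e"
      using e Lambda_class_eq_iff[OF x(1) idem_chain_T_seqs[OF e(1)]] by (simp add: x)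
    moreover have "e (Suc n) * e (Suc n) * e n = e n" for n
      by (simp add: idem_chain_mult[OF e(1)] mult.assoc)
    ultimately show "X \<in> {Lambda_class x | x. x \<in> T_seqs \<and> (\<forall>n. \<exists>y. y * x (Suc n) * x n = x n)}"
      using idem_chain_T_seqs[OF e(1)] by blast
  qed blast
  then show ?thesis by (simp add: S_monoid_def)
qed

end

section \<open>Matrices acting on columns\<close>

abbreviation columns :: "('a::{ring,monoid_mult}, nat \<Rightarrow> 'a) rmod" where
  "columns \<equiv> free_rmod UNIV"

abbreviation std :: "'i \<Rightarrow> 'i \<Rightarrow> 'a::{ring,monoid_mult}" where
  "std j \<equiv> (\<lambda>i. if i = j then 1 else 0)"

text \<open>The matrix with columns \<open>c 0\<close> to \<open>c (n - 1)\<close>. A column of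
  infinite support is replaced by zero, which keeps the result finitely supported for every
  argument.\<close>

lift_definition of_cols :: "nat \<Rightarrow> (nat \<Rightarrow> nat \<Rightarrow> 'a) \<Rightarrow> 'a::zero minf"
  is "\<lambda>n c i j. if j < n \<and> finite {i. c j i \<noteq> 0} then c j i else 0"
  subgoal for n c
  proof (rule finite_subset[of _ "\<Union>j\<in>{j. j < n \<and> finite {i. c j i \<noteq> 0}}. {i. c j i \<noteq> 0} \<times> {j}"])
    show "finite (\<Union>j\<in>{j. j < n \<and> finite {i. c j i \<noteq> 0}}. {i. c j i \<noteq> 0} \<times> {j})" by auto
  qed (auto split: if_splits)
  done

lemma mat_vec_superset:
  assumes "finite K" "{k. v k \<noteq> 0} \<subseteq> K"
  shows "mat_vec x v i = (\<Sum>k\<in>K. entry x i k * v k)"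
  unfolding mat_vec_def using assms by (intro sum.mono_neutral_left) auto

text \<open>A column is viewed as a matrix with one column, so that compatibility with products
  reduces to associativity in the matrix ring.\<close>

lemma mat_vec_times:
  assumes "finite {k. v k \<noteq> 0}"
  shows "mat_vec x v i = entry (x * of_cols 1 (\<lambda>_. v)) i 0"
proof -
  let ?K = "{k. entry x i k \<noteq> 0} \<union> {k. v k \<noteq> 0}"
  have "mat_vec x v i = (\<Sum>k\<in>?K. entry x i k * v k)"
    by (rule mat_vec_superset) (use assms in auto)
  also have "\<dots> = (\<Sum>k\<in>?K. entry x i k * entry (of_cols 1 (\<lambda>_. v)) k 0)"
    using assms by (simp add: of_cols.rep_eq)
  also have "\<dots> = entry (x * of_cols 1 (\<lambda>_. v)) i 0"
    by (rule entry_times_superset[symmetric]) (use assms in auto)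
  finally show ?thesis .
qed

lemma mat_vec_outside:
  assumes "x \<in> mats m n" "m \<le> i"
  shows "mat_vec x v i = 0"
proof -
  have "entry x i k = 0" for k using assms leD unfolding mats_def by blast
  then show ?thesis by (simp add: mat_vec_def)
qed

lemma mat_vec_closed:
  assumes "x \<in> mats m n"
  shows "mat_vec x v \<in> carrier (free_rmod {..<m})"
proof -
  have "{i. mat_vec x v i \<noteq> 0} \<subseteq> {..<m}"
    using mat_vec_outside[OF assms] by (auto simp: not_less[symmetric])
  then show ?thesis by (simp add: free_rmod_def finite_subset)
qed

lemma mat_vec_finite [simp]:
  fixes x :: "'a::{ring,monoid_mult} minf"
  shows "finite {i. mat_vec x v i \<noteq> 0}"
proof -
  obtain n where "x \<in> mats n n" using ex_mats by blast
  from mat_vec_closed[OF this] show ?thesis by (simp add: free_rmod_def)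
qed

lemma mat_vec_mult:
  fixes x y :: "'a::{ring,monoid_mult} minf"
  assumes "finite {k. v k \<noteq> 0}"
  shows "mat_vec (x * y) v = mat_vec x (mat_vec y v)"
proof
  fix i
  have "entry (y * of_cols 1 (\<lambda>_. v)) k j = entry (of_cols 1 (\<lambda>_. mat_vec y v)) k j" for k j
  proof (cases "j = 0")
    case True
    then show ?thesis by (simp add: mat_vec_times[OF assms, symmetric] of_cols.rep_eq del: One_nat_def)
  next
    case False
    then show ?thesis by (simp add: times_minf.rep_eq of_cols.rep_eq)
  qed
  then have *: "y * of_cols 1 (\<lambda>_. v) = of_cols 1 (\<lambda>_. mat_vec y v)" by (rule minf_eqI)
  have "mat_vec (x * y) v i = entry (x * (y * of_cols 1 (\<lambda>_. v))) i 0"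
    by (subst mat_vec_times[OF assms]) (simp only: mult.assoc)
  also have "\<dots> = mat_vec x (mat_vec y v) i"
    unfolding * by (rule mat_vec_times[symmetric]) simp
  finally show "mat_vec (x * y) v i = mat_vec x (mat_vec y v) i" .
qed

lemma mat_vec_add: "mat_vec x (\<lambda>i. v i + w i) = (\<lambda>i. mat_vec x v i + mat_vec x w i)"
  if "finite {i. v i \<noteq> 0}" "finite {i. w i \<noteq> 0}"
proof
  fix i
  let ?K = "{i. v i \<noteq> 0} \<union> {i. w i \<noteq> 0}"
  have "mat_vec x u i = (\<Sum>k\<in>?K. entry x i k * u k)" if "{i. u i \<noteq> 0} \<subseteq> ?K" for u
    by (rule mat_vec_superset) (use that \<open>finite {i. v i \<noteq> 0}\<close> \<open>finite {i. w i \<noteq> 0}\<close> in auto)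
  moreover have "{i. v i + w i \<noteq> 0} \<subseteq> ?K" by auto
  ultimately show "mat_vec x (\<lambda>i. v i + w i) i = mat_vec x v i + mat_vec x w i"
    by (simp add: distrib_left sum.distrib)
qed

lemma mat_vec_scale:
  assumes "finite {i. v i \<noteq> 0}"
  shows "mat_vec x (\<lambda>i. v i * r) = (\<lambda>i. mat_vec x v i * r)"
proof
  fix i
  have "mat_vec x (\<lambda>i. v i * r) i = (\<Sum>k | v k \<noteq> 0. entry x i k * (v k * r))"
    by (rule mat_vec_superset) (use assms in auto)
  then show "mat_vec x (\<lambda>i. v i * r) i = mat_vec x v i * r"
    by (simp add: mat_vec_def sum_distrib_right mult.assoc)
qed

lemma mat_vec_0 [simp]: "mat_vec 0 v = (\<lambda>_. 0)" "mat_vec x (\<lambda>_. 0) = (\<lambda>_. 0)"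
  by (simp_all add: mat_vec_def zero_minf.rep_eq fun_eq_iff)

lemma mat_vec_plus: "mat_vec (x + y) v = (\<lambda>i. mat_vec x v i + mat_vec y v i)"
  by (simp add: mat_vec_def plus_minf.rep_eq distrib_right sum.distrib fun_eq_iff)

lemma mat_vec_diff: "mat_vec (x - y) v = (\<lambda>i. mat_vec x v i - mat_vec y v i)"
  by (simp add: mat_vec_def minus_minf.rep_eq left_diff_distrib sum_subtractf fun_eq_iff)

lemma mat_vec_std:
  fixes x :: "'a::{ring,monoid_mult} minf"
  shows "mat_vec x (std j) = (\<lambda>i. entry x i j)"
proof
  fix i
  have "mat_vec x (std j) i = (\<Sum>k\<in>{j}. entry x i k * std j k)"
    by (rule mat_vec_superset) auto
  then show "mat_vec x (std j) i = entry x i j" by simp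
qed

text \<open>Beyond the common column bound both matrices vanish; the row bounds may differ.\<close>

lemma mats_eqI:
  fixes x y :: "'a::{ring,monoid_mult} minf"
  assumes "x \<in> mats m n" "y \<in> mats m' n" "\<And>j. j < n \<Longrightarrow> mat_vec x (std j) = mat_vec y (std j)"
  shows "x = y"
proof (rule minf_eqI)
  fix i j
  show "entry x i j = entry y i j"
  proof (cases "j < n")
    case True
    then show ?thesis using assms(3)[of j] unfolding mat_vec_std by metis
  next
    case False
    then show ?thesis using assms(1,2) unfolding mats_def by (metis (mono_tags, lifting) mem_Collect_eq)
  qed
qed

lemma of_cols_std:
  fixes c :: "nat \<Rightarrow> nat \<Rightarrow> 'a::{ring,monoid_mult}"
  assumes "finite {i. c j i \<noteq> 0}" "j < n"
  shows "mat_vec (of_cols n c) (std j) = c j"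
  using assms by (simp add: mat_vec_std of_cols.rep_eq fun_eq_iff)

lemma std_closed: "j \<in> I \<Longrightarrow> std j \<in> carrier (free_rmod I)"
  by (auto simp: free_rmod_def)

lemma mat_vec_rhom:
  fixes x :: "'a::{ring,monoid_mult} minf"
  shows "x \<in> mats m n \<Longrightarrow> mat_vec x \<in> rhom (free_rmod I) (free_rmod {..<m})"
  using mat_vec_closed[of x m n] by (auto simp: rhom_def free_rmod_def mat_vec_add mat_vec_scale)

lemma mat_vec_unit:
  "v \<in> carrier (free_rmod {..<n}) \<Longrightarrow> mat_vec (unit_mat n) v = v"
proof
  fix i assume v: "v \<in> carrier (free_rmod {..<n})"
  have "mat_vec (unit_mat n) v i = (\<Sum>k | v k \<noteq> 0. if k = i then v i else 0)"
    unfolding mat_vec_def by (rule sum.cong) (use v in \<open>auto simp: unit_mat.rep_eq free_rmod_def\<close>)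
  also have "\<dots> = v i" using v by (simp add: free_rmod_def sum.delta')
  finally show "mat_vec (unit_mat n) v i = v i" .
qed


section \<open>Homomorphisms and submodules\<close>

text \<open>Induction on a finite set containing the support, splitting off one coordinate at a
  time. It replaces manipulations of finite linear combinations.\<close>

lemma free_rmod_induct [consumes 1, case_names zero add std]:
  fixes v :: "'i \<Rightarrow> 'a::{ring,monoid_mult}"
  assumes v: "v \<in> carrier (free_rmod I)"
    and zero: "P (\<lambda>_. 0)"
    and add: "\<And>v w. v \<in> carrier (free_rmod I) \<Longrightarrow> w \<in> carrier (free_rmod I) \<Longrightarrow> P v \<Longrightarrow> P w
      \<Longrightarrow> P (\<lambda>i. v i + w i)"
    and std: "\<And>j r. j \<in> I \<Longrightarrow> P (\<lambda>i. std j i * r)"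
  shows "P v"
proof -
  have "finite S \<Longrightarrow> {i. v i \<noteq> 0} \<subseteq> S \<Longrightarrow> S \<subseteq> I \<Longrightarrow> P v" for S and v :: "'i \<Rightarrow> 'a"
  proof (induction S arbitrary: v rule: finite_induct)
    case empty
    then have "v = (\<lambda>_. 0)" by auto
    then show ?case using zero by simp
  next
    case (insert j S)
    let ?v = "\<lambda>i. if i = j then 0 else v i"
    have sub: "{i. ?v i \<noteq> 0} \<subseteq> S" using insert.prems(1) by auto
    have SI: "S \<subseteq> I" "j \<in> I" using insert.prems(2) by auto
    have "P ?v" by (rule insert.IH[OF sub SI(1)])
    moreover have "P (\<lambda>i. std j i * v j)" using insert.prems(2) by (intro std) simp
    moreover have "?v \<in> carrier (free_rmod I)"
      using subset_trans[OF sub SI(1)] finite_subset[OF sub insert.hyps(1)] by (simp add: free_rmod_def)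
    moreover have "{i. std j i * v j \<noteq> 0} \<subseteq> {j}" by auto
    then have "(\<lambda>i. std j i * v j) \<in> carrier (free_rmod I)"
      using SI(2) finite_subset[of _ "{j}"] unfolding free_rmod_def by auto
    ultimately have "P (\<lambda>i. ?v i + std j i * v j)" by (intro add)
    moreover have "(\<lambda>i. ?v i + std j i * v j) = v" by auto
    ultimately show ?case by simp
  qed
  then show ?thesis using v by (auto simp: free_rmod_def)
qed

lemma free_sel:
  "\<zero>\<^bsub>free_rmod I\<^esub> = (\<lambda>_. 0)" "v \<oplus>\<^bsub>free_rmod I\<^esub> w = (\<lambda>i. v i + w i)" "v \<cdot>\<^bsub>free_rmod I\<^esub> r = (\<lambda>i. v i * r)"
  by (simp_all add: free_rmod_def)

lemma rhom_free_eq: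
  fixes N :: "('a::{ring,monoid_mult}, 'n) rmod"
  assumes N: "right_module N" and \<phi>: "\<phi> \<in> rhom (free_rmod I) N" and \<psi>: "\<psi> \<in> rhom (free_rmod I) N"
    and eq: "\<And>j. j \<in> I \<Longrightarrow> \<phi> (std j) = \<psi> (std j)" and v: "v \<in> carrier (free_rmod I)"
  shows "\<phi> v = \<psi> v"
  using v
proof (induction rule: free_rmod_induct)
  case zero
  show ?case
    using rhom_zero[OF right_module_free N \<phi>] rhom_zero[OF right_module_free N \<psi>] by (simp add: free_sel)
next
  case (add v w)
  then show ?case using rhom_add[OF \<phi>] rhom_add[OF \<psi>] by (simp add: free_sel)
next
  case (std j r)
  then show ?case
    using rhom_ract[OF \<phi> std_closed[OF std]] rhom_ract[OF \<psi> std_closed[OF std]] eq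
    by (simp add: free_sel)
qed

lemma rhom_free_submodule:
  fixes N :: "('a::{ring,monoid_mult}, 'n) rmod"
  assumes N: "right_module N" and \<phi>: "\<phi> \<in> rhom (free_rmod I) N" and X: "rsubmodule N X"
    and std: "\<And>j. j \<in> I \<Longrightarrow> \<phi> (std j) \<in> X" and v: "v \<in> carrier (free_rmod I)"
  shows "\<phi> v \<in> X"
  using v
proof (induction rule: free_rmod_induct)
  case zero
  show ?case using rhom_zero[OF right_module_free N \<phi>] X by (simp add: free_sel rsubmodule_def)
next
  case (add v w)
  then show ?case using rhom_add[OF \<phi>, of v w] X by (simp add: free_sel rsubmodule_def)
next
  case (std j r)
  then show ?case
    using rhom_ract[OF \<phi> std_closed[OF std], of r] X assms(4) by (simp add: free_sel rsubmodule_def)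
qed

lemma right_module_submodule:
  fixes M :: "('a::{ring,monoid_mult}, 'm) rmod"
  assumes "right_module M" "rsubmodule M X"
  shows "right_module (M\<lparr>carrier := X\<rparr>)"
proof -
  interpret M: right_module M by fact
  have X: "X \<subseteq> carrier M" "\<zero>\<^bsub>M\<^esub> \<in> X" "\<And>x y. x \<in> X \<Longrightarrow> y \<in> X \<Longrightarrow> x \<oplus>\<^bsub>M\<^esub> y \<in> X"
    "\<And>x r. x \<in> X \<Longrightarrow> x \<cdot>\<^bsub>M\<^esub> r \<in> X" using assms(2) by (auto simp: rsubmodule_def)
  have inX: "x \<in> carrier M" if "x \<in> X" for x using that X(1) by blast
  have "abelian_group (M\<lparr>carrier := X\<rparr>)"
  proof (rule abelian_groupI)
    fix x assume "x \<in> carrier (M\<lparr>carrier := X\<rparr>)"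
    then have x: "x \<in> X" by simp
    \<comment> \<open>Closure under negatives is not part of \<open>rsubmodule\<close>; the scalar
      \<open>- 1\<close> provides them.\<close>
    have "x \<cdot>\<^bsub>M\<^esub> (- 1) \<oplus>\<^bsub>M\<^esub> x = x \<cdot>\<^bsub>M\<^esub> (- 1 + 1)"
      using M.ract_add_right[of x "- 1" 1] inX[OF x] by simp
    also have "\<dots> = \<zero>\<^bsub>M\<^esub>" using inX[OF x] by simp
    finally show "\<exists>y\<in>carrier (M\<lparr>carrier := X\<rparr>). y \<oplus>\<^bsub>M\<lparr>carrier := X\<rparr>\<^esub> x = \<zero>\<^bsub>M\<lparr>carrier := X\<rparr>\<^esub>"
      using X(4)[OF x] by (intro bexI[of _ "x \<cdot>\<^bsub>M\<^esub> (- 1)"]) simp_all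
  qed (use X inX in \<open>auto simp: M.a_assoc intro: M.a_comm\<close>)
  then show ?thesis
    unfolding right_module_def right_module_axioms_def
    using X inX by (auto simp: M.ract_add_left M.ract_add_right M.ract_mult)
qed

lemma rsubmodule_image:
  fixes M :: "('a::{ring,monoid_mult}, 'm) rmod" and N :: "('a, 'n) rmod"
  assumes "right_module M" "right_module N" "f \<in> rhom M N"
  shows "rsubmodule N (f ` carrier M)"
  unfolding rsubmodule_def
proof (intro conjI ballI allI)
  interpret M: right_module M by fact
  show "f ` carrier M \<subseteq> carrier N" using assms(3) by (auto simp: rhom_def)
  show "\<zero>\<^bsub>N\<^esub> \<in> f ` carrier M" using rhom_zero[OF assms] by (metis M.zero_closed imageI)
  show "x \<oplus>\<^bsub>N\<^esub> y \<in> f ` carrier M" if "x \<in> f ` carrier M" "y \<in> f ` carrier M" for x y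
    using that rhom_add[OF assms(3)] M.a_closed by (smt (verit) imageE imageI)
  show "x \<cdot>\<^bsub>N\<^esub> r \<in> f ` carrier M" if "x \<in> f ` carrier M" for x r
    using that rhom_ract[OF assms(3)] M.ract_closed by (smt (verit) imageE imageI)
qed

lemma rmod_iso_refl: "rmod_iso M M"
  unfolding rmod_iso_def by (rule bexI[of _ "\<lambda>x. x"]) (auto simp: rhom_def bij_betw_def)

lemma rmod_iso_sym: "right_module M \<Longrightarrow> rmod_iso M N \<Longrightarrow> rmod_iso N M"
  unfolding rmod_iso_def using rhom_inv bij_betw_inv_into by blast

lemma rmod_iso_trans: "rmod_iso M N \<Longrightarrow> rmod_iso N L \<Longrightarrow> rmod_iso M L"
  unfolding rmod_iso_def
proof (elim bexE)
  fix f g assume *: "f \<in> rhom M N" "bij_betw f (carrier M) (carrier N)"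
    "g \<in> rhom N L" "bij_betw g (carrier N) (carrier L)"
  have "bij_betw (\<lambda>x. g (f x)) (carrier M) (carrier L)"
    using bij_betw_trans[OF *(2,4)] by (simp add: o_def)
  then show "\<exists>h\<in>rhom M L. bij_betw h (carrier M) (carrier L)"
    using rhom_comp[OF *(1,3)] by blast
qed

lemma rmod_isoE:
  fixes M :: "('a::{ring,monoid_mult}, 'm) rmod"
  assumes "right_module M" "rmod_iso M N"
  obtains f g where "f \<in> rhom M N" "g \<in> rhom N M" "\<And>x. x \<in> carrier M \<Longrightarrow> g (f x) = x"
    "\<And>y. y \<in> carrier N \<Longrightarrow> f (g y) = y"
proof -
  obtain f where f: "f \<in> rhom M N" "bij_betw f (carrier M) (carrier N)"
    using assms(2) unfolding rmod_iso_def by blast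
  then show ?thesis
    using that[OF f(1) rhom_inv[OF assms(1) f]]
    by (simp add: bij_betw_inv_into_left bij_betw_inv_into_right)
qed

lemma rmod_isoI:
  assumes "f \<in> rhom M N" "g \<in> rhom N M" "\<And>x. x \<in> carrier M \<Longrightarrow> g (f x) = x"
    "\<And>y. y \<in> carrier N \<Longrightarrow> f (g y) = y"
  shows "rmod_iso M N"
  unfolding rmod_iso_def
proof (rule bexI[OF _ assms(1)])
  show "bij_betw f (carrier M) (carrier N)"
    by (rule bij_betw_byWitness[where f' = g]) (use assms in \<open>auto simp: rhom_def\<close>)
qed


section \<open>Direct limits\<close>

locale direct_system =
  fixes M :: "nat \<Rightarrow> ('a::{ring,monoid_mult}, 'm) rmod" and f :: "nat \<Rightarrow> 'm \<Rightarrow> 'm"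
  assumes mod: "right_module (M i)" and hom: "f i \<in> rhom (M i) (M (Suc i))"
begin

abbreviation tr :: "nat \<Rightarrow> nat \<Rightarrow> 'm \<Rightarrow> 'm" where
  "tr i k \<equiv> fold f [i..<k]"

definition incl :: "nat \<Rightarrow> 'm \<Rightarrow> (nat \<times> 'm) set" where
  "incl i v = dlim_rel M f `` {(i, v)}"

lemma tr_tr: "i \<le> j \<Longrightarrow> j \<le> k \<Longrightarrow> tr j k (tr i j v) = tr i k v"
  using upt_add_eq_append[of i j "k - j"] by simp

lemma tr_rhom: "i \<le> k \<Longrightarrow> tr i k \<in> rhom (M i) (M k)"
proof (induction rule: dec_induct)
  case base
  show ?case by (simp add: rhom_def)
next
  case (step k)
  then have "tr i (Suc k) = (\<lambda>v. f k (tr i k v))" by auto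
  then show ?case using rhom_comp[OF step.IH hom] by simp
qed

lemma equiv_dlim: "equiv (SIGMA i:UNIV. carrier (M i)) (dlim_rel M f)"
proof (rule equivI)
  show "trans (dlim_rel M f)"
  proof (rule transI)
    fix p q r assume pq: "(p, q) \<in> dlim_rel M f" and qr: "(q, r) \<in> dlim_rel M f"
    obtain i v j w l u where p: "p = (i, v)" "q = (j, w)" "r = (l, u)" by (metis surj_pair)
    obtain k where k: "i \<le> k" "j \<le> k" "tr i k v = tr j k w" "v \<in> carrier (M i)"
      using pq unfolding dlim_rel_def p by auto
    obtain k' where k': "j \<le> k'" "l \<le> k'" "tr j k' w = tr l k' u" "u \<in> carrier (M l)"
      using qr unfolding dlim_rel_def p by auto
    let ?m = "max k k'"
    have "tr i ?m v = tr k ?m (tr j k w)"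
      using k tr_tr[of i k ?m v] by simp
    also have "\<dots> = tr k' ?m (tr j k' w)"
      using k k' tr_tr[of j k ?m w] tr_tr[of j k' ?m w] by simp
    also have "\<dots> = tr l ?m u" using k' tr_tr[of l k' ?m u] by simp
    finally show "(p, r) \<in> dlim_rel M f"
      unfolding dlim_rel_def p using k k' by (auto intro!: exI[of _ ?m])
  qed
  show "sym (dlim_rel M f)"
  proof (rule symI)
    fix p q assume "(p, q) \<in> dlim_rel M f"
    then show "(q, p) \<in> dlim_rel M f"
      unfolding dlim_rel_def by (cases p, cases q) (simp, metis)
  qed
qed (auto simp: dlim_rel_def refl_on_def)

lemma incl_eq_iff:
  assumes "v \<in> carrier (M i)" "w \<in> carrier (M j)"
  shows "incl i v = incl j w \<longleftrightarrow> (\<exists>k. i \<le> k \<and> j \<le> k \<and> tr i k v = tr j k w)"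
  unfolding incl_def using eq_equiv_class_iff[OF equiv_dlim, of "(i, v)" "(j, w)"] assms
  by (simp add: dlim_rel_def)

lemma incl_Suc: "v \<in> carrier (M i) \<Longrightarrow> incl (Suc i) (f i v) = incl i v"
  using rhom_closed[OF hom] by (subst incl_eq_iff) (auto intro!: exI[of _ "Suc i"])

lemma carrier_dlim: "carrier (dlim M f) = {incl i v | i v. v \<in> carrier (M i)}"
  by (auto simp: dlim_def quotient_def incl_def)

lemma mem_incl: "(k, w) \<in> incl i v \<Longrightarrow> w \<in> carrier (M k) \<and> incl k w = incl i v"
proof
  assume "(k, w) \<in> incl i v"
  then have *: "((i, v), (k, w)) \<in> dlim_rel M f" by (simp add: incl_def)
  then show "w \<in> carrier (M k)" by (simp add: dlim_rel_def)
  show "incl k w = incl i v" unfolding incl_def by (rule equiv_class_eq[OF equiv_dlim *, symmetric])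
qed

lemma incl_self: "v \<in> carrier (M i) \<Longrightarrow> (i, v) \<in> incl i v"
  unfolding incl_def by (auto simp: dlim_rel_def)

lemma add_closed: "v \<in> carrier (M i) \<Longrightarrow> w \<in> carrier (M i) \<Longrightarrow> v \<oplus>\<^bsub>M i\<^esub> w \<in> carrier (M i)"
  and ract_closed: "v \<in> carrier (M i) \<Longrightarrow> v \<cdot>\<^bsub>M i\<^esub> r \<in> carrier (M i)"
proof -
  interpret Mi: right_module "M i" by (rule mod)
  show "v \<in> carrier (M i) \<Longrightarrow> w \<in> carrier (M i) \<Longrightarrow> v \<oplus>\<^bsub>M i\<^esub> w \<in> carrier (M i)"
    "v \<in> carrier (M i) \<Longrightarrow> v \<cdot>\<^bsub>M i\<^esub> r \<in> carrier (M i)" by simp_all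
qed

text \<open>Independence of representatives: the two presentations of each summand agree from some
  stage on, and at the maximum of the two stages the sums agree as well.\<close>

lemma incl_add:
  assumes "v \<in> carrier (M i)" "w \<in> carrier (M i)"
  shows "incl i v \<oplus>\<^bsub>dlim M f\<^esub> incl i w = incl i (v \<oplus>\<^bsub>M i\<^esub> w)"
proof -
  let ?S = "{incl k (v' \<oplus>\<^bsub>M k\<^esub> w') | k v' w'. (k, v') \<in> incl i v \<and> (k, w') \<in> incl i w}"
  have "incl i v \<oplus>\<^bsub>dlim M f\<^esub> incl i w = \<Union>?S" by (simp add: dlim_def incl_def)
  also have "\<dots> = incl i (v \<oplus>\<^bsub>M i\<^esub> w)"
  proof (rule Union_eqI)
    have "incl i (v \<oplus>\<^bsub>M i\<^esub> w) \<in> ?S"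
      unfolding mem_Collect_eq
      by (rule exI[of _ i], rule exI[of _ v], rule exI[of _ w]) (simp add: incl_self assms)
    then show "?S \<noteq> {}" by blast
    fix X assume "X \<in> ?S"
    then obtain k v' w' where X: "X = incl k (v' \<oplus>\<^bsub>M k\<^esub> w')" "(k, v') \<in> incl i v" "(k, w') \<in> incl i w"
      by blast
    then have c: "v' \<in> carrier (M k)" "w' \<in> carrier (M k)" and e: "incl k v' = incl i v" "incl k w' = incl i w"
      using mem_incl by blast+
    obtain l l' where l: "k \<le> l" "i \<le> l" "tr k l v' = tr i l v"
      "k \<le> l'" "i \<le> l'" "tr k l' w' = tr i l' w"
      using e unfolding incl_eq_iff[OF c(1) assms(1)] incl_eq_iff[OF c(2) assms(2)] by blast
    let ?m = "max l l'"
    have "tr k ?m v' = tr i ?m v" "tr k ?m w' = tr i ?m w"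
      using l tr_tr[of k l ?m v'] tr_tr[of i l ?m v]
        tr_tr[of k l' ?m w'] tr_tr[of i l' ?m w] by simp_all
    moreover have "k \<le> ?m" "i \<le> ?m" using l by auto
    ultimately have "tr k ?m (v' \<oplus>\<^bsub>M k\<^esub> w') = tr i ?m (v \<oplus>\<^bsub>M i\<^esub> w)"
      using rhom_add[OF tr_rhom[OF \<open>k \<le> ?m\<close>] c] rhom_add[OF tr_rhom[OF \<open>i \<le> ?m\<close>] assms] by simp
    then show "X = incl i (v \<oplus>\<^bsub>M i\<^esub> w)"
      unfolding X(1) incl_eq_iff[OF add_closed[OF c] add_closed[OF assms]]
      using \<open>k \<le> ?m\<close> \<open>i \<le> ?m\<close> by blast
  qed
  finally show ?thesis .
qed

lemma incl_ract:
  assumes "v \<in> carrier (M i)"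
  shows "incl i v \<cdot>\<^bsub>dlim M f\<^esub> r = incl i (v \<cdot>\<^bsub>M i\<^esub> r)"
proof -
  let ?S = "{incl k (v' \<cdot>\<^bsub>M k\<^esub> r) | k v'. (k, v') \<in> incl i v}"
  have "incl i v \<cdot>\<^bsub>dlim M f\<^esub> r = \<Union>?S" by (simp add: dlim_def incl_def)
  also have "\<dots> = incl i (v \<cdot>\<^bsub>M i\<^esub> r)"
  proof (rule Union_eqI)
    have "incl i (v \<cdot>\<^bsub>M i\<^esub> r) \<in> ?S"
      unfolding mem_Collect_eq by (rule exI[of _ i], rule exI[of _ v]) (simp add: incl_self assms)
    then show "?S \<noteq> {}" by blast
    fix X assume "X \<in> ?S"
    then obtain k v' where X: "X = incl k (v' \<cdot>\<^bsub>M k\<^esub> r)" "(k, v') \<in> incl i v" by blast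
    then have c: "v' \<in> carrier (M k)" and e: "incl k v' = incl i v" using mem_incl by blast+
    obtain l where l: "k \<le> l" "i \<le> l" "tr k l v' = tr i l v"
      using e unfolding incl_eq_iff[OF c assms] by blast
    have "tr k l (v' \<cdot>\<^bsub>M k\<^esub> r) = tr i l (v \<cdot>\<^bsub>M i\<^esub> r)"
      using rhom_ract[OF tr_rhom[OF l(1)] c] rhom_ract[OF tr_rhom[OF l(2)] assms] l(3) by simp
    then show "X = incl i (v \<cdot>\<^bsub>M i\<^esub> r)"
      unfolding X(1) incl_eq_iff[OF ract_closed[OF c] ract_closed[OF assms]] using l by blast
  qed
  finally show ?thesis .
qed

lemma incl_rhom: "incl i \<in> rhom (M i) (dlim M f)"
  unfolding rhom_def using incl_add incl_ract by (auto simp: carrier_dlim)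

end

section \<open>Split sequences of matrices and their limits\<close>

text \<open>This is the condition \<open>CP_to_S\<close> imposes on a presenting sequence: each map
  is left invertible on the image of its predecessor.\<close>

definition split_system :: "(nat \<Rightarrow> nat) \<Rightarrow> (nat \<Rightarrow> 'a::ring minf) \<Rightarrow> bool" where
  "split_system n x \<longleftrightarrow> (\<forall>i. x i \<in> mats (n (Suc i)) (n i) \<and>
     (\<exists>y \<in> mats (n (Suc i)) (n (Suc (Suc i))). y * x (Suc i) * x i = x i))"

lemma split_system_T_seqs: "split_system n x \<Longrightarrow> x \<in> T_seqs"
  unfolding split_system_def T_seqs_def by (auto intro: le1I[OF sym])

lemma split_direct_system:
  fixes x :: "nat \<Rightarrow> 'a::{ring,monoid_mult} minf"
  assumes "\<forall>i. x i \<in> mats (n (Suc i)) (n i)"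
  shows "direct_system (\<lambda>i. free_rmod {..<n i}) (\<lambda>i. mat_vec (x i))"
  by (rule direct_system.intro) (rule right_module_free mat_vec_rhom assms[rule_format])+

lemma free_finite: "v \<in> carrier (free_rmod I) \<Longrightarrow> finite {i. v i \<noteq> 0}"
  by (simp add: free_rmod_def)

text \<open>Hence elements of stage \<open>i\<close> that become equal in the limit are already identified by \<open>x i\<close>.\<close>

lemma split_retract:
  fixes x :: "nat \<Rightarrow> 'a::{ring,monoid_mult} minf"
  assumes x: "split_system n x" and "i \<le> k"
  shows "\<exists>Y. \<forall>v\<in>carrier (free_rmod {..<n i}).
    mat_vec Y (mat_vec (x k) (fold (\<lambda>i. mat_vec (x i)) [i..<k] v)) = mat_vec (x i) v"
proof -
  have m: "\<forall>i. x i \<in> mats (n (Suc i)) (n i)" using x by (simp add: split_system_def)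
  interpret direct_system "\<lambda>i. free_rmod {..<n i} :: ('a, nat \<Rightarrow> 'a) rmod" "\<lambda>i. mat_vec (x i)"
    by (rule split_direct_system[OF m])
  show ?thesis
    using assms(2)
  proof (induction rule: dec_induct)
    case base
    show ?case
      by (rule exI[of _ "unit_mat (n (Suc i))"]) (simp add: mat_vec_unit[OF mat_vec_closed[OF m[rule_format]]])
  next
    case (step k)
    then obtain Y where Y: "\<And>v. v \<in> carrier (free_rmod {..<n i}) \<Longrightarrow>
      mat_vec Y (mat_vec (x k) (tr i k v)) = mat_vec (x i) v" by blast
    obtain y where y: "y * x (Suc k) * x k = x k" using x unfolding split_system_def by blast
    \<comment> \<open>The factor \<open>y\<close> undoes \<open>x (Suc k)\<close> on the image of
      \<open>x k\<close>, and \<open>Y\<close> undoes the remaining maps.\<close>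
    show ?case
    proof (rule exI[of _ "Y * y"], rule ballI)
      fix v assume v: "v \<in> carrier (free_rmod {..<n i} :: ('a, nat \<Rightarrow> 'a) rmod)"
      let ?w = "tr i k v"
      have w: "finite {i. ?w i \<noteq> 0}"
        by (rule free_finite[OF rhom_closed[OF tr_rhom[OF step(1)] v]])
      have "tr i (Suc k) v = mat_vec (x k) ?w" using step(1) by simp
      then have "mat_vec (Y * y) (mat_vec (x (Suc k)) (tr i (Suc k) v))
          = mat_vec Y (mat_vec (y * x (Suc k) * x k) ?w)"
        using w by (simp add: mat_vec_mult)
      then show "mat_vec (Y * y) (mat_vec (x (Suc k)) (tr i (Suc k) v)) = mat_vec (x i) v"
        by (simp add: y Y[OF v])
    qed
  qed
qed

text \<open>An internal description of \<open>P\<close> as a direct limit that avoids the quotient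
  \<open>dlim\<close>. The third clause is joint surjectivity; the last is the sharp form of
  injectivity that split systems allow, with identification already at the next stage.\<close>

definition is_cocone :: "('a::{ring,monoid_mult}, 'm) rmod \<Rightarrow> (nat \<Rightarrow> nat) \<Rightarrow> (nat \<Rightarrow> 'a minf) \<Rightarrow>
    (nat \<Rightarrow> (nat \<Rightarrow> 'a) \<Rightarrow> 'm) \<Rightarrow> bool" where
  "is_cocone P n x \<phi> \<longleftrightarrow> (\<forall>i. \<phi> i \<in> rhom (free_rmod {..<n i}) P) \<and>
     (\<forall>i. \<forall>v\<in>carrier (free_rmod {..<n i}). \<phi> (Suc i) (mat_vec (x i) v) = \<phi> i v) \<and>
     (\<forall>p\<in>carrier P. \<exists>i. \<exists>v\<in>carrier (free_rmod {..<n i}). p = \<phi> i v) \<and>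
     (\<forall>i. \<forall>v\<in>carrier (free_rmod {..<n i}). \<forall>w\<in>carrier (free_rmod {..<n i}).
        \<phi> i v = \<phi> i w \<longrightarrow> mat_vec (x i) v = mat_vec (x i) w)"

lemma limit_cocone:
  fixes P :: "('a::{ring,monoid_mult}, 'm) rmod"
  assumes P: "right_module P" and x: "split_system n x" and lim: "is_limit_of P n x"
  shows "\<exists>\<phi>. is_cocone P n x \<phi>"
proof -
  have m: "\<forall>i. x i \<in> mats (n (Suc i)) (n i)" using x by (simp add: split_system_def)
  interpret direct_system "\<lambda>i. free_rmod {..<n i} :: ('a, nat \<Rightarrow> 'a) rmod" "\<lambda>i. mat_vec (x i)"
    by (rule split_direct_system[OF m])
  let ?M = "\<lambda>i. free_rmod {..<n i} :: ('a, nat \<Rightarrow> 'a) rmod"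
  let ?D = "dlim ?M (\<lambda>i. mat_vec (x i))"
  obtain f g where fg: "f \<in> rhom P ?D" "g \<in> rhom ?D P" "\<And>p. p \<in> carrier P \<Longrightarrow> g (f p) = p"
    "\<And>d. d \<in> carrier ?D \<Longrightarrow> f (g d) = d"
    by (rule rmod_isoE[OF P lim[unfolded is_limit_of_def]]) blast
  let ?\<phi> = "\<lambda>i v. g (incl i v)"
  have "is_cocone P n x ?\<phi>"
    unfolding is_cocone_def
  proof (intro conjI allI ballI impI)
    show "?\<phi> i \<in> rhom (?M i) P" for i by (rule rhom_comp[OF incl_rhom fg(2)])
    show "?\<phi> (Suc i) (mat_vec (x i) v) = ?\<phi> i v" if "v \<in> carrier (?M i)" for i v
      by (simp only: incl_Suc[OF that])
    show "\<exists>i. \<exists>v\<in>carrier (?M i). p = ?\<phi> i v" if p: "p \<in> carrier P" for p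
    proof -
      have "f p \<in> carrier ?D" by (rule rhom_closed[OF fg(1) p])
      then obtain i v where "f p = incl i v" "v \<in> carrier (?M i)" unfolding carrier_dlim by blast
      then show ?thesis using fg(3)[OF p] by metis
    qed
    fix i v w assume v: "v \<in> carrier (?M i)" and w: "w \<in> carrier (?M i)" and eq: "?\<phi> i v = ?\<phi> i w"
    have "incl i v = f (?\<phi> i v)" by (rule fg(4)[OF rhom_closed[OF incl_rhom v], symmetric])
    also have "\<dots> = f (?\<phi> i w)" by (simp only: eq)
    also have "\<dots> = incl i w" by (rule fg(4)[OF rhom_closed[OF incl_rhom w]])
    finally have "incl i v = incl i w" .
    then obtain k where k: "i \<le> k" "tr i k v = tr i k w" unfolding incl_eq_iff[OF v w] by blast
    obtain Y where Y: "\<And>v. v \<in> carrier (?M i) \<Longrightarrow> mat_vec Y (mat_vec (x k) (tr i k v)) = mat_vec (x i) v"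
      using split_retract[OF x k(1)] by blast
    show "mat_vec (x i) v = mat_vec (x i) w" unfolding Y[OF v, symmetric] Y[OF w, symmetric] k(2) ..
  qed
  then show ?thesis by blast
qed

lemma cocone_tr:
  fixes P :: "('a::{ring,monoid_mult}, 'm) rmod"
  assumes \<phi>: "is_cocone P n x \<phi>" and m: "\<forall>i. x i \<in> mats (n (Suc i)) (n i)"
    and v: "v \<in> carrier (free_rmod {..<n i})" and "i \<le> k"
  shows "fold (\<lambda>i. mat_vec (x i)) [i..<k] v \<in> carrier (free_rmod {..<n k})"
    "\<phi> k (fold (\<lambda>i. mat_vec (x i)) [i..<k] v) = \<phi> i v"
proof -
  interpret direct_system "\<lambda>i. free_rmod {..<n i} :: ('a, nat \<Rightarrow> 'a) rmod" "\<lambda>i. mat_vec (x i)"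
    by (rule split_direct_system[OF m])
  have *: "tr i k v \<in> carrier (free_rmod {..<n k})" if "i \<le> k" for k
    by (rule rhom_closed[OF tr_rhom[OF that] v])
  show "tr i k v \<in> carrier (free_rmod {..<n k})" by (rule *[OF assms(4)])
  show "\<phi> k (tr i k v) = \<phi> i v"
    using \<open>i \<le> k\<close>
  proof (induction rule: dec_induct)
    case (step k)
    have "\<phi> (Suc k) (mat_vec (x k) (tr i k v)) = \<phi> k (tr i k v)"
      using \<phi> *[OF step(1)] unfolding is_cocone_def by blast
    then show ?case using step by simp
  qed simp
qed

text \<open>Preimages of the finitely many basis vectors are moved to one stage and become the
  columns of \<open>t\<close>. The bound \<open>k0\<close> lets that stage be as late as a later
  argument requires.\<close>

lemma cocone_factor:
  fixes Q :: "('a::{ring,monoid_mult}, 'm) rmod"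
  assumes \<phi>: "is_cocone Q n x \<phi>" and m: "\<forall>i. x i \<in> mats (n (Suc i)) (n i)"
    and Q: "right_module Q" and \<psi>: "\<psi> \<in> rhom (free_rmod {..<N}) Q"
  shows "\<exists>k\<ge>k0. \<exists>t\<in>mats (n k) N. \<forall>v\<in>carrier (free_rmod {..<N}). \<psi> v = \<phi> k (mat_vec t v)"
proof -
  have "\<exists>l. \<forall>k\<ge>l. \<exists>c\<in>carrier (free_rmod {..<n k}). q = \<phi> k c" if q: "q \<in> carrier Q" for q
  proof -
    obtain l c where "c \<in> carrier (free_rmod {..<n l})" "q = \<phi> l c"
      using \<phi> q unfolding is_cocone_def by blast
    then show ?thesis using cocone_tr[OF \<phi> m, of c l] by metis
  qed
  then have "\<exists>l. \<forall>k\<ge>l. \<exists>c\<in>carrier (free_rmod {..<n k}). \<psi> (std j) = \<phi> k c" if "j < N" for j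
    using rhom_closed[OF \<psi> std_closed[of j]] that by simp
  then obtain l where l: "\<And>j k. j < N \<Longrightarrow> l j \<le> k \<Longrightarrow> \<exists>c\<in>carrier (free_rmod {..<n k}). \<psi> (std j) = \<phi> k c"
    by metis
  \<comment> \<open>A stage beyond \<open>k0\<close> at which all basis vectors have preimages;
    inserting \<open>k0\<close> also keeps the set nonempty when \<open>N = 0\<close>.\<close>
  define k where "k = Max (insert k0 (l ` {..<N}))"
  have k: "k0 \<le> k" "l j \<le> k" if "j < N" for j unfolding k_def using that by simp_all
  have "k0 \<le> k" unfolding k_def by simp
  obtain c where c: "\<And>j. j < N \<Longrightarrow> c j \<in> carrier (free_rmod {..<n k}) \<and> \<psi> (std j) = \<phi> k (c j)"
    using l[OF _ k(2)] by metis
  let ?t = "of_cols N c"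
  have t: "?t \<in> mats (n k) N"
    using c unfolding mats_def by (auto simp: of_cols.rep_eq free_rmod_def split: if_splits)
  have \<phi>k: "\<phi> k \<in> rhom (free_rmod {..<n k}) Q" using \<phi> by (simp add: is_cocone_def)
  have "\<psi> v = \<phi> k (mat_vec ?t v)" if "v \<in> carrier (free_rmod {..<N})" for v
  proof (rule rhom_free_eq[OF Q \<psi> rhom_comp[OF mat_vec_rhom[OF t] \<phi>k] _ that])
    fix j assume "j \<in> {..<N}"
    then have j: "j < N" by simp
    then have "mat_vec ?t (std j) = c j" using c[OF j] by (intro of_cols_std free_finite) blast
    then show "\<psi> (std j) = \<phi> k (mat_vec ?t (std j))" using c[OF j] by simp
  qed
  then show ?thesis using t \<open>k0 \<le> k\<close> by blast
qed

text \<open>The comparison is tested on the image of stage \<open>i\<close>. The maps to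
  \<open>Q\<close> and back factor through finite stages by \<open>t\<close> and \<open>r\<close>.
  Their composite agrees with the transition map inside \<open>P\<close>; applying
  \<open>x k\<close> makes this an equality of columns, and the retraction \<open>Y\<close> brings
  it down to \<open>x i\<close>.\<close>

lemma cp_le_imp_seq_le:
  fixes P :: "('a::{ring,monoid_mult}, 'p) rmod" and Q :: "('a, 'q) rmod"
  assumes P: "right_module P" "split_system n x" "is_limit_of P n x"
    and Q: "right_module Q" "split_system n' x'" "is_limit_of Q n' x'"
    and le: "P \<lesssim>\<^sub>C\<^sub>P Q"
  shows "seq_le x x'"
  unfolding seq_le_def
proof
  fix i
  have m: "\<forall>i. x i \<in> mats (n (Suc i)) (n i)" using P(2) by (simp add: split_system_def)
  have m': "\<forall>i. x' i \<in> mats (n' (Suc i)) (n' i)" using Q(2) by (simp add: split_system_def)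
  obtain \<phi> where \<phi>: "is_cocone P n x \<phi>" using limit_cocone[OF P] by blast
  obtain \<phi>' where \<phi>': "is_cocone Q n' x' \<phi>'" using limit_cocone[OF Q] by blast
  let ?F = "free_rmod {..<n i} :: ('a, nat \<Rightarrow> 'a) rmod"
  have \<phi>i: "\<phi> i \<in> rhom ?F P" using \<phi> by (simp add: is_cocone_def)
  let ?X = "rspan P (\<phi> i ` std ` {..<n i})"
  have gen: "\<phi> i ` std ` {..<n i} \<subseteq> carrier P"
    by (auto intro!: rhom_closed[OF \<phi>i] std_closed)
  have "finite (\<phi> i ` std ` {..<n i})" by simp
  then have "fg_submodule P ?X" unfolding fg_submodule_def using gen by blast
  from le[unfolded cp_le_def, rule_format, OF this] obtain \<alpha> \<beta> where \<alpha>: "\<alpha> \<in> rhom (P\<lparr>carrier := ?X\<rparr>) Q" and \<beta>: "\<beta> \<in> rhom Q P"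
    and \<beta>\<alpha>: "\<And>p. p \<in> ?X \<Longrightarrow> \<beta> (\<alpha> p) = p" by blast
  note X = rsubmodule_rspan[OF P(1) gen]
  have \<phi>X: "\<phi> i v \<in> ?X" if "v \<in> carrier ?F" for v
    by (rule rhom_free_submodule[OF P(1) \<phi>i X(1) _ that]) (use X(2) in blast)
  have "\<phi> i \<in> rhom ?F (P\<lparr>carrier := ?X\<rparr>)" using \<phi>i \<phi>X by (auto simp: rhom_def)
  from cocone_factor[OF \<phi>' m' Q(1) rhom_comp[OF this \<alpha>], of 0]
  obtain l t where t: "t \<in> mats (n' l) (n i)" "\<And>v. v \<in> carrier ?F \<Longrightarrow> \<alpha> (\<phi> i v) = \<phi>' l (mat_vec t v)"
    by blast
  \<comment> \<open>The return map is factored on stage \<open>Suc l\<close> and not on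
    \<open>l\<close>, so that \<open>x' l\<close> appears between \<open>r\<close> and
    \<open>t\<close>.\<close>
  have "\<phi>' (Suc l) \<in> rhom (free_rmod {..<n' (Suc l)}) Q" using \<phi>' by (simp add: is_cocone_def)
  from cocone_factor[OF \<phi> m P(1) rhom_comp[OF this \<beta>], of "Suc i"]
  obtain k r where k: "Suc i \<le> k" and r: "r \<in> mats (n k) (n' (Suc l))"
    "\<And>v. v \<in> carrier (free_rmod {..<n' (Suc l)}) \<Longrightarrow> \<beta> (\<phi>' (Suc l) v) = \<phi> k (mat_vec r v)"
    by blast
  obtain Y where Y: "\<And>v. v \<in> carrier ?F \<Longrightarrow>
      mat_vec Y (mat_vec (x k) (fold (\<lambda>i. mat_vec (x i)) [i..<k] v)) = mat_vec (x i) v"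
    using split_retract[OF P(2), of i k] k by auto
  obtain s where s: "Y \<in> mats s s" using ex_mats by blast
  have "x i = (Y * x k * r) * x' l * t"
  proof (rule mats_eqI)
    show "x i \<in> mats (n (Suc i)) (n i)" by (rule m[rule_format])
    show "(Y * x k * r) * x' l * t \<in> mats s (n i)"
      using mats_sandwich[OF s t(1), of "x k * r * x' l"] by (simp add: mult.assoc)
    fix j assume "j < n i"
    then have v: "std j \<in> carrier ?F" by (intro std_closed) simp
    let ?v = "std j :: nat \<Rightarrow> 'a"
    let ?w = "mat_vec r (mat_vec (x' l) (mat_vec t ?v))"
    have tv: "mat_vec t ?v \<in> carrier (free_rmod {..<n' l})" by (rule mat_vec_closed[OF t(1)])
    have xtv: "mat_vec (x' l) (mat_vec t ?v) \<in> carrier (free_rmod {..<n' (Suc l)})"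
      by (rule mat_vec_closed[OF m'[rule_format]])
    have w: "?w \<in> carrier (free_rmod {..<n k})" by (rule mat_vec_closed[OF r(1)])
    have "\<phi> i ?v = \<beta> (\<phi>' l (mat_vec t ?v))" using \<beta>\<alpha>[OF \<phi>X[OF v]] t(2)[OF v] by simp
    also have "\<dots> = \<beta> (\<phi>' (Suc l) (mat_vec (x' l) (mat_vec t ?v)))"
      using \<phi>' tv unfolding is_cocone_def by metis
    also have "\<dots> = \<phi> k ?w" by (rule r(2)[OF xtv])
    finally have "\<phi> k (fold (\<lambda>i. mat_vec (x i)) [i..<k] ?v) = \<phi> k ?w"
      using cocone_tr(2)[OF \<phi> m v, of k] k by simp
    moreover have "fold (\<lambda>i. mat_vec (x i)) [i..<k] ?v \<in> carrier (free_rmod {..<n k})"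
      using cocone_tr(1)[OF \<phi> m v, of k] k by simp
    ultimately have "mat_vec (x k) (fold (\<lambda>i. mat_vec (x i)) [i..<k] ?v) = mat_vec (x k) ?w"
      using \<phi> w unfolding is_cocone_def by blast
    then have "mat_vec (x i) ?v = mat_vec Y (mat_vec (x k) ?w)" using Y[OF v] by simp
    then show "mat_vec (x i) ?v = mat_vec ((Y * x k * r) * x' l * t) ?v"
      using free_finite[OF v] by (simp add: mat_vec_mult)
  qed
  then show "\<exists>l. x i \<lesssim>\<^sub>1 x' l" using le1I by blast
qed


section \<open>Modules of increasing sequences of idempotents\<close>

text \<open>For an idempotent, being fixed is the same as lying in the image; membership in the
  union of the images thus becomes an equation.\<close>

definition chain_mod :: "(nat \<Rightarrow> 'a::{ring,monoid_mult} minf) \<Rightarrow> ('a, nat \<Rightarrow> 'a) rmod" where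
  "chain_mod e = columns\<lparr>carrier := {v. finite {i. v i \<noteq> 0} \<and> (\<exists>n. mat_vec (e n) v = v)}\<rparr>"

lemma chain_mod_sel:
  "\<zero>\<^bsub>chain_mod e\<^esub> = (\<lambda>_. 0)" "v \<oplus>\<^bsub>chain_mod e\<^esub> w = (\<lambda>i. v i + w i)" "v \<cdot>\<^bsub>chain_mod e\<^esub> r = (\<lambda>i. v i * r)"
  "v \<in> carrier (chain_mod e) \<longleftrightarrow> finite {i. v i \<noteq> 0} \<and> (\<exists>n. mat_vec (e n) v = v)"
  by (simp_all add: chain_mod_def free_rmod_def)

lemma idem_chain_fix:
  fixes e :: "nat \<Rightarrow> 'a::{ring,monoid_mult} minf"
  assumes "idem_chain e" "finite {i. v i \<noteq> 0}" "mat_vec (e n) v = v" "n \<le> m"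
  shows "mat_vec (e m) v = v"
proof -
  have "e m * e n = e n" using assms(1,4) by (simp add: idem_chain_mult min_absorb2)
  then have "mat_vec (e m) (mat_vec (e n) v) = mat_vec (e n) v"
    by (simp add: assms(2) flip: mat_vec_mult)
  then show ?thesis using assms(3) by simp
qed

lemma finite_add: "finite {i. v i \<noteq> 0} \<Longrightarrow> finite {i. w i \<noteq> 0} \<Longrightarrow> finite {i. v i + w i \<noteq> (0::'a::monoid_add)}"
  by (rule finite_subset[of _ "{i. v i \<noteq> 0} \<union> {i. w i \<noteq> 0}"]) auto

lemma finite_scale: "finite {i. v i \<noteq> 0} \<Longrightarrow> finite {i. v i * r \<noteq> (0::'a::mult_zero)}"
  by (rule finite_subset[of _ "{i. v i \<noteq> 0}"]) auto

lemma right_module_chain: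
  fixes e :: "nat \<Rightarrow> 'a::{ring,monoid_mult} minf"
  assumes e: "idem_chain e"
  shows "rsubmodule columns (carrier (chain_mod e))" "right_module (chain_mod e)"
proof -
  show sub: "rsubmodule columns (carrier (chain_mod e))"
    unfolding rsubmodule_def free_sel
  proof (intro conjI ballI allI)
    show "carrier (chain_mod e) \<subseteq> carrier columns" by (auto simp: chain_mod_sel free_rmod_def)
    show "(\<lambda>_. 0) \<in> carrier (chain_mod e)" by (simp add: chain_mod_sel)
    fix v w assume vw: "v \<in> carrier (chain_mod e)" "w \<in> carrier (chain_mod e)"
    then obtain m n where "mat_vec (e m) v = v" "mat_vec (e n) w = w" by (auto simp: chain_mod_sel)
    then have "mat_vec (e (max m n)) v = v" "mat_vec (e (max m n)) w = w"
      using idem_chain_fix[OF e, of v m "max m n"] idem_chain_fix[OF e, of w n "max m n"] vw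
      by (simp_all add: chain_mod_sel)
    then have "mat_vec (e (max m n)) (\<lambda>i. v i + w i) = (\<lambda>i. v i + w i)"
      using vw by (simp add: mat_vec_add chain_mod_sel)
    then show "(\<lambda>i. v i + w i) \<in> carrier (chain_mod e)"
      using vw by (auto simp: chain_mod_sel finite_add)
  next
    fix v r assume v: "v \<in> carrier (chain_mod e)"
    then obtain m where "mat_vec (e m) v = v" by (auto simp: chain_mod_sel)
    then have "mat_vec (e m) (\<lambda>i. v i * r) = (\<lambda>i. v i * r)"
      using v by (simp add: mat_vec_scale chain_mod_sel)
    then show "(\<lambda>i. v i * r) \<in> carrier (chain_mod e)"
      using v by (auto simp: chain_mod_sel finite_scale)
  qed
  have "chain_mod e = columns\<lparr>carrier := carrier (chain_mod e)\<rparr>" by (simp add: chain_mod_def)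
  then show "right_module (chain_mod e)"
    using right_module_submodule[OF right_module_free sub] by simp
qed

lemma idem_chain_range:
  fixes e :: "nat \<Rightarrow> 'a::{ring,monoid_mult} minf"
  assumes "idem_chain e" "finite {i. v i \<noteq> 0}"
  shows "mat_vec (e n) v \<in> carrier (chain_mod e)"
proof -
  have "mat_vec (e n) (mat_vec (e n) v) = mat_vec (e n) v"
    using assms by (simp add: idem_chain_mult flip: mat_vec_mult)
  then show ?thesis by (auto simp: chain_mod_sel)
qed

text \<open>The transition maps are the \<open>e i\<close> themselves and not inclusions: a column
  \<open>v\<close> at stage \<open>i\<close> stands for \<open>e i\<close> applied to
  \<open>v\<close>, so the limit of the free stages is the union of the images.\<close>

lemma chain_mod_limit:
  fixes e :: "nat \<Rightarrow> 'a::{ring,monoid_mult} minf"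
  assumes e: "idem_chain e"
  shows "\<exists>n. split_system n e \<and> is_limit_of (chain_mod e) n e"
proof -
  have "\<exists>n. \<forall>i. (e i \<in> mats (n i) (n i)) \<and> n i \<le> n (Suc i)"
    by (rule dependent_nat_choice) (use ex_mats in blast)+
  then obtain n where n: "\<And>i. e i \<in> mats (n i) (n i)" "\<And>i. n i \<le> n (Suc i)" by blast
  have m: "\<forall>i. e i \<in> mats (n (Suc i)) (n i)" by (intro allI mats_mono[OF n(1) n(2)]) simp
  have "split_system n e"
    unfolding split_system_def
  proof (intro allI conjI)
    fix i
    have "e (Suc i) \<in> mats (n (Suc i)) (n (Suc (Suc i)))" by (rule mats_mono[OF n(1) _ n(2)]) simp
    moreover have "e (Suc i) * e (Suc i) * e i = e i" by (simp add: idem_chain_mult[OF e] mult.assoc)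
    ultimately show "\<exists>y\<in>mats (n (Suc i)) (n (Suc (Suc i))). y * e (Suc i) * e i = e i" by blast
  qed (rule m[rule_format])
  moreover
  interpret direct_system "\<lambda>i. free_rmod {..<n i} :: ('a, nat \<Rightarrow> 'a) rmod" "\<lambda>i. mat_vec (e i)"
    by (rule split_direct_system[OF m])
  let ?M = "\<lambda>i. free_rmod {..<n i} :: ('a, nat \<Rightarrow> 'a) rmod"
  let ?D = "dlim ?M (\<lambda>i. mat_vec (e i))"
  have tr_fix: "tr i k v = v" if v: "finite {i. v i \<noteq> 0}" "mat_vec (e i) v = v" and "i \<le> k" for v i k
    using \<open>i \<le> k\<close>
  proof (induction rule: dec_induct)
    case (step k)
    then show ?case using idem_chain_fix[OF e v, of k] by simp
  qed simp
  have inM: "v \<in> carrier (?M i)" if "mat_vec (e i) v = v" for v i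
    using mat_vec_closed[OF n(1), of i v] that by simp
  \<comment> \<open>A vector is sent to its class at a stage that fixes it. Later transition maps
    leave it in place, so the choice of stage does not affect the class.\<close>
  define G where "G v = incl (SOME i. mat_vec (e i) v = v) v" for v
  have G: "G v = incl i v" if v: "finite {i. v i \<noteq> 0}" "mat_vec (e i) v = v" for v i
  proof -
    let ?k = "SOME i. mat_vec (e i) v = v"
    have k: "mat_vec (e ?k) v = v" by (rule someI[of "\<lambda>i. mat_vec (e i) v = v", OF v(2)])
    have "tr ?k (max i ?k) v = tr i (max i ?k) v"
      using tr_fix[OF v(1) k, of "max i ?k"] tr_fix[OF v, of "max i ?k"] by simp
    then show ?thesis
      unfolding G_def incl_eq_iff[OF inM[OF k] inM[OF v(2)]] by (intro exI[of _ "max i ?k"]) simp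
  qed
  have common: "\<exists>k. mat_vec (e k) v = v \<and> mat_vec (e k) w = w"
    if vw: "v \<in> carrier (chain_mod e)" "w \<in> carrier (chain_mod e)" for v w
  proof -
    obtain i j where "mat_vec (e i) v = v" "mat_vec (e j) w = w" using vw by (auto simp: chain_mod_sel)
    then show ?thesis
      using idem_chain_fix[OF e, of v i "max i j"] idem_chain_fix[OF e, of w j "max i j"] that
      by (intro exI[of _ "max i j"]) (simp add: chain_mod_sel)
  qed
  have fin: "finite {i. v i \<noteq> 0}" if "v \<in> carrier (chain_mod e)" for v
    using that by (simp add: chain_mod_sel)
  have "G \<in> rhom (chain_mod e) ?D"
    unfolding rhom_def mem_Collect_eq
  proof (intro conjI ballI allI)
    show "G \<in> carrier (chain_mod e) \<rightarrow> carrier ?D"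
    proof
      fix v assume v: "v \<in> carrier (chain_mod e)"
      then obtain k where k: "mat_vec (e k) v = v" by (auto simp: chain_mod_sel)
      show "G v \<in> carrier ?D" unfolding G[OF fin[OF v] k] by (rule rhom_closed[OF incl_rhom inM[OF k]])
    qed
    fix v w assume v: "v \<in> carrier (chain_mod e)" and w: "w \<in> carrier (chain_mod e)"
    then obtain k where k: "mat_vec (e k) v = v" "mat_vec (e k) w = w" using common by blast
    have "mat_vec (e k) (\<lambda>i. v i + w i) = (\<lambda>i. v i + w i)"
      using k fin[OF v] fin[OF w] by (simp add: mat_vec_add)
    then show "G (v \<oplus>\<^bsub>chain_mod e\<^esub> w) = G v \<oplus>\<^bsub>?D\<^esub> G w"
      using G[OF fin[OF v] k(1)] G[OF fin[OF w] k(2)] G[OF finite_add[OF fin[OF v] fin[OF w]]]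
        incl_add[OF inM[OF k(1)] inM[OF k(2)]] by (simp add: chain_mod_sel free_sel)
  next
    fix v r assume v: "v \<in> carrier (chain_mod e)"
    then obtain k where k: "mat_vec (e k) v = v" using common by blast
    have "mat_vec (e k) (\<lambda>i. v i * r) = (\<lambda>i. v i * r)" using k fin[OF v] by (simp add: mat_vec_scale)
    then show "G (v \<cdot>\<^bsub>chain_mod e\<^esub> r) = G v \<cdot>\<^bsub>?D\<^esub> r"
      using G[OF fin[OF v] k] G[OF finite_scale[OF fin[OF v]]] incl_ract[OF inM[OF k]]
      by (simp add: chain_mod_sel free_sel)
  qed
  moreover have "bij_betw G (carrier (chain_mod e)) (carrier ?D)"
    unfolding bij_betw_def
  proof
    show "inj_on G (carrier (chain_mod e))"
    proof (rule inj_onI)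
      fix v w assume v: "v \<in> carrier (chain_mod e)" and w: "w \<in> carrier (chain_mod e)" and eq: "G v = G w"
      obtain k where k: "mat_vec (e k) v = v" "mat_vec (e k) w = w" using common[OF v w] by blast
      have "incl k v = incl k w" using eq G[OF fin[OF v] k(1)] G[OF fin[OF w] k(2)] by simp
      then obtain l where "k \<le> l" "tr k l v = tr k l w"
        unfolding incl_eq_iff[OF inM[OF k(1)] inM[OF k(2)]] by blast
      then show "v = w" using tr_fix[OF fin[OF v] k(1)] tr_fix[OF fin[OF w] k(2)] by simp
    qed
    show "G ` carrier (chain_mod e) = carrier ?D"
    proof (intro equalityI subsetI)
      fix d assume "d \<in> carrier ?D"
      then obtain i v where d: "d = incl i v" "v \<in> carrier (?M i)" unfolding carrier_dlim by blast
      let ?w = "mat_vec (e i) v"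
      \<comment> \<open>The class of \<open>v\<close> at stage \<open>i\<close> is that of
        \<open>?w\<close> at stage \<open>Suc i\<close>, where \<open>?w\<close> is a fixed
        vector.\<close>
      have "mat_vec (e (Suc i)) ?w = ?w"
        using free_finite[OF d(2)] by (simp add: idem_chain_mult[OF e] flip: mat_vec_mult)
      then have "G ?w = incl (Suc i) ?w" by (intro G) simp_all
      then have "d = G ?w" using incl_Suc[OF d(2)] d(1) by simp
      then show "d \<in> G ` carrier (chain_mod e)" using idem_chain_range[OF e free_finite[OF d(2)]] by blast
    qed (use \<open>G \<in> rhom (chain_mod e) ?D\<close> in \<open>auto simp: rhom_def\<close>)
  qed
  ultimately show ?thesis unfolding is_limit_of_def rmod_iso_def by blast
qed

section \<open>Back and forth between sequences of idempotents\<close>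

definition idem_le :: "'b::ring \<Rightarrow> 'b \<Rightarrow> bool" where
  "idem_le p q \<longleftrightarrow> p * q = p \<and> q * p = p"

text \<open>Murray-von Neumann equivalence with normalized witnesses: \<open>u\<close> maps the
  image of \<open>p\<close> isomorphically onto that of \<open>q\<close>, with inverse
  \<open>v\<close>. Thanks to the normalization, extension of \<open>u\<close> by \<open>u'\<close>
  can be expressed as \<open>u' * p = u\<close>.\<close>

definition idem_iso :: "'b::ring \<Rightarrow> 'b \<Rightarrow> 'b \<Rightarrow> 'b \<Rightarrow> bool" where
  "idem_iso p q u v \<longleftrightarrow> v * u = p \<and> u * v = q \<and> u * p = u \<and> v * q = v"

lemma idem_le_trans: "idem_le p q \<Longrightarrow> idem_le q r \<Longrightarrow> idem_le p r"
  unfolding idem_le_def by (metis absorb_right absorb_left)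

lemma idem_le_zero: "idem_le 0 q"
  by (simp add: idem_le_def)

lemma idem_chain_le: "idem_chain e \<Longrightarrow> i \<le> j \<Longrightarrow> idem_le (e i) (e j)"
  by (simp add: idem_chain_def idem_le_def)

lemma idem_iso_sym: "idem_iso p q u v \<Longrightarrow> idem_iso q p v u"
  by (simp add: idem_iso_def)

lemma idem_iso_left: "idem_iso p q u v \<Longrightarrow> q * u = u \<and> p * v = v"
  unfolding idem_iso_def by (metis mult.assoc)

lemma idem_iso_idem:
  assumes "idem_iso p q u v"
  shows "p * p = p" "q * q = q"
proof -
  have "p * (v * u) = (p * v) * u" "q * (u * v) = (q * u) * v" by (simp_all only: mult.assoc)
  then show "p * p = p" "q * q = q" using assms idem_iso_left[OF assms] by (simp_all add: idem_iso_def)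
qed

lemma idem_chain_rhom:
  fixes e :: "nat \<Rightarrow> 'a::{ring,monoid_mult} minf"
  assumes "idem_chain e"
  shows "mat_vec (e k) \<in> rhom (free_rmod I) (chain_mod e)"
  unfolding rhom_def chain_mod_sel(2,3) free_sel
  using idem_chain_range[OF assms free_finite] mat_vec_add[OF free_finite free_finite]
    mat_vec_scale[OF free_finite] by blast

lemma chain_mod_subset:
  fixes f q :: "nat \<Rightarrow> 'a::{ring,monoid_mult} minf"
  assumes "\<And>k. \<exists>n. f n * q k = q k"
  shows "carrier (chain_mod q) \<subseteq> carrier (chain_mod f)"
proof
  fix v assume "v \<in> carrier (chain_mod q)"
  then obtain k where v: "finite {i. v i \<noteq> 0}" "mat_vec (q k) v = v" by (auto simp: chain_mod_sel)
  obtain n where "f n * q k = q k" using assms by blast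
  then have "mat_vec (f n) (mat_vec (q k) v) = mat_vec (q k) v" using v(1) by (simp flip: mat_vec_mult)
  then have "mat_vec (f n) v = v" by (simp only: v(2))
  then show "v \<in> carrier (chain_mod f)" using v(1) by (auto simp: chain_mod_sel)
qed

text \<open>Each \<open>u (Suc k)\<close> extends \<open>u k\<close> from the image of
  \<open>p k\<close>, so the maps glue on the union; the value at a vector is given by any stage
  that fixes it.\<close>

lemma chain_mod_hom:
  fixes p q u :: "nat \<Rightarrow> 'a::{ring,monoid_mult} minf"
  assumes p: "idem_chain p" and qu: "\<And>k. q k * u k = u k" and up: "\<And>k. u (Suc k) * p k = u k"
  shows "\<exists>h\<in>rhom (chain_mod p) (chain_mod q). \<forall>k v. finite {i. v i \<noteq> 0} \<longrightarrow> mat_vec (p k) v = v \<longrightarrow>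
    h v = mat_vec (u k) v"
proof -
  have u_fix: "mat_vec (u l) v = mat_vec (u (Suc k)) v"
    if "Suc k \<le> l" and v: "finite {i. v i \<noteq> 0}" "mat_vec (p k) v = v" for k l v
    using that(1)
  proof (induction rule: dec_induct)
    case (step l)
    have "k \<le> l" using step(1) by simp
    have "mat_vec (u (Suc l)) (mat_vec (p l) v) = mat_vec (u l) v"
      using v(1) up by (simp flip: mat_vec_mult)
    then show ?case using step.IH idem_chain_fix[OF p v \<open>k \<le> l\<close>] by simp
  qed simp
  have u_Suc: "mat_vec (u (Suc k)) v = mat_vec (u k) v"
    if "finite {i. v i \<noteq> 0}" "mat_vec (p k) v = v" for k v
  proof -
    have "mat_vec (u (Suc k)) (mat_vec (p k) v) = mat_vec (u k) v"
      using that(1) up by (simp flip: mat_vec_mult)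
    then show ?thesis by (simp only: that(2))
  qed
  have u_le: "mat_vec (u l) v = mat_vec (u k) v"
    if "k \<le> l" "finite {i. v i \<noteq> 0}" "mat_vec (p k) v = v" for k l v
    using that u_fix[OF _ that(2,3), of l] u_Suc[OF that(2,3)] by (cases "k = l") auto
  define h where "h v = mat_vec (u (SOME k. mat_vec (p k) v = v)) v" for v
  have h: "h v = mat_vec (u k) v" if v: "finite {i. v i \<noteq> 0}" "mat_vec (p k) v = v" for v k
  proof -
    let ?l = "SOME k. mat_vec (p k) v = v"
    have l: "mat_vec (p ?l) v = v" by (rule someI[of "\<lambda>k. mat_vec (p k) v = v", OF v(2)])
    show ?thesis
      unfolding h_def using u_le[of ?l k v] u_le[of k ?l v] v l nat_le_linear[of k ?l] by metis
  qed
  have fin: "finite {i. v i \<noteq> 0}" if "v \<in> carrier (chain_mod p)" for v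
    using that by (simp add: chain_mod_sel)
  have ex: "\<exists>k. mat_vec (p k) v = v" if "v \<in> carrier (chain_mod p)" for v
    using that by (simp add: chain_mod_sel)
  have "h \<in> rhom (chain_mod p) (chain_mod q)"
    unfolding rhom_def mem_Collect_eq
  proof (intro conjI ballI allI)
    show "h \<in> carrier (chain_mod p) \<rightarrow> carrier (chain_mod q)"
    proof
      fix v assume v: "v \<in> carrier (chain_mod p)"
      obtain k where k: "mat_vec (p k) v = v" using ex[OF v] by blast
      have "mat_vec (q k) (mat_vec (u k) v) = mat_vec (u k) v"
        using fin[OF v] qu by (simp flip: mat_vec_mult)
      then show "h v \<in> carrier (chain_mod q)" unfolding h[OF fin[OF v] k] by (auto simp: chain_mod_sel)
    qed
    fix v w assume v: "v \<in> carrier (chain_mod p)" and w: "w \<in> carrier (chain_mod p)"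
    obtain i j where "mat_vec (p i) v = v" "mat_vec (p j) w = w" using ex[OF v] ex[OF w] by blast
    then have k: "mat_vec (p (max i j)) v = v" "mat_vec (p (max i j)) w = w"
      using idem_chain_fix[OF p fin[OF v]] idem_chain_fix[OF p fin[OF w]] by (meson max.cobounded1 max.cobounded2)+
    have "mat_vec (p (max i j)) (\<lambda>i. v i + w i) = (\<lambda>i. v i + w i)"
      using k fin[OF v] fin[OF w] by (simp add: mat_vec_add)
    then show "h (v \<oplus>\<^bsub>chain_mod p\<^esub> w) = h v \<oplus>\<^bsub>chain_mod q\<^esub> h w"
      using h[OF fin[OF v] k(1)] h[OF fin[OF w] k(2)] h[OF finite_add[OF fin[OF v] fin[OF w]]]
      by (simp add: chain_mod_sel mat_vec_add[OF fin[OF v] fin[OF w]])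
  next
    fix v r assume v: "v \<in> carrier (chain_mod p)"
    obtain k where k: "mat_vec (p k) v = v" using ex[OF v] by blast
    have "mat_vec (p k) (\<lambda>i. v i * r) = (\<lambda>i. v i * r)" using k fin[OF v] by (simp add: mat_vec_scale)
    then show "h (v \<cdot>\<^bsub>chain_mod p\<^esub> r) = h v \<cdot>\<^bsub>chain_mod q\<^esub> r"
      using h[OF fin[OF v] k] h[OF finite_scale[OF fin[OF v]]]
      by (simp add: chain_mod_sel mat_vec_scale[OF fin[OF v]])
  qed
  then show ?thesis using h by blast
qed

lemma chain_mod_iso:
  fixes p q u v :: "nat \<Rightarrow> 'a::{ring,monoid_mult} minf"
  assumes pq: "idem_chain p" "idem_chain q" and iso: "\<And>k. idem_iso (p k) (q k) (u k) (v k)"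
    and up: "\<And>k. u (Suc k) * p k = u k" and vq: "\<And>k. v (Suc k) * q k = v k"
  shows "rmod_iso (chain_mod p) (chain_mod q)"
proof -
  have i: "v k * u k = p k" "u k * v k = q k" "q k * u k = u k" "p k * v k = v k" for k
    using iso[of k] idem_iso_left[OF iso[of k]] by (simp_all add: idem_iso_def)
  obtain h where h: "h \<in> rhom (chain_mod p) (chain_mod q)"
    "\<And>k x. finite {i. x i \<noteq> 0} \<Longrightarrow> mat_vec (p k) x = x \<Longrightarrow> h x = mat_vec (u k) x"
    using chain_mod_hom[OF pq(1) i(3) up] by blast
  obtain g where g: "g \<in> rhom (chain_mod q) (chain_mod p)"
    "\<And>k x. finite {i. x i \<noteq> 0} \<Longrightarrow> mat_vec (q k) x = x \<Longrightarrow> g x = mat_vec (v k) x"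
    using chain_mod_hom[OF pq(2) i(4) vq] by blast
  show ?thesis
  proof (rule rmod_isoI[OF h(1) g(1)])
    fix x assume "x \<in> carrier (chain_mod p)"
    then obtain k where x: "finite {i. x i \<noteq> 0}" "mat_vec (p k) x = x" by (auto simp: chain_mod_sel)
    have "mat_vec (q k) (mat_vec (u k) x) = mat_vec (u k) x" using x(1) i by (simp flip: mat_vec_mult)
    then have "g (mat_vec (u k) x) = mat_vec (v k) (mat_vec (u k) x)" by (intro g(2)) simp_all
    also have "\<dots> = mat_vec (p k) x" using x(1) i by (simp flip: mat_vec_mult)
    finally show "g (h x) = x" using h(2)[OF x] x(2) by simp
  next
    fix x assume "x \<in> carrier (chain_mod q)"
    then obtain k where x: "finite {i. x i \<noteq> 0}" "mat_vec (q k) x = x" by (auto simp: chain_mod_sel)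
    have "mat_vec (p k) (mat_vec (v k) x) = mat_vec (v k) x" using x(1) i by (simp flip: mat_vec_mult)
    then have "h (mat_vec (v k) x) = mat_vec (u k) (mat_vec (v k) x)" by (intro h(2)) simp_all
    also have "\<dots> = mat_vec (q k) x" using x(1) i by (simp flip: mat_vec_mult)
    finally show "h (g x) = x" using g(2)[OF x] x(2) by simp
  qed
qed

context
  assumes ur: "unit_regular TYPE('a::{ring,monoid_mult})"
begin

text \<open>The intermediate idempotent is \<open>u' * v'\<close>, the image of the extended map; it
  lies above \<open>q\<close> because the new map extends the old one.\<close>

lemma idem_iso_extend:
  fixes p q p' q' u v :: "'a minf"
  assumes iso: "idem_iso p q u v" and le: "idem_le p p'" "idem_le q q'"
    and p': "p' * p' = p'" and q': "q' * q' = q'" and "p' \<lesssim>\<^sub>1 q'"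
  shows "\<exists>q'' u' v'. idem_iso p' q'' u' v' \<and> idem_le q q'' \<and> idem_le q'' q' \<and> u' * p = u \<and> v' * q = v"
proof -
  have "p * p' = p" "p' * p = p" "q * q' = q" "q' * q = q" using le by (simp_all add: idem_le_def)
  moreover have "v * u = p" "u * v = q" "u * p = u" "v * q = v" using iso by (simp_all add: idem_iso_def)
  ultimately obtain u' v' where "v' * u' = p'" "u' * p' = u'" "v' * (u' * v') = v'" "u' * p = u" "v' * q = v"
    "q' * (u' * v') = u' * v'" "u' * v' * q' = u' * v'" "q * (u' * v') = q" "u' * v' * q = q"
    using idem_extend[OF ur idem_iso_idem(1)[OF iso] p' _ _ idem_iso_idem(2)[OF iso] q', of v u] assms(6)
    by blast
  then show ?thesis unfolding idem_iso_def idem_le_def by blast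
qed

text \<open>The domain runs through all of \<open>e\<close>, while the images \<open>q k\<close>
  stay below terms of \<open>f\<close> without having to exhaust them. The isomorphism therefore
  lands on a submodule.\<close>

lemma chain_mod_embed:
  fixes e f :: "nat \<Rightarrow> 'a minf"
  assumes e: "idem_chain e" and f: "idem_chain f" and le: "seq_le e f"
  shows "\<exists>q. idem_chain q \<and> rmod_iso (chain_mod e) (chain_mod q) \<and>
    carrier (chain_mod q) \<subseteq> carrier (chain_mod f)"
proof -
  have ee: "e k * e k = e k" and ff: "f k * f k = f k" for k
    using idem_chain_mult[OF e, of k k] idem_chain_mult[OF f, of k k] by simp_all
  have step: "\<exists>q' u' v'. (idem_iso (e k) q' u' v' \<and> (\<exists>m. idem_le q' (f m))) \<and>
      (idem_le q q' \<and> u' * p = u \<and> v' * q = v)"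
    if iso: "idem_iso p q u v" and pe: "idem_le p (e k)" and qf: "idem_le q (f m)" for p q u v k m
  proof -
    obtain l where "e k \<lesssim>\<^sub>1 f l" using le unfolding seq_le_def by blast
    then have "e k \<lesssim>\<^sub>1 f (max m l)" by (rule T_seqs_le[OF idem_chain_T_seqs[OF f]]) simp
    moreover have "idem_le q (f (max m l))" by (rule idem_le_trans[OF qf idem_chain_le[OF f]]) simp
    ultimately show ?thesis using idem_iso_extend[OF iso pe _ ee ff] by meson
  qed
  let ?P = "\<lambda>k (q, u, v). idem_iso (e k) q u v \<and> (\<exists>m. idem_le q (f m))"
  let ?Q = "\<lambda>k (q, u, v) (q', u', v'). idem_le q q' \<and> u' * e k = u \<and> v' * q = v"
  have "\<exists>s. \<forall>k. ?P k (s k) \<and> ?Q k (s k) (s (Suc k))"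
  proof (rule dependent_nat_choice)
    \<comment> \<open>The recursion starts from the zero isomorphism between zero
      idempotents.\<close>
    show "\<exists>s. ?P 0 s"
      using step[of 0 0 0 0 0 0] by (auto simp: idem_iso_def idem_le_zero)
  next
    fix s k assume s: "?P k s"
    obtain q u v where quv: "s = (q, u, v)" by (rule prod_cases3)
    obtain m where "idem_iso (e k) q u v" "idem_le q (f m)" using s quv by auto
    from step[OF this(1) idem_chain_le[OF e] this(2), of "Suc k"]
    obtain q' u' v' where "idem_iso (e (Suc k)) q' u' v'" "\<exists>m. idem_le q' (f m)"
      "idem_le q q'" "u' * e k = u" "v' * q = v" by auto
    then show "\<exists>s'. ?P (Suc k) s' \<and> ?Q k s s'"
      unfolding quv by (intro exI[of _ "(q', u', v')"]) simp
  qed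
  then obtain s where all: "\<forall>k. ?P k (s k) \<and> ?Q k (s k) (s (Suc k))" ..
  have s: "?P k (s k)" "?Q k (s k) (s (Suc k))" for k
    by (rule all[rule_format, THEN conjunct1], rule all[rule_format, THEN conjunct2])
  define q u v where quv: "q k = fst (s k)" "u k = fst (snd (s k))" "v k = snd (snd (s k))" for k
  have iso: "idem_iso (e k) (q k) (u k) (v k)" and below: "\<exists>m. idem_le (q k) (f m)"
    and up: "idem_le (q k) (q (Suc k))" "u (Suc k) * e k = u k" "v (Suc k) * q k = v k" for k
    using s(1)[of k] s(2)[of k] unfolding quv by (auto simp: case_prod_beta)
  have q: "idem_chain q"
    using up(1) idem_iso_idem(2)[OF iso] by (intro idem_chainI) (auto simp: idem_le_def)
  have "carrier (chain_mod q) \<subseteq> carrier (chain_mod f)"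
    by (rule chain_mod_subset) (use below in \<open>auto simp: idem_le_def\<close>)
  then show ?thesis using q chain_mod_iso[OF e q iso up(2,3)] by blast
qed

text \<open>A round extends the domain to a term of \<open>e\<close> and then, with the roles
  exchanged, the range to a term of \<open>f\<close>. The second half enlarges the domain again, so
  the domains need not be terms of \<open>e\<close>; they are interleaved with them, which gives the
  same union.\<close>

lemma chain_mod_back_and_forth:
  fixes e f :: "nat \<Rightarrow> 'a minf"
  assumes e: "idem_chain e" and f: "idem_chain f" and le: "seq_le e f" "seq_le f e"
  shows "rmod_iso (chain_mod e) (chain_mod f)"
proof -
  have ee: "e k * e k = e k" and ff: "f k * f k = f k" for k
    using idem_chain_mult[OF e, of k k] idem_chain_mult[OF f, of k k] by simp_all
  have step: "\<exists>p' q' u' v'. (idem_iso p' q' u' v' \<and> (\<exists>n. idem_le p' (e n)) \<and> (\<exists>m. idem_le q' (f m)) \<and>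
      p' * e k = e k \<and> q' * f k = f k) \<and> (idem_le p p' \<and> idem_le q q' \<and> u' * p = u \<and> v' * q = v)"
    if iso: "idem_iso p q u v" and pe: "idem_le p (e n)" and qf: "idem_le q (f m)" for p q u v k m n
  proof -
    \<comment> \<open>Taking at least \<open>k\<close> makes round \<open>k\<close> absorb
      \<open>e k\<close>; \<open>?m\<close> below does the same for \<open>f k\<close>, so both
      chains are exhausted.\<close>
    let ?n = "max n k"
    have pe': "idem_le p (e ?n)" by (rule idem_le_trans[OF pe idem_chain_le[OF e]]) simp
    obtain l where "e ?n \<lesssim>\<^sub>1 f l" using le(1) unfolding seq_le_def by blast
    then have 1: "e ?n \<lesssim>\<^sub>1 f (max m l)" by (rule T_seqs_le[OF idem_chain_T_seqs[OF f]]) simp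
    have "idem_le q (f (max m l))" by (rule idem_le_trans[OF qf idem_chain_le[OF f]]) simp
    from idem_iso_extend[OF iso pe' this ee ff 1]
    obtain q1 u1 v1 where 1: "idem_iso (e ?n) q1 u1 v1" "idem_le q q1" "idem_le q1 (f (max m l))"
      "u1 * p = u" "v1 * q = v" by blast
    let ?m = "max (max m l) k"
    have qf': "idem_le q1 (f ?m)" by (rule idem_le_trans[OF 1(3) idem_chain_le[OF f]]) simp
    obtain l' where "f ?m \<lesssim>\<^sub>1 e l'" using le(2) unfolding seq_le_def by blast
    then have 2: "f ?m \<lesssim>\<^sub>1 e (max ?n l')" by (rule T_seqs_le[OF idem_chain_T_seqs[OF e]]) simp
    have "idem_le (e ?n) (e (max ?n l'))" by (rule idem_chain_le[OF e]) simp
    from idem_iso_extend[OF idem_iso_sym[OF 1(1)] qf' this ff ee 2]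
    obtain p2 v2 u2 where 2: "idem_iso (f ?m) p2 v2 u2" "idem_le (e ?n) p2" "idem_le p2 (e (max ?n l'))"
      "v2 * q1 = v1" "u2 * e ?n = u1" by blast
    have "e ?n * p = p" "q1 * q = q" using pe' 1(2) by (simp_all add: idem_le_def)
    then have "u2 * p = (u2 * e ?n) * p" "v2 * q = (v2 * q1) * q" by (simp_all only: mult.assoc)
    then have uv: "u2 * p = u" "v2 * q = v" using 1 2 by simp_all
    have ek: "e ?n * e k = e k" and fk: "f ?m * f k = f k"
      using idem_chain_mult[OF e, of ?n k] idem_chain_mult[OF f, of ?m k] by simp_all
    have p2: "p2 * e k = e k"
      by (rule absorb_left[OF ek]) (use 2(2) in \<open>simp add: idem_le_def\<close>)
    have nm: "\<exists>n. idem_le p2 (e n)" "\<exists>m. idem_le (f ?m) (f m)"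
      using 2(3) idem_chain_le[OF f order_refl] by blast+
    show ?thesis
      by (rule exI[of _ p2], rule exI[of _ "f ?m"], rule exI[of _ u2], rule exI[of _ v2])
        (intro conjI nm idem_iso_sym[OF 2(1)] p2 fk uv idem_le_trans[OF pe' 2(2)] idem_le_trans[OF 1(2) qf'])
  qed
  let ?P = "\<lambda>k (p, q, u, v). idem_iso p q u v \<and> (\<exists>n. idem_le p (e n)) \<and> (\<exists>m. idem_le q (f m)) \<and>
    p * e k = e k \<and> q * f k = f k"
  let ?Q = "\<lambda>k (p, q, u, v) (p', q', u', v'). idem_le p p' \<and> idem_le q q' \<and> u' * p = u \<and> v' * q = v"
  have "\<exists>s. \<forall>k. ?P k (s k) \<and> ?Q k (s k) (s (Suc k))"
  proof (rule dependent_nat_choice)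
    obtain p q u v where "?P 0 (p, q, u, v)"
      using step[of 0 0 0 0 0 0 0] by (auto simp: idem_iso_def idem_le_zero)
    then show "\<exists>s. ?P 0 s" by blast
  next
    fix s k assume s: "?P k s"
    obtain p q u v where pquv: "s = (p, q, u, v)" by (rule prod_cases4)
    obtain m n where "idem_iso p q u v" "idem_le p (e n)" "idem_le q (f m)" using s pquv by auto
    from step[OF this, of "Suc k"]
    obtain p' q' u' v' where "?P (Suc k) (p', q', u', v') \<and> ?Q k (p, q, u, v) (p', q', u', v')"
      by simp blast
    then show "\<exists>s'. ?P (Suc k) s' \<and> ?Q k s s'" unfolding pquv by (rule exI)
  qed
  then obtain s where all: "\<forall>k. ?P k (s k) \<and> ?Q k (s k) (s (Suc k))" ..
  have s: "?P k (s k)" "?Q k (s k) (s (Suc k))" for k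
    by (rule all[rule_format, THEN conjunct1], rule all[rule_format, THEN conjunct2])
  define p q u v where pquv: "p k = fst (s k)" "q k = fst (snd (s k))"
    "u k = fst (snd (snd (s k)))" "v k = snd (snd (snd (s k)))" for k
  have iso: "idem_iso (p k) (q k) (u k) (v k)"
    and below: "\<exists>n. idem_le (p k) (e n)" "\<exists>m. idem_le (q k) (f m)"
    and above: "p k * e k = e k" "q k * f k = f k"
    and up: "idem_le (p k) (p (Suc k))" "idem_le (q k) (q (Suc k))"
      "u (Suc k) * p k = u k" "v (Suc k) * q k = v k" for k
    using s(1)[of k] s(2)[of k] unfolding pquv by (auto simp: case_prod_beta)
  have p: "idem_chain p" and q: "idem_chain q"
    using up(1,2) idem_iso_idem[OF iso] by (auto intro!: idem_chainI simp: idem_le_def)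
  \<comment> \<open>The invariants \<open>below\<close> and \<open>above\<close> give the two
    inclusions. Chain modules differ from \<open>columns\<close> in the carrier alone, so equal
    carriers make them equal, not just isomorphic.\<close>
  have "carrier (chain_mod p) = carrier (chain_mod e)"
    by (intro equalityI chain_mod_subset) (use below above in \<open>unfold idem_le_def, blast\<close>)+
  moreover have "carrier (chain_mod q) = carrier (chain_mod f)"
    by (intro equalityI chain_mod_subset) (use below above in \<open>unfold idem_le_def, blast\<close>)+
  moreover have "chain_mod a = columns\<lparr>carrier := carrier (chain_mod a)\<rparr>" for a :: "nat \<Rightarrow> 'a minf"
    by (simp add: chain_mod_def)
  ultimately have "chain_mod p = chain_mod e" "chain_mod q = chain_mod f" by metis+
  then show ?thesis using chain_mod_iso[OF p q iso up(3,4)] by simp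
qed

text \<open>On columns of length \<open>N\<close>, \<open>h\<close> after \<open>e k\<close> is
  given by a matrix \<open>s = f m * t\<close>. For a quasi-inverse \<open>z\<close> of
  \<open>s\<close>, a column \<open>v\<close> and its image under \<open>z * s\<close> have equal
  images under \<open>s\<close>. Injectivity of \<open>h\<close> then expresses \<open>e k\<close>,
  up to truncation, as \<open>e k * z * s\<close>, a multiple of \<open>f m\<close>.\<close>

lemma chain_mod_injective_le:
  fixes e f :: "nat \<Rightarrow> 'a minf"
  assumes e: "idem_chain e" and f: "idem_chain f"
    and h: "h \<in> rhom (chain_mod e) (chain_mod f)" "inj_on h (carrier (chain_mod e))"
  shows "seq_le e f"
  unfolding seq_le_def
proof
  fix k
  obtain n where n: "split_system n f" "is_limit_of (chain_mod f) n f" using chain_mod_limit[OF f] by blast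
  obtain N where N: "e k \<in> mats N N" using ex_mats by blast
  let ?F = "free_rmod {..<N} :: ('a, nat \<Rightarrow> 'a) rmod"
  have E: "mat_vec (e k) \<in> rhom ?F (chain_mod e)"
    by (rule idem_chain_rhom[OF e])
  have "mat_vec (f m) \<in> rhom (free_rmod {..<n m}) (chain_mod f)" for m
    by (rule idem_chain_rhom[OF f])
  then have cone: "is_cocone (chain_mod f) n f (\<lambda>m. mat_vec (f m))"
    unfolding is_cocone_def
  proof (intro conjI allI ballI impI)
    show "mat_vec (f (Suc i)) (mat_vec (f i) v) = mat_vec (f i) v"
      if "v \<in> carrier (free_rmod {..<n i})" for i v
      using free_finite[OF that] by (simp add: idem_chain_mult[OF f] flip: mat_vec_mult)
    fix v assume "v \<in> carrier (chain_mod f)"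
    then obtain i where i: "finite {i. v i \<noteq> 0}" "mat_vec (f i) v = v" by (auto simp: chain_mod_sel)
    then have "mat_vec (f (Suc i)) v = v" by (intro idem_chain_fix[OF f i]) simp
    moreover have "v \<in> carrier (free_rmod {..<n (Suc i)})"
      using mat_vec_closed[of "f i" "n (Suc i)" "n i" v] n(1) i(2) by (simp add: split_system_def)
    ultimately show "\<exists>i. \<exists>w\<in>carrier (free_rmod {..<n i}). v = mat_vec (f i) w" by metis
  qed
  have fm: "\<forall>i. f i \<in> mats (n (Suc i)) (n i)" using n(1) by (simp add: split_system_def)
  obtain m t where t: "t \<in> mats (n m) N"
    "\<And>v. v \<in> carrier ?F \<Longrightarrow> h (mat_vec (e k) v) = mat_vec (f m) (mat_vec t v)"
    using cocone_factor[OF cone fm right_module_chain(2)[OF f] rhom_comp[OF E h(1)], of 0]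
    by blast
  let ?s = "f m * t"
  obtain z where z: "?s * z * ?s = ?s" using regular[OF ur, of ?s] by metis
  \<comment> \<open>The truncation is inserted because the formula for \<open>h\<close> holds on
    columns of length \<open>N\<close>, a length that \<open>z * ?s\<close> need not
    respect.\<close>
  have "?s * unit_mat N = ?s" using t(1) by (simp add: mats_iff mult.assoc)
  then have "?s * (unit_mat N * z) * ?s = ?s" using z by (simp flip: mult.assoc)
  then have z': "?s * (unit_mat N * z * ?s) = ?s" by (simp only: mult.assoc)
  have "e k = (e k * unit_mat N * z) * f m * t"
  proof (rule mats_eqI[OF N])
    show "(e k * unit_mat N * z) * f m * t \<in> mats N N"
      using mats_sandwich[OF N t(1), of "unit_mat N * z * f m"] by (simp only: mult.assoc)
    fix j assume "j < N"
    then have v: "std j \<in> carrier ?F" by (intro std_closed) simp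
    let ?v = "std j :: nat \<Rightarrow> 'a"
    note fin = free_finite[OF v]
    let ?w = "mat_vec (unit_mat N * z * ?s) ?v"
    have "?w = mat_vec (unit_mat N) (mat_vec (z * ?s) ?v)" using fin by (simp add: mult.assoc flip: mat_vec_mult)
    then have w: "?w \<in> carrier ?F" using mat_vec_closed[OF unit_mat_mats] by simp
    have "h (mat_vec (e k) ?w) = mat_vec ?s ?w" using t(2)[OF w] by (simp add: mat_vec_mult)
    also have "\<dots> = mat_vec ?s ?v" by (simp only: mat_vec_mult[OF fin, symmetric] z')
    also have "\<dots> = h (mat_vec (e k) ?v)" using t(2)[OF v] fin by (simp add: mat_vec_mult)
    finally have "mat_vec (e k) ?v = mat_vec (e k) ?w"
      using h(2) idem_chain_range[OF e fin] idem_chain_range[OF e mat_vec_finite]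
      unfolding inj_on_def by metis
    also have "\<dots> = mat_vec ((e k * unit_mat N * z) * f m * t) ?v"
      by (simp only: mat_vec_mult[OF fin, symmetric] mult.assoc)
    finally show "mat_vec (e k) ?v = mat_vec ((e k * unit_mat N * z) * f m * t) ?v" .
  qed
  then show "\<exists>m. e k \<lesssim>\<^sub>1 f m" using le1I by blast
qed

end

section \<open>Countably generated projective modules\<close>

lemma rhom_restrict: "f \<in> rhom P Q \<Longrightarrow> X \<subseteq> carrier P \<Longrightarrow> f \<in> rhom (P\<lparr>carrier := X\<rparr>) Q"
  by (auto simp: rhom_def Pi_iff subset_iff)

lemma rsubmodule_carrier: "right_module M \<Longrightarrow> rsubmodule M (carrier M)"
proof -
  assume "right_module M"
  then interpret right_module M .
  show ?thesis by (auto simp: rsubmodule_def)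
qed

lemma chain_mod_countably_generated:
  fixes e :: "nat \<Rightarrow> 'a::{ring,monoid_mult} minf"
  assumes e: "idem_chain e"
  shows "countably_generated (chain_mod e)"
  unfolding countably_generated_def
proof (intro exI conjI)
  let ?S = "(\<lambda>(n, j). mat_vec (e n) (std j)) ` UNIV"
  note M = right_module_chain(2)[OF e]
  show "countable ?S" by simp
  show S: "?S \<subseteq> carrier (chain_mod e)"
    by (auto intro!: idem_chain_range[OF e] simp del: mat_vec_finite)
  show "carrier (chain_mod e) = rspan (chain_mod e) ?S"
  proof (intro equalityI subsetI)
    fix v assume "v \<in> carrier (chain_mod e)"
    then obtain n where v: "finite {i. v i \<noteq> 0}" "mat_vec (e n) v = v" by (auto simp: chain_mod_sel)
    have "mat_vec (e n) v \<in> rspan (chain_mod e) ?S"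
    proof (rule rhom_free_submodule[OF M idem_chain_rhom[OF e] rsubmodule_rspan(1)[OF M S], where I = UNIV])
      show "mat_vec (e n) (std j) \<in> rspan (chain_mod e) ?S" for j
        using rsubmodule_rspan(2)[OF M S] by (rule subsetD) auto
    qed (use v in \<open>simp add: free_rmod_def\<close>)
    then show "v \<in> rspan (chain_mod e) ?S" by (simp only: v(2))
  next
    fix v assume "v \<in> rspan (chain_mod e) ?S"
    then show "v \<in> carrier (chain_mod e)"
      using rspan_least[OF rsubmodule_carrier[OF M] S] by blast
  qed
qed

text \<open>The differences \<open>d n\<close> of consecutive idempotents make \<open>chain_mod e\<close> a retract of the free module
  on pairs \<open>(n, j)\<close>.\<close>

lemma chain_mod_projective:
  fixes e :: "nat \<Rightarrow> 'a::{ring,monoid_mult} minf"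
  assumes e: "idem_chain e"
  shows "projective (chain_mod e)"
  unfolding projective_def
proof (intro allI impI, elim conjE)
  fix M :: "('a, (nat \<Rightarrow> 'a) \<Rightarrow> 'a) rmod" and N :: "('a, nat \<Rightarrow> 'a) rmod" and f g
  assume M: "right_module M" and N: "right_module N" and f: "f \<in> rhom M N" "f ` carrier M = carrier N"
    and g: "g \<in> rhom (chain_mod e) N"
  interpret M: right_module M by fact
  let ?E = "chain_mod e"
  let ?F = "free_rmod UNIV :: ('a, nat \<times> nat \<Rightarrow> 'a) rmod"
  \<comment> \<open>Starting with \<open>e 0\<close> makes the sum of \<open>d 0\<close> to
    \<open>d n\<close> equal to \<open>e n\<close>.\<close>
  define d where "d n = (case n of 0 \<Rightarrow> e 0 | Suc k \<Rightarrow> e (Suc k) - e k)" for n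
  have ed: "e n * d n = d n" and de: "k \<le> n \<Longrightarrow> d (Suc n) * e k = 0" and dd: "d n * d n = d n" for k n
  proof -
    show "e n * d n = d n" "d n * d n = d n"
      by (cases n; simp add: d_def algebra_simps idem_chain_mult[OF e])+
    show "k \<le> n \<Longrightarrow> d (Suc n) * e k = 0"
      by (simp add: d_def left_diff_distrib idem_chain_mult[OF e] min_def)
  qed
  have fin: "finite {i. v i \<noteq> 0}" if "v \<in> carrier ?E" for v
    using that by (simp add: chain_mod_sel)
  have dE: "mat_vec (d n) v \<in> carrier ?E" if "finite {i. v i \<noteq> 0}" for n v
  proof -
    have "mat_vec (e n) (mat_vec (d n) v) = mat_vec (d n) v" using that ed by (simp flip: mat_vec_mult)
    then show ?thesis by (auto simp: chain_mod_sel)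
  qed
  have d_rhom: "mat_vec (d n) \<in> rhom columns ?E" for n
    unfolding rhom_def chain_mod_sel(2,3) free_sel
    using dE[OF free_finite] mat_vec_add[OF free_finite free_finite] mat_vec_scale[OF free_finite] by blast
  have "\<exists>m\<in>carrier M. f m = g (mat_vec (d n) (std j))" for n j
  proof -
    have "g (mat_vec (d n) (std j)) \<in> carrier N"
      by (rule rhom_closed[OF g rhom_closed[OF d_rhom std_closed]]) simp
    then have "g (mat_vec (d n) (std j)) \<in> f ` carrier M" by (simp only: f(2))
    then obtain m where "g (mat_vec (d n) (std j)) = f m" "m \<in> carrier M" by (rule imageE)
    then show ?thesis by (intro bexI[of _ m]) simp_all
  qed
  \<comment> \<open>Lifts are chosen for the generators, and \<open>L\<close> extends them linearly
    to the free module on pairs, where no relations need to be respected.\<close>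
  then obtain m where m: "\<And>n j. m n j \<in> carrier M" "\<And>n j. f (m n j) = g (mat_vec (d n) (std j))"
    by metis
  define L where "L = M.lin (\<lambda>(n, j). m n j)"
  have L: "L \<in> rhom ?F M" unfolding L_def by (rule M.lin_rhom) (use m in auto)
  define \<iota> where "\<iota> n w = (\<lambda>(k, j). if k = n then w j else 0)" for n :: nat and w :: "nat \<Rightarrow> 'a"
  have \<iota>: "\<iota> n \<in> rhom columns ?F" for n
  proof -
    have "\<iota> n w \<in> carrier ?F" if "finite {i. w i \<noteq> 0}" for w
    proof -
      have "{p. \<iota> n w p \<noteq> 0} \<subseteq> {n} \<times> {i. w i \<noteq> 0}" by (auto simp: \<iota>_def split: if_splits)
      then have "finite {p. \<iota> n w p \<noteq> 0}" by (rule finite_subset) (use that in simp)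
      then show ?thesis by (simp add: free_rmod_def)
    qed
    moreover have "\<iota> n (\<lambda>i. v i + w i) = (\<lambda>p. \<iota> n v p + \<iota> n w p)" "\<iota> n (\<lambda>i. v i * r) = (\<lambda>p. \<iota> n v p * r)" for v w r
      by (simp_all add: \<iota>_def fun_eq_iff)
    ultimately show ?thesis unfolding rhom_def free_sel using free_finite by blast
  qed
  have fL\<iota>: "f (L (\<iota> n w)) = g (mat_vec (d n) w)" if "w \<in> carrier columns" for n w
  proof (rule rhom_free_eq[OF N _ _ _ that])
    show "(\<lambda>w. f (L (\<iota> n w))) \<in> rhom columns N" by (rule rhom_comp[OF rhom_comp[OF \<iota> L] f(1)])
    show "(\<lambda>w. g (mat_vec (d n) w)) \<in> rhom columns N" by (rule rhom_comp[OF d_rhom g])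
    fix j :: nat
    have "\<iota> n (std j) = std (n, j)" by (auto simp: \<iota>_def)
    then show "f (L (\<iota> n (std j))) = g (mat_vec (d n) (std j))"
      using M.lin_single[of "\<lambda>(n, j). m n j" "(n, j)"] m by (simp add: L_def)
  qed
  \<comment> \<open>Coordinates truncated at stage \<open>n\<close>. The truncation permits the
    telescoping induction in \<open>fLc\<close>, which adds one component at a time.\<close>
  define c where "c n v = (\<lambda>(k, j). if k \<le> n then mat_vec (d k) v j else 0)" for n v
  have c_free: "c n v \<in> carrier ?F" for n v
  proof -
    have "{p. c n v p \<noteq> 0} \<subseteq> (\<Union>k\<le>n. {k} \<times> {j. mat_vec (d k) v j \<noteq> 0})"
      by (auto simp: c_def split: if_splits)
    moreover have "finite (\<Union>k\<le>n. {k} \<times> {j. mat_vec (d k) v j \<noteq> 0})" by auto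
    ultimately have "finite {p. c n v p \<noteq> 0}" by (rule finite_subset)
    then show ?thesis by (simp add: free_rmod_def)
  qed
  have fLc: "f (L (c n v)) = g (mat_vec (e n) v)" if v: "finite {i. v i \<noteq> 0}" for n v
  proof (induction n)
    case 0
    have "c 0 v = \<iota> 0 (mat_vec (d 0) v)" by (auto simp: c_def \<iota>_def fun_eq_iff)
    moreover have "mat_vec (d 0) (mat_vec (d 0) v) = mat_vec (e 0) v"
      using v dd[of 0] by (simp add: d_def flip: mat_vec_mult)
    ultimately show ?case using fL\<iota>[of "mat_vec (d 0) v" 0] by (simp add: free_rmod_def)
  next
    case (Suc n)
    let ?w = "mat_vec (d (Suc n)) v"
    have w: "?w \<in> carrier columns" by (simp add: free_rmod_def)
    have "c (Suc n) v = (\<lambda>p. c n v p + \<iota> (Suc n) ?w p)"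
      by (auto simp: c_def \<iota>_def fun_eq_iff le_Suc_eq)
    then have "L (c (Suc n) v) = L (c n v) \<oplus>\<^bsub>M\<^esub> L (\<iota> (Suc n) ?w)"
      using rhom_add[OF L c_free rhom_closed[OF \<iota> w], of n v "Suc n"] by (simp add: free_sel)
    then have "f (L (c (Suc n) v)) = f (L (c n v)) \<oplus>\<^bsub>N\<^esub> f (L (\<iota> (Suc n) ?w))"
      using rhom_add[OF f(1) rhom_closed[OF L c_free] rhom_closed[OF L rhom_closed[OF \<iota> w]]] by simp
    also have "\<dots> = g (mat_vec (e n) v) \<oplus>\<^bsub>N\<^esub> g (mat_vec (d (Suc n)) ?w)"
      using Suc fL\<iota>[OF w] by simp
    also have "mat_vec (d (Suc n)) ?w = ?w" using v dd by (simp flip: mat_vec_mult)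
    also have "g (mat_vec (e n) v) \<oplus>\<^bsub>N\<^esub> g ?w = g (mat_vec (e n) v \<oplus>\<^bsub>?E\<^esub> ?w)"
      by (rule rhom_add[OF g idem_chain_range[OF e v] dE[OF v], symmetric])
    also have "mat_vec (e n) v \<oplus>\<^bsub>?E\<^esub> ?w = mat_vec (e n + d (Suc n)) v"
      by (simp add: chain_mod_sel mat_vec_plus)
    also have "e n + d (Suc n) = e (Suc n)" by (simp add: d_def)
    finally show ?case .
  qed
  \<comment> \<open>On a vector fixed by \<open>e n\<close> the components beyond \<open>n\<close>
    vanish, so these coordinates agree with \<open>c n\<close>; unlike \<open>c n\<close> they give
    one homomorphism valid at all stages.\<close>
  define \<kappa> where "\<kappa> v = (\<lambda>(k, j). mat_vec (d k) v j)" for v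
  have \<kappa>c: "\<kappa> v = c n v" if v: "finite {i. v i \<noteq> 0}" "mat_vec (e n) v = v" for v n
  proof -
    have "mat_vec (d k) v = (\<lambda>_. 0)" if "n < k" for k
    proof -
      obtain l where l: "k = Suc l" "n \<le> l" using \<open>n < k\<close> by (cases k) auto
      have "mat_vec (d k) (mat_vec (e n) v) = (\<lambda>_. 0)"
        using v(1) de[OF l(2)] by (simp add: l(1) flip: mat_vec_mult)
      then show ?thesis by (simp only: v(2))
    qed
    then show ?thesis by (auto simp: \<kappa>_def c_def fun_eq_iff not_le)
  qed
  have "\<kappa> v \<in> carrier ?F" if v: "v \<in> carrier ?E" for v
    using v \<kappa>c[OF fin[OF v]] c_free by (auto simp: chain_mod_sel)
  then have "\<kappa> \<in> rhom ?E ?F"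
    unfolding rhom_def chain_mod_sel(2,3) free_sel
    using mat_vec_add[OF fin fin] mat_vec_scale[OF fin] by (auto simp: \<kappa>_def fun_eq_iff)
  then have L\<kappa>: "(\<lambda>v. L (\<kappa> v)) \<in> rhom ?E M" by (rule rhom_comp[OF _ L])
  have "f (L (\<kappa> v)) = g v" if v: "v \<in> carrier ?E" for v
  proof -
    obtain n where n: "mat_vec (e n) v = v" using v by (auto simp: chain_mod_sel)
    show ?thesis using fLc[OF fin[OF v], of n] by (simp add: \<kappa>c[OF fin[OF v] n] n)
  qed
  then show "\<exists>h\<in>rhom ?E M. \<forall>v\<in>carrier ?E. f (h v) = g v" by (intro bexI[OF _ L\<kappa>] ballI)
qed

lemma chain_mod_cg_projective: "idem_chain e \<Longrightarrow> chain_mod e \<in> cg_projective"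
  by (simp add: cg_projective_def right_module_chain chain_mod_countably_generated chain_mod_projective)

text \<open>It attaches an idempotent chain to a module on any carrier type. The module axioms for
  \<open>P\<close> are included because inverting the isomorphism uses them.\<close>

definition represents :: "(nat \<Rightarrow> 'a minf) \<Rightarrow> ('a::{ring,monoid_mult}, 'm) rmod \<Rightarrow> bool" where
  "represents e P \<longleftrightarrow> idem_chain e \<and> right_module P \<and> rmod_iso P (chain_mod e)"

lemma represents_chain_mod: "idem_chain e \<Longrightarrow> represents e (chain_mod e)"
  by (simp add: represents_def right_module_chain rmod_iso_refl)

lemma represents_limit:
  assumes "represents e P"
  shows "\<exists>n. split_system n e \<and> is_limit_of P n e"
  using assms chain_mod_limit[of e] rmod_iso_trans unfolding represents_def is_limit_of_def by blast

lemma represents_limit_equiv: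
  fixes P :: "('a::{ring,monoid_mult}, 'p) rmod"
  assumes e: "represents e P" and f: "represents f Q" and le: "P \<lesssim>\<^sub>C\<^sub>P Q"
    and x: "split_system n x" "is_limit_of P n x" and y: "split_system n' y" "is_limit_of Q n' y"
  shows "seq_le x y"
  using cp_le_imp_seq_le[OF _ x _ y le] e f by (simp add: represents_def)

lemma cp_le_refl: "right_module P \<Longrightarrow> P \<lesssim>\<^sub>C\<^sub>P P"
  unfolding cp_le_def
proof (intro allI impI)
  fix X assume P: "right_module P" and "fg_submodule P X"
  then obtain S where S: "S \<subseteq> carrier P" "X = rspan P S" unfolding fg_submodule_def by blast
  have "X \<subseteq> carrier P" unfolding S(2) by (rule rspan_least[OF rsubmodule_carrier[OF P] S(1)])
  then show "\<exists>\<alpha>\<in>rhom (P\<lparr>carrier := X\<rparr>) P. \<exists>\<beta>\<in>rhom P P. \<forall>x\<in>X. \<beta> (\<alpha> x) = x"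
    by (intro bexI[of _ "\<lambda>x. x"]) (auto simp: rhom_def)
qed

text \<open>Forward, the two chains are compared as presentations of limits. Backward, a finitely
  generated \<open>X\<close> corresponds to vectors fixed by a single \<open>e k\<close>, and a
  factorization of \<open>e k\<close> through some \<open>f m\<close> provides both maps.\<close>

lemma represents_cp_le:
  fixes P :: "('a::{ring,monoid_mult}, 'p) rmod" and Q :: "('a, 'q) rmod"
  assumes eP: "represents e P" and fQ: "represents f Q"
  shows "P \<lesssim>\<^sub>C\<^sub>P Q \<longleftrightarrow> seq_le e f"
proof
  assume le: "P \<lesssim>\<^sub>C\<^sub>P Q"
  obtain n where n: "split_system n e" "is_limit_of P n e" using represents_limit[OF eP] by blast
  obtain n' where n': "split_system n' f" "is_limit_of Q n' f" using represents_limit[OF fQ] by blast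
  show "seq_le e f" by (rule represents_limit_equiv[OF eP fQ le n n'])
next
  assume le: "seq_le e f"
  have e: "idem_chain e" and P: "right_module P" and f: "idem_chain f" and Q: "right_module Q"
    using eP fQ by (simp_all add: represents_def)
  obtain g g' where g: "g \<in> rhom P (chain_mod e)" "g' \<in> rhom (chain_mod e) P"
    "\<And>x. x \<in> carrier P \<Longrightarrow> g' (g x) = x"
    using eP unfolding represents_def by (metis rmod_isoE)
  obtain h h' where h: "h \<in> rhom Q (chain_mod f)" "h' \<in> rhom (chain_mod f) Q"
    "\<And>y. y \<in> carrier (chain_mod f) \<Longrightarrow> h (h' y) = y"
    using fQ unfolding represents_def by (metis rmod_isoE)
  have hom: "(\<lambda>v. mat_vec (c k) (mat_vec x v)) \<in> rhom (chain_mod b) (chain_mod c)"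
    if "idem_chain c" for b c :: "nat \<Rightarrow> 'a minf" and x k
    using idem_chain_range[OF that]
    by (auto simp: rhom_def chain_mod_sel mat_vec_add mat_vec_scale)
  show "P \<lesssim>\<^sub>C\<^sub>P Q"
    unfolding cp_le_def
  proof (intro allI impI)
    fix X assume "fg_submodule P X"
    then obtain S where S: "finite S" "S \<subseteq> carrier P" "X = rspan P S" unfolding fg_submodule_def by blast
    have gS: "finite {i. g s i \<noteq> 0}" "\<exists>k. mat_vec (e k) (g s) = g s" if "s \<in> carrier P" for s
      using rhom_closed[OF g(1) that] by (simp_all add: chain_mod_sel)
    obtain l where l: "\<And>s. s \<in> carrier P \<Longrightarrow> mat_vec (e (l s)) (g s) = g s" using gS(2) by metis
    \<comment> \<open>One stage that fixes all generators; \<open>0\<close> is inserted for the case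
      of no generators.\<close>
    define k where "k = Max (insert 0 (l ` S))"
    let ?Y = "{x \<in> carrier P. mat_vec (e k) (g x) = g x}"
    interpret P: right_module P by fact
    have "rsubmodule P ?Y"
      unfolding rsubmodule_def
      using rhom_add[OF g(1)] rhom_ract[OF g(1)] rhom_zero[OF P right_module_chain(2)[OF e] g(1)] gS(1)
      by (auto simp: chain_mod_sel mat_vec_add mat_vec_scale)
    moreover have "S \<subseteq> ?Y"
    proof
      fix s assume s: "s \<in> S"
      then have "l s \<le> k" using S(1) by (simp add: k_def)
      have sP: "s \<in> carrier P" using s S(2) by blast
      from idem_chain_fix[OF e gS(1)[OF sP] l[OF sP] \<open>l s \<le> k\<close>] sP show "s \<in> ?Y" by blast
    qed
    ultimately have X: "X \<subseteq> ?Y" unfolding S(3) by (rule rspan_least)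
    obtain m r t where rt: "e k = r * f m * t" using le unfolding seq_le_def le1_def by blast
    \<comment> \<open>Passing through \<open>f m\<close> and \<open>e k\<close> forces the
      intermediate columns into the two chain modules.\<close>
    let ?\<alpha> = "\<lambda>x. h' (mat_vec (f m) (mat_vec t (g x)))"
    let ?\<beta> = "\<lambda>y. g' (mat_vec (e k) (mat_vec (r * f m) (h y)))"
    have "?\<alpha> \<in> rhom P Q" by (rule rhom_comp[OF rhom_comp[OF g(1) hom[OF f]] h(2)])
    then have \<alpha>: "?\<alpha> \<in> rhom (P\<lparr>carrier := X\<rparr>) Q" by (rule rhom_restrict) (use X in blast)
    have \<beta>: "?\<beta> \<in> rhom Q P" by (rule rhom_comp[OF rhom_comp[OF h(1) hom[OF e]] g(2)])
    have "?\<beta> (?\<alpha> x) = x" if "x \<in> X" for x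
    proof -
      have x: "x \<in> carrier P" "mat_vec (e k) (g x) = g x" using X that by auto
      have "h (?\<alpha> x) = mat_vec (f m) (mat_vec t (g x))" by (rule h(3)[OF idem_chain_range[OF f]]) simp
      moreover have "e k * (r * f m * (f m * t)) = e k"
      proof -
        have "e k * (r * f m * (f m * t)) = e k * (r * (f m * f m) * t)" by (simp only: mult.assoc)
        then show ?thesis
          using idem_chain_mult[OF f, of m m] idem_chain_mult[OF e, of k k] by (simp flip: rt)
      qed
      ultimately have "?\<beta> (?\<alpha> x) = g' (mat_vec (e k) (g x))"
        using gS(1)[OF x(1)] by (simp flip: mat_vec_mult)
      then show ?thesis using g(3)[OF x(1)] by (simp only: x(2))
    qed
    then show "\<exists>\<alpha>\<in>rhom (P\<lparr>carrier := X\<rparr>) Q. \<exists>\<beta>\<in>rhom Q P. \<forall>x\<in>X. \<beta> (\<alpha> x) = x"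
      by (intro bexI[OF _ \<alpha>] bexI[OF _ \<beta>] ballI)
  qed
qed

text \<open>Even coordinates carry the first summand, odd ones the second. Embeddings independent of
  \<open>n\<close> are essential: in block sums the offset of the second block would vary with
  \<open>n\<close>, and the sums need not form a chain.\<close>

lemma direct_sum_chain_mod:
  fixes e f :: "nat \<Rightarrow> 'a::{ring,monoid_mult} minf"
  assumes e: "idem_chain e" and f: "idem_chain f"
  defines "\<sigma> \<equiv> \<lambda>i. 2 * i" and "\<tau> \<equiv> \<lambda>i. Suc (2 * i)"
  defines "g \<equiv> \<lambda>n. embed_mat \<sigma> \<sigma> (e n) + embed_mat \<tau> \<tau> (f n)"
  shows "idem_chain g" "rmod_iso (direct_sum (chain_mod e) (chain_mod f)) (chain_mod g)"
    "sized k e \<Longrightarrow> seq_le g (seq_sum k e f) \<and> seq_le (seq_sum k e f) g"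
proof -
  have inj: "inj \<sigma>" "inj \<tau>" by (auto simp: \<sigma>_def \<tau>_def inj_on_def)
  have disj: "range \<sigma> \<inter> range \<tau> = {}" "range \<tau> \<inter> range \<sigma> = {}"
    unfolding \<sigma>_def \<tau>_def by (auto) presburger+
  have orth: "embed_mat a \<sigma> x * embed_mat \<tau> b y = 0" "embed_mat a \<tau> x * embed_mat \<sigma> b y = 0"
    for a b and x y :: "'a minf" by (rule embed_orth disj)+
  show g: "idem_chain g"
    using e f by (simp add: idem_chain_def g_def distrib_left distrib_right orth embed_mult inj)
  show "seq_le g (seq_sum k e f) \<and> seq_le (seq_sum k e f) g" if k: "sized k e"
  proof -
    have "g n \<lesssim>\<^sub>1 seq_sum k e f n \<and> seq_sum k e f n \<lesssim>\<^sub>1 g n" for n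
    proof -
      \<comment> \<open>The comparison passes through the square block sum, which is the orthogonal
        sum \<open>e n + ?s\<close>; the rectangular \<open>seq_sum\<close> is reached because sizes
        do not matter up to equivalence.\<close>
      obtain m where m: "e n \<in> mats m m" using ex_mats by blast
      have kn: "e n \<in> mats (k (Suc n)) (k n)" using k by (simp add: sized_def)
      have idem: "e n * e n = e n" "f n * f n = f n"
        using idem_chain_mult[OF e, of n n] idem_chain_mult[OF f, of n n] by simp_all
      let ?s = "embed_mat (shift m) (shift m) (f n)"
      have s: "?s * ?s = ?s" "orth (e n) ?s"
        using idem m by (simp_all add: orth_def mats_mult_shift shift_mult_mats embed_mult[OF inj_shift])
      have eg: "embed_mat \<sigma> \<sigma> (e n) * embed_mat \<sigma> \<sigma> (e n) = embed_mat \<sigma> \<sigma> (e n)"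
        "embed_mat \<tau> \<tau> (f n) * embed_mat \<tau> \<tau> (f n) = embed_mat \<tau> \<tau> (f n)"
        "orth (embed_mat \<sigma> \<sigma> (e n)) (embed_mat \<tau> \<tau> (f n))"
        by (simp_all add: embed_mult inj idem orth_def orth)
      have "g n \<lesssim>\<^sub>1 e n + ?s" unfolding g_def
        by (rule orth_add_le1[OF eg idem(1) s embed_le1(1)[OF inj(1) inj(1)]])
          (rule le1_trans[OF embed_le1(1)[OF inj(2) inj(2)] embed_le1(2)[OF inj_shift inj_shift]])
      moreover have "e n + ?s \<lesssim>\<^sub>1 g n" unfolding g_def
        by (rule orth_add_le1[OF idem(1) s eg embed_le1(2)[OF inj(1) inj(1)]])
          (rule le1_trans[OF embed_le1(1)[OF inj_shift inj_shift] embed_le1(2)[OF inj(2) inj(2)]])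
      moreover have "diag_sum m m (e n) (f n) \<lesssim>\<^sub>1 seq_sum k e f n" "seq_sum k e f n \<lesssim>\<^sub>1 diag_sum m m (e n) (f n)"
        by (rule diag_sum_le1 m kn le1_refl)+
      ultimately show ?thesis unfolding diag_sum_eq[OF m] by (blast intro: le1_trans)
    qed
    then show ?thesis unfolding seq_le_def by blast
  qed
  have mv: "mat_vec (embed_mat a b x) w i
      = (if i \<in> range a then mat_vec x (\<lambda>j. w (b j)) (inv_into UNIV a i) else 0)"
    if "inj b" "finite {i. w i \<noteq> 0}" for a b :: "nat \<Rightarrow> nat" and x and w :: "nat \<Rightarrow> 'a" and i
  proof -
    have "mat_vec (embed_mat a b x) w i = (\<Sum>k\<in>b ` {j. w (b j) \<noteq> 0}. entry (embed_mat a b x) i k * w k)"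
      unfolding mat_vec_def
      by (rule sum.mono_neutral_right) (use that in \<open>auto simp: embed_mat.rep_eq\<close>)
    also have "\<dots> = (\<Sum>j | w (b j) \<noteq> 0. entry (embed_mat a b x) i (b j) * w (b j))"
      by (rule sum.reindex_cong[of b]) (use that(1) in \<open>auto simp: inj_on_def\<close>)
    finally show ?thesis using that(1) by (simp add: embed_mat.rep_eq mat_vec_def)
  qed
  define glue :: "(nat \<Rightarrow> 'a) \<times> (nat \<Rightarrow> 'a) \<Rightarrow> nat \<Rightarrow> 'a"
    where "glue = (\<lambda>(v, w) i. if even i then v (i div 2) else w (i div 2))"
  define cut where "cut x = (\<lambda>i. x (\<sigma> i), \<lambda>i. x (\<tau> i))" for x :: "nat \<Rightarrow> 'a"
  have glue_cut: "glue (cut x) = x" for x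
    by (auto simp: glue_def cut_def \<sigma>_def \<tau>_def fun_eq_iff)
  have cut_glue: "cut (glue (v, w)) = (v, w)" for v w
    by (auto simp: glue_def cut_def \<sigma>_def \<tau>_def)
  have glue_sel: "glue (v, w) (\<sigma> i) = v i" "glue (v, w) (\<tau> i) = w i" for v w i
    using cut_glue[of v w] by (auto simp: cut_def dest: fun_cong)
  have fin_glue: "finite {i. glue (v, w) i \<noteq> 0}" if "finite {i. v i \<noteq> 0}" "finite {i. w i \<noteq> 0}" for v w
  proof (rule finite_subset)
    show "{i. glue (v, w) i \<noteq> 0} \<subseteq> \<sigma> ` {i. v i \<noteq> 0} \<union> \<tau> ` {i. w i \<noteq> 0}"
    proof
      fix i assume i: "i \<in> {i. glue (v, w) i \<noteq> 0}"
      show "i \<in> \<sigma> ` {i. v i \<noteq> 0} \<union> \<tau> ` {i. w i \<noteq> 0}"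
      proof (cases "even i")
        case True
        then have "i = \<sigma> (i div 2)" by (simp add: \<sigma>_def)
        then show ?thesis using i True by (auto simp: glue_def)
      next
        case False
        then have "i = \<tau> (i div 2)" by (simp add: \<tau>_def)
        then show ?thesis using i False by (auto simp: glue_def)
      qed
    qed
  qed (use that in simp)
  have fin_cut: "finite {i. x (\<sigma> i) \<noteq> 0}" "finite {i. x (\<tau> i) \<noteq> 0}"
    if "finite {i. x i \<noteq> 0}" for x :: "nat \<Rightarrow> 'a"
    using finite_vimageI[OF that inj(1)] finite_vimageI[OF that inj(2)] by (simp_all add: vimage_def)
  have g_glue: "mat_vec (g n) (glue (v, w)) = glue (mat_vec (e n) v, mat_vec (f n) w)"
    if vw: "finite {i. v i \<noteq> 0}" "finite {i. w i \<noteq> 0}" for n v w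
  proof
    fix i
    have "mat_vec (g n) (glue (v, w)) i =
        (if i \<in> range \<sigma> then mat_vec (e n) v (inv_into UNIV \<sigma> i) else 0) +
        (if i \<in> range \<tau> then mat_vec (f n) w (inv_into UNIV \<tau> i) else 0)"
      unfolding g_def mat_vec_plus mv[OF inj(1) fin_glue[OF vw]] mv[OF inj(2) fin_glue[OF vw]] glue_sel ..
    moreover have "(\<exists>j. i = \<sigma> j) \<or> (\<exists>j. i = \<tau> j)" by (auto simp: \<sigma>_def \<tau>_def) presburger
    ultimately show "mat_vec (g n) (glue (v, w)) i = glue (mat_vec (e n) v, mat_vec (f n) w) i"
      using disj inj by (auto simp: glue_sel)
  qed
  show "rmod_iso (direct_sum (chain_mod e) (chain_mod f)) (chain_mod g)"
  proof (rule rmod_isoI)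
    let ?D = "direct_sum (chain_mod e) (chain_mod f)"
    show "glue \<in> rhom ?D (chain_mod g)"
      unfolding rhom_def mem_Collect_eq
    proof (intro conjI ballI allI)
      show "glue \<in> carrier ?D \<rightarrow> carrier (chain_mod g)"
      proof
        fix p assume p: "p \<in> carrier ?D"
        obtain v w where vw: "p = (v, w)" "v \<in> carrier (chain_mod e)" "w \<in> carrier (chain_mod f)"
          using p by (auto simp: direct_sum_def)
        then obtain i j where ij: "mat_vec (e i) v = v" "mat_vec (f j) w = w" by (auto simp: chain_mod_sel)
        have fin: "finite {i. v i \<noteq> 0}" "finite {i. w i \<noteq> 0}" using vw by (simp_all add: chain_mod_sel)
        have "mat_vec (e (max i j)) v = v" by (rule idem_chain_fix[OF e fin(1) ij(1)]) simp
        moreover have "mat_vec (f (max i j)) w = w" by (rule idem_chain_fix[OF f fin(2) ij(2)]) simp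
        ultimately have "mat_vec (g (max i j)) (glue p) = glue p"
          unfolding vw(1) g_glue[OF fin] by simp
        then show "glue p \<in> carrier (chain_mod g)"
          using fin_glue[OF fin] vw(1) by (auto simp: chain_mod_sel)
      qed
    qed (auto simp: direct_sum_def chain_mod_sel glue_def fun_eq_iff split: prod.splits)
    show "cut \<in> rhom (chain_mod g) ?D"
      unfolding rhom_def mem_Collect_eq
    proof (intro conjI ballI allI)
      show "cut \<in> carrier (chain_mod g) \<rightarrow> carrier ?D"
      proof
        fix x assume "x \<in> carrier (chain_mod g)"
        then obtain n where x: "finite {i. x i \<noteq> 0}" "mat_vec (g n) x = x" by (auto simp: chain_mod_sel)
        obtain v w where vw: "cut x = (v, w)" by (rule prod.exhaust)
        then have fin: "finite {i. v i \<noteq> 0}" "finite {i. w i \<noteq> 0}"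
          using fin_cut[OF x(1)] by (auto simp: cut_def)
        have xg: "x = glue (v, w)" using glue_cut[of x] vw by simp
        have "glue (mat_vec (e n) v, mat_vec (f n) w) = glue (v, w)"
          using x(2) unfolding xg g_glue[OF fin] .
        then have "(mat_vec (e n) v, mat_vec (f n) w) = (v, w)"
          by (metis cut_glue)
        then show "cut x \<in> carrier ?D" using fin by (auto simp: vw direct_sum_def chain_mod_sel)
      qed
    qed (auto simp: direct_sum_def chain_mod_sel cut_def)
    show "cut (glue p) = p" for p by (cases p) (simp add: cut_glue)
    show "glue (cut x) = x" for x by (rule glue_cut)
  qed
qed

section \<open>Direct sums and their representing chains\<close>

lemma right_module_direct_sum:
  assumes "right_module M" "right_module N"
  shows "right_module (direct_sum M N)"
proof -
  interpret M: right_module M by fact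
  interpret N: right_module N by fact
  have "abelian_group (direct_sum M N)"
  proof (rule abelian_groupI)
    fix p assume "p \<in> carrier (direct_sum M N)"
    then obtain x y where p: "p = (x, y)" "x \<in> carrier M" "y \<in> carrier N"
      by (auto simp: direct_sum_def)
    then have "(\<ominus>\<^bsub>M\<^esub> x, \<ominus>\<^bsub>N\<^esub> y) \<in> carrier (direct_sum M N)"
      "(\<ominus>\<^bsub>M\<^esub> x, \<ominus>\<^bsub>N\<^esub> y) \<oplus>\<^bsub>direct_sum M N\<^esub> p = \<zero>\<^bsub>direct_sum M N\<^esub>"
      by (simp_all add: direct_sum_def M.l_neg N.l_neg)
    then show "\<exists>q\<in>carrier (direct_sum M N). q \<oplus>\<^bsub>direct_sum M N\<^esub> p = \<zero>\<^bsub>direct_sum M N\<^esub>" by blast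
  qed (auto simp: direct_sum_def M.a_assoc N.a_assoc intro: M.a_comm N.a_comm)
  then show ?thesis
    unfolding right_module_def right_module_axioms_def
    by (auto simp: direct_sum_def M.ract_add_left M.ract_add_right M.ract_mult
        N.ract_add_left N.ract_add_right N.ract_mult)
qed

lemma rmod_iso_direct_sum:
  assumes "rmod_iso M M'" "rmod_iso N N'"
  shows "rmod_iso (direct_sum M N) (direct_sum M' N')"
proof -
  obtain f where f: "f \<in> rhom M M'" "bij_betw f (carrier M) (carrier M')"
    using assms(1) unfolding rmod_iso_def by blast
  obtain g where g: "g \<in> rhom N N'" "bij_betw g (carrier N) (carrier N')"
    using assms(2) unfolding rmod_iso_def by blast
  have "map_prod f g \<in> rhom (direct_sum M N) (direct_sum M' N')"
    using rhom_closed[OF f(1)] rhom_closed[OF g(1)] rhom_add[OF f(1)] rhom_add[OF g(1)]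
      rhom_ract[OF f(1)] rhom_ract[OF g(1)]
    unfolding rhom_def[of "direct_sum M N"] by (auto simp: direct_sum_def)
  moreover have "bij_betw (map_prod f g) (carrier (direct_sum M N)) (carrier (direct_sum M' N'))"
    using bij_betw_map_prod[OF f(2) g(2)] by (simp add: direct_sum_def)
  ultimately show ?thesis unfolding rmod_iso_def by blast
qed

lemma direct_sum_represents:
  assumes "represents e P" "represents f Q"
  shows "\<exists>g. represents g (direct_sum P Q) \<and>
    (\<forall>k. sized k e \<longrightarrow> seq_le g (seq_sum k e f) \<and> seq_le (seq_sum k e f) g)"
proof -
  have e: "idem_chain e" "right_module P" "rmod_iso P (chain_mod e)"
    and f: "idem_chain f" "right_module Q" "rmod_iso Q (chain_mod f)"
    using assms by (simp_all add: represents_def)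
  note g = direct_sum_chain_mod[OF e(1) f(1)]
  show ?thesis
    unfolding represents_def
    using g right_module_direct_sum[OF e(2) f(2)]
      rmod_iso_trans[OF rmod_iso_direct_sum[OF e(3) f(3)] g(2)] by blast
qed

text \<open>The comparison passes through block sums, where monotonicity is
  \<open>seq_sum_le\<close>. The chains \<open>g\<close> and \<open>g'\<close> are arbitrary, since
  two chains representing the same module are comparable.\<close>

lemma direct_sum_represents_le:
  fixes P :: "('a::{ring,monoid_mult}, 'p) rmod" and P' :: "('a, 'q) rmod"
  assumes "represents e P" "represents f Q" "represents e' P'" "represents f' Q'"
    and "seq_le e e'" "seq_le f f'"
    and g: "represents g (direct_sum P Q)" and g': "represents g' (direct_sum P' Q')"
  shows "seq_le g g'"
proof -
  have T: "e \<in> T_seqs" "e' \<in> T_seqs" "f' \<in> T_seqs"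
    using assms by (simp_all add: represents_def idem_chain_T_seqs)
  obtain k where k: "sized k e" using sized_exists[OF T(1)] by blast
  obtain k' where k': "sized k' e'" using sized_exists[OF T(2)] by blast
  obtain h where h: "represents h (direct_sum P Q)" "seq_le h (seq_sum k e f)"
    using direct_sum_represents[OF assms(1,2)] k by blast
  obtain h' where h': "represents h' (direct_sum P' Q')" "seq_le (seq_sum k' e' f') h'"
    using direct_sum_represents[OF assms(3,4)] k' by blast
  have "seq_le g h" "seq_le h' g'"
    using represents_cp_le[OF g h(1)] represents_cp_le[OF h'(1) g'] g g'
    by (simp_all add: represents_def cp_le_refl)
  moreover have "seq_le (seq_sum k e f) (seq_sum k' e' f')"
    by (rule seq_sum_le[OF k k' T(3) assms(5,6)])
  ultimately show ?thesis using h(2) h'(2) by (blast intro: seq_le_trans)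
qed

section \<open>Every countably generated projective module is represented by a chain\<close>

context
  assumes ur: "unit_regular TYPE('a::{ring,monoid_mult})"
begin

text \<open>One step in exhausting a submodule of columns by idempotents. The part \<open>w'\<close>
  of \<open>w\<close> outside the image of \<open>e\<close> is turned into a one-column matrix
  \<open>a\<close>; regularity yields an idempotent \<open>f = a * z\<close> whose image is
  generated by \<open>w'\<close>.\<close>

lemma idem_absorb_vector:
  fixes e :: "'a minf"
  assumes e: "e * e = e" and X: "rsubmodule columns X"
    and eX: "\<And>v. finite {i. v i \<noteq> 0} \<Longrightarrow> mat_vec e v \<in> X" and w: "w \<in> X"
  shows "\<exists>g. g * g = g \<and> idem_le e g \<and> mat_vec g w = w \<and> (\<forall>v. finite {i. v i \<noteq> 0} \<longrightarrow> mat_vec g v \<in> X)"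
proof -
  have Xfin: "finite {i. v i \<noteq> 0}" if "v \<in> X" for v
    using that X by (auto simp: rsubmodule_def free_rmod_def)
  have Xadd: "(\<lambda>i. v i + v' i) \<in> X" if "v \<in> X" "v' \<in> X" for v v'
    using that X by (auto simp: rsubmodule_def free_sel)
  have Xscale: "(\<lambda>i. v i * r) \<in> X" if "v \<in> X" for v r
    using that X by (auto simp: rsubmodule_def free_sel)
  \<comment> \<open>This is \<open>w\<close> minus its image under \<open>e\<close>, written with
    the scalar \<open>- 1\<close> so that closure of \<open>X\<close> under sums and scalars
    applies.\<close>
  define w' where "w' = (\<lambda>i. w i + mat_vec e w i * (- 1))"
  have w': "w' \<in> X" unfolding w'_def by (rule Xadd[OF w Xscale[OF eX[OF Xfin[OF w]]]])
  define a where "a = of_cols 1 (\<lambda>_. w')"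
  have a_std: "mat_vec a (std 0) = w'" unfolding a_def by (rule of_cols_std[OF Xfin[OF w']]) simp
  have a_vec: "mat_vec a v = (\<lambda>i. w' i * v 0)" if "finite {i. v i \<noteq> 0}" for v
  proof
    fix i
    have "mat_vec a v i = (\<Sum>k\<in>insert 0 {k. v k \<noteq> 0}. entry a i k * v k)"
      by (rule mat_vec_superset) (use that in auto)
    also have "\<dots> = (\<Sum>k\<in>{0}. entry a i k * v k)"
      by (rule sum.mono_neutral_right) (use that in \<open>auto simp: a_def of_cols.rep_eq\<close>)
    finally show "mat_vec a v i = w' i * v 0" by (simp add: a_def of_cols.rep_eq Xfin[OF w'])
  qed
  have ew': "mat_vec e w' = (\<lambda>_. 0)"
  proof -
    have "mat_vec e (mat_vec e w) = mat_vec e w" using e Xfin[OF w] by (simp flip: mat_vec_mult)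
    then show ?thesis
      unfolding w'_def mat_vec_add[OF Xfin[OF w] finite_scale[OF mat_vec_finite]]
        mat_vec_scale[OF mat_vec_finite] by simp
  qed
  obtain s where s: "a \<in> mats s s" using ex_mats by blast
  then have a1: "a \<in> mats s 1" by (auto simp: mats_def a_def of_cols.rep_eq split: if_splits)
  have ea: "e * a = 0"
  proof -
    obtain t where t: "e \<in> mats t t" using ex_mats by blast
    show ?thesis
    proof (rule mats_eqI)
      show "e * a \<in> mats t 1" by (rule mats_mult[OF t a1])
      show "0 \<in> mats t 1" by (simp add: mats_def zero_minf.rep_eq)
      fix j :: nat assume "j < 1"
      then show "mat_vec (e * a) (std j) = mat_vec 0 (std j)"
        by (simp add: mat_vec_mult a_std ew')
    qed
  qed
  obtain z where z: "a * z * a = a" using regular[OF ur, of a] by metis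
  let ?f = "a * z"
  have f: "?f * ?f = ?f"
  proof -
    have "?f * ?f = (a * z * a) * z" by (simp only: mult.assoc)
    then show ?thesis by (simp only: z)
  qed
  have ef: "e * ?f = 0" using ea by (simp flip: mult.assoc)
  then have ef': "e * (?f * x) = 0" for x by (simp flip: mult.assoc)
  have ff: "?f * (?f * x) = ?f * x" for x using f by (simp flip: mult.assoc)
  have ee: "e * (e * x) = e * x" for x using e by (simp flip: mult.assoc)
  define f where "f = a * z"
  note fs = f[folded f_def] ef[folded f_def] ef'[folded f_def] ff[folded f_def] ee
  have fw': "mat_vec f w' = w'"
  proof -
    have "mat_vec (f * a) (std 0) = mat_vec a (std 0)" by (simp add: f_def z)
    then show ?thesis by (simp add: mat_vec_mult a_std)
  qed
  have fX: "mat_vec f v \<in> X" if "finite {i. v i \<noteq> 0}" for v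
    using that Xscale[OF w'] by (simp add: f_def mat_vec_mult a_vec)
  \<comment> \<open>Here \<open>e * f = 0\<close>, but \<open>f * e\<close> need not vanish. The
    correction amounts to \<open>e + f * (1 - e)\<close> in a ring without identity; it keeps the
    image inside \<open>X\<close> and still fixes \<open>w\<close>.\<close>
  let ?g = "e + f - f * e"
  have g: "?g * ?g = ?g" "idem_le e ?g"
    by (simp_all add: idem_le_def algebra_simps fs e)
  have g_vec: "mat_vec ?g v = (\<lambda>i. mat_vec e v i + mat_vec f (\<lambda>i. v i + mat_vec e v i * (- 1)) i)"
    if v: "finite {i. v i \<noteq> 0}" for v
    unfolding mat_vec_add[OF v finite_scale[OF mat_vec_finite]] mat_vec_scale[OF mat_vec_finite]
      mat_vec_diff mat_vec_plus mat_vec_mult[OF v] by (simp add: algebra_simps)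
  have "mat_vec ?g w = w"
    unfolding g_vec[OF Xfin[OF w]] w'_def[symmetric] fw' by (simp add: w'_def)
  moreover have "mat_vec ?g v \<in> X" if v: "finite {i. v i \<noteq> 0}" for v
    unfolding g_vec[OF v]
    by (intro Xadd eX fX finite_add finite_scale mat_vec_finite v)
  ultimately show ?thesis using g by blast
qed

text \<open>Projectivity splits the surjection from \<open>columns\<close> onto \<open>P\<close>,
  which identifies \<open>P\<close> with the submodule \<open>?X\<close>. Absorbing the images of
  the countably many generators one after another gives a chain whose images exhaust
  \<open>?X\<close>.\<close>

lemma cg_projective_represents:
  fixes P :: "('a, 'p) rmod"
  assumes "P \<in> cg_projective"
  shows "\<exists>e. represents e P"
proof -
  have P: "right_module P" "countably_generated P" "projective P"
    using assms by (simp_all add: cg_projective_def)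
  interpret P: right_module P by fact
  obtain S where S: "countable S" "S \<subseteq> carrier P" "carrier P = rspan P S"
    using P(2) unfolding countably_generated_def by blast
  define b where "b = from_nat_into (insert \<zero>\<^bsub>P\<^esub> S)"
  have rb: "range b = insert \<zero>\<^bsub>P\<^esub> S"
    unfolding b_def using S(1) by (intro range_from_nat_into) auto
  have b: "b i \<in> carrier P" for i
    using rb S(2) P.zero_closed by (metis insert_iff rangeI subsetD)
  have lin: "P.lin b \<in> rhom columns P" by (rule P.lin_rhom) (use b in auto)
  have lin_std: "P.lin b (std i) = b i" for i by (rule P.lin_single) (rule b)
  have surj: "P.lin b ` carrier columns = carrier P"
  proof
    show "P.lin b ` carrier columns \<subseteq> carrier P" using lin by (auto simp: rhom_def)
    have "x \<in> P.lin b ` carrier columns" if "x \<in> S" for x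
    proof -
      have "x \<in> range b" using that rb by blast
      then obtain i where "x = b i" by (rule rangeE)
      then have "x = P.lin b (std i)" using lin_std[of i] by simp
      then show ?thesis using imageI[OF std_closed[of i UNIV], of "P.lin b"] by simp
    qed
    then show "carrier P \<subseteq> P.lin b ` carrier columns"
      unfolding S(3) by (intro rspan_least rsubmodule_image[OF right_module_free P(1) lin]) blast
  qed
  have "(\<lambda>x. x) \<in> rhom P P" by (simp add: rhom_def)
  from projective_lift[OF P(1,3) right_module_free P(1) lin surj this]
  obtain s where s: "s \<in> rhom P columns" "\<And>x. x \<in> carrier P \<Longrightarrow> P.lin b (s x) = x" by blast
  let ?X = "s ` carrier P"
  have X: "rsubmodule columns ?X" by (rule rsubmodule_image[OF P(1) right_module_free s(1)])
  have Xfin: "finite {i. v i \<noteq> 0}" if "v \<in> ?X" for v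
    using that X by (auto simp: rsubmodule_def free_rmod_def)
  let ?P = "\<lambda>n e. e * e = e \<and> (\<forall>v. finite {i. v i \<noteq> 0} \<longrightarrow> mat_vec e v \<in> ?X)"
  have "\<exists>e. \<forall>n. ?P n (e n) \<and> (idem_le (e n) (e (Suc n)) \<and> mat_vec (e (Suc n)) (s (b n)) = s (b n))"
  proof (rule dependent_nat_choice)
    have "(\<lambda>_. 0) \<in> ?X" using X by (simp add: rsubmodule_def free_sel)
    then show "\<exists>e. ?P 0 e" by (intro exI[of _ 0]) simp
  next
    fix e n assume "?P n e"
    then show "\<exists>e'. ?P (Suc n) e' \<and> (idem_le e e' \<and> mat_vec e' (s (b n)) = s (b n))"
      using idem_absorb_vector[OF _ X, of e "s (b n)"] b[of n] by blast
  qed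
  then obtain e where "\<forall>n. ?P n (e n) \<and> (idem_le (e n) (e (Suc n)) \<and> mat_vec (e (Suc n)) (s (b n)) = s (b n))" ..
  then have idem: "e n * e n = e n" and eX: "finite {i. v i \<noteq> 0} \<Longrightarrow> mat_vec (e n) v \<in> ?X"
    and le: "idem_le (e n) (e (Suc n))" and fix_b: "mat_vec (e (Suc n)) (s (b n)) = s (b n)" for n v
    by blast+
  have e: "idem_chain e" using idem le by (intro idem_chainI) (auto simp: idem_le_def)
  have "carrier (chain_mod e) = ?X"
  proof (intro equalityI subsetI)
    fix v assume "v \<in> carrier (chain_mod e)"
    then obtain n where "finite {i. v i \<noteq> 0}" "mat_vec (e n) v = v" by (auto simp: chain_mod_sel)
    then show "v \<in> ?X" using eX[of v n] by simp
  next
    fix v assume "v \<in> ?X"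
    then obtain x where x: "x \<in> carrier P" "v = s x" by blast
    \<comment> \<open>The vector \<open>s x\<close> equals \<open>s (P.lin b (s x))\<close>, a
      combination of the vectors \<open>s (b j)\<close>, each fixed by
      \<open>e (Suc j)\<close>.\<close>
    have "s (P.lin b (s x)) \<in> carrier (chain_mod e)"
    proof (rule rhom_free_submodule[OF right_module_free rhom_comp[OF lin s(1)] right_module_chain(1)[OF e]])
      show "s (P.lin b (std j)) \<in> carrier (chain_mod e)" for j
        unfolding lin_std using fix_b[of j] Xfin b[of j] by (auto simp: chain_mod_sel)
      show "s x \<in> carrier columns" by (rule rhom_closed[OF s(1) x(1)])
    qed
    then show "v \<in> carrier (chain_mod e)" using s(2)[OF x(1)] x(2) by simp
  qed
  then have "s ` carrier P = carrier (chain_mod e)" "inj_on s (carrier P)"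
    using inj_on_inverseI[of "carrier P" "P.lin b" s] s(2) by simp_all
  then have bij: "bij_betw s (carrier P) (carrier (chain_mod e))" by (simp add: bij_betw_def)
  have "s \<in> rhom P (chain_mod e)"
    using s(1) \<open>s ` carrier P = carrier (chain_mod e)\<close>
    by (auto simp: rhom_def chain_mod_sel(2,3) free_sel)
  then have "represents e P" using e P(1) bij unfolding represents_def rmod_iso_def by blast
  then show ?thesis by (rule exI[of "\<lambda>e. represents e P"])
qed

lemma represents_iso:
  fixes P :: "('a, 'p) rmod" and Q :: "('a, 'q) rmod"
  assumes eP: "represents e P" and fQ: "represents f Q"
  shows "rmod_iso P Q \<longleftrightarrow> seq_le e f \<and> seq_le f e"
proof
  have e: "idem_chain e" "right_module P" "rmod_iso P (chain_mod e)"
    and f: "idem_chain f" "right_module Q" "rmod_iso Q (chain_mod f)"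
    using eP fQ by (simp_all add: represents_def)
  show "seq_le e f \<and> seq_le f e" if "rmod_iso P Q"
  proof -
    have "represents f P" using e(2) f(1) rmod_iso_trans[OF that f(3)] by (simp add: represents_def)
    then show ?thesis
      using represents_cp_le[OF eP] represents_cp_le[OF _ eP] cp_le_refl[OF e(2)] by blast
  qed
  show "rmod_iso P Q" if "seq_le e f \<and> seq_le f e"
    using rmod_iso_trans[OF rmod_iso_trans[OF e(3) chain_mod_back_and_forth[OF ur e(1) f(1)]]
        rmod_iso_sym[OF f(2,3)]] that by blast
qed

text \<open>From left to right the embedding is transported to an injective homomorphism of chain
  modules. For the converse, the subchain obtained from \<open>chain_mod_embed\<close> is carried
  into \<open>Q\<close>.\<close>

lemma represents_embed:
  fixes P :: "('a, 'p) rmod" and Q :: "('a, 'q) rmod"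
  assumes eP: "represents e P" and fQ: "represents f Q"
  shows "(\<exists>X. rsubmodule Q X \<and> rmod_iso P (Q\<lparr>carrier := X\<rparr>)) \<longleftrightarrow> seq_le e f"
proof
  have e: "idem_chain e" "right_module P" "rmod_iso P (chain_mod e)"
    and f: "idem_chain f" "right_module Q" "rmod_iso Q (chain_mod f)"
    using eP fQ by (simp_all add: represents_def)
  obtain h' where h': "h' \<in> rhom (chain_mod f) Q" "bij_betw h' (carrier (chain_mod f)) (carrier Q)"
    using rmod_iso_sym[OF f(2,3)] unfolding rmod_iso_def by blast
  show "seq_le e f" if ex: "\<exists>X. rsubmodule Q X \<and> rmod_iso P (Q\<lparr>carrier := X\<rparr>)"
  proof -
    obtain X where X: "rsubmodule Q X" "rmod_iso P (Q\<lparr>carrier := X\<rparr>)" using ex by blast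
    obtain h where h: "h \<in> rhom (chain_mod e) (Q\<lparr>carrier := X\<rparr>)" "inj_on h (carrier (chain_mod e))"
      using rmod_iso_trans[OF rmod_iso_sym[OF e(2,3)] X(2)] unfolding rmod_iso_def bij_betw_def by blast
    obtain k where k: "k \<in> rhom Q (chain_mod f)" "inj_on k (carrier Q)"
      using f(3) unfolding rmod_iso_def bij_betw_def by blast
    have "h \<in> rhom (chain_mod e) Q" using h(1) X(1) by (auto simp: rhom_def rsubmodule_def)
    then have "(\<lambda>x. k (h x)) \<in> rhom (chain_mod e) (chain_mod f)" by (rule rhom_comp[OF _ k(1)])
    moreover have "inj_on (\<lambda>x. k (h x)) (carrier (chain_mod e))"
    proof (rule inj_onI)
      fix x y assume xy: "x \<in> carrier (chain_mod e)" "y \<in> carrier (chain_mod e)" "k (h x) = k (h y)"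
      have "h x = h y"
        by (rule inj_onD[OF k(2) xy(3)]) (rule rhom_closed[OF \<open>h \<in> rhom (chain_mod e) Q\<close>], rule xy)+
      then show "x = y" by (rule inj_onD[OF h(2) _ xy(1,2)])
    qed
    ultimately show ?thesis by (rule chain_mod_injective_le[OF ur e(1) f(1)])
  qed
  show "\<exists>X. rsubmodule Q X \<and> rmod_iso P (Q\<lparr>carrier := X\<rparr>)" if le: "seq_le e f"
  proof -
    obtain q where q: "idem_chain q" "rmod_iso (chain_mod e) (chain_mod q)"
      "carrier (chain_mod q) \<subseteq> carrier (chain_mod f)"
      using chain_mod_embed[OF ur e(1) f(1) le] by blast
    let ?X = "h' ` carrier (chain_mod q)"
    have "chain_mod q = (chain_mod f)\<lparr>carrier := carrier (chain_mod q)\<rparr>" by (simp add: chain_mod_def)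
    then have h'q: "h' \<in> rhom (chain_mod q) Q" using rhom_restrict[OF h'(1) q(3)] by simp
    have X: "rsubmodule Q ?X" by (rule rsubmodule_image[OF right_module_chain(2)[OF q(1)] f(2) h'q])
    have "h' \<in> rhom (chain_mod q) (Q\<lparr>carrier := ?X\<rparr>)" using h'q by (auto simp: rhom_def)
    moreover have "bij_betw h' (carrier (chain_mod q)) (carrier (Q\<lparr>carrier := ?X\<rparr>))"
      using inj_on_subset[OF bij_betw_imp_inj_on[OF h'(2)] q(3)] by (simp add: bij_betw_def)
    ultimately have "rmod_iso (chain_mod q) (Q\<lparr>carrier := ?X\<rparr>)" unfolding rmod_iso_def by blast
    then show ?thesis using X rmod_iso_trans[OF rmod_iso_trans[OF e(3) q(2)]] by blast
  qed
qed


section \<open>The monoids of module classes\<close>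

text \<open>Transitivity of the comparison of modules is inherited from \<open>seq_le\<close>
  through representing chains.\<close>

lemma equiv_CP: "equiv cg_projective (CP_rel :: (('a, nat \<Rightarrow> 'a) rmod \<times> _) set)"
  unfolding CP_rel_def
proof (rule equiv_antisymmetrization)
  show "P \<lesssim>\<^sub>C\<^sub>P P" if "P \<in> cg_projective" for P :: "('a, nat \<Rightarrow> 'a) rmod"
    using that by (simp add: cg_projective_def cp_le_refl)
  fix P Q U :: "('a, nat \<Rightarrow> 'a) rmod"
  assume PQU: "P \<in> cg_projective" "Q \<in> cg_projective" "U \<in> cg_projective" "P \<lesssim>\<^sub>C\<^sub>P Q" "Q \<lesssim>\<^sub>C\<^sub>P U"
  obtain e f g where "represents e P" "represents f Q" "represents g U"
    using PQU(1-3) cg_projective_represents by metis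
  then show "P \<lesssim>\<^sub>C\<^sub>P U" using PQU(4,5) by (simp add: represents_cp_le) (blast intro: seq_le_trans)
qed

lemma CP_rel_iff:
  fixes P Q :: "('a, nat \<Rightarrow> 'a) rmod"
  assumes "represents e P" "represents f Q" "P \<in> cg_projective" "Q \<in> cg_projective"
  shows "(P, Q) \<in> CP_rel \<longleftrightarrow> seq_le e f \<and> seq_le f e"
  using assms by (simp add: CP_rel_def antisymmetrization_def represents_cp_le)

text \<open>Both relations translate into mutual \<open>seq_le\<close> of representing chains, by
  \<open>represents_iso\<close> and \<open>represents_cp_le\<close>.\<close>

lemma Vstar_rel_eq: "Vstar_rel = (CP_rel :: (('a, nat \<Rightarrow> 'a) rmod \<times> _) set)"
proof -
  have "(P, Q) \<in> Vstar_rel \<longleftrightarrow> (P, Q) \<in> CP_rel"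
    if PQ: "P \<in> cg_projective" "Q \<in> cg_projective" for P Q :: "('a, nat \<Rightarrow> 'a) rmod"
  proof -
    obtain e f where ef: "represents e P" "represents f Q" using PQ cg_projective_represents by metis
    show ?thesis unfolding CP_rel_iff[OF ef PQ] using PQ by (simp add: Vstar_rel_def represents_iso[OF ef])
  qed
  then show ?thesis by (auto simp: Vstar_rel_def CP_rel_def antisymmetrization_def)
qed

abbreviation CP_class :: "('a, nat \<Rightarrow> 'a) rmod \<Rightarrow> ('a, nat \<Rightarrow> 'a) rmod set" where
  "CP_class P \<equiv> CP_rel `` {P}"

lemma CP_classE:
  fixes X :: "('a, nat \<Rightarrow> 'a) rmod set"
  assumes "X \<in> carrier CP_monoid"
  obtains P e where "P \<in> cg_projective" "represents e P" "X = CP_class P"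
proof -
  obtain P where "P \<in> cg_projective" "X = CP_class P"
    using assms unfolding CP_monoid_def quotient_def by auto
  moreover from this obtain e where "represents e P" using cg_projective_represents by blast
  ultimately show thesis using that by blast
qed

lemma CP_class_mem:
  fixes P Q :: "('a, nat \<Rightarrow> 'a) rmod"
  assumes "represents e P" "P \<in> cg_projective" "Q \<in> CP_class P"
  shows "Q \<in> cg_projective" "\<exists>f. represents f Q \<and> seq_le e f \<and> seq_le f e"
proof -
  show Q: "Q \<in> cg_projective" using assms(3) by (simp add: CP_rel_def antisymmetrization_def)
  obtain f where "represents f Q" using cg_projective_represents[OF Q] by blast
  then show "\<exists>f. represents f Q \<and> seq_le e f \<and> seq_le f e"
    using CP_rel_iff[OF assms(1) _ assms(2) Q] assms(3) by auto
qed

text \<open>The module \<open>direct_sum P Q\<close> lives on a product type and cannot be a member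
  of a class; the sum is therefore named through the chain module of a representing chain.\<close>

lemma CP_mult:
  fixes P Q :: "('a, nat \<Rightarrow> 'a) rmod"
  assumes e: "represents e P" "P \<in> cg_projective" and f: "represents f Q" "Q \<in> cg_projective"
    and g: "represents g (direct_sum P Q)"
  shows "CP_class P \<otimes>\<^bsub>CP_monoid\<^esub> CP_class Q = CP_class (chain_mod g)"
proof -
  have gc: "represents g (chain_mod g)" "chain_mod g \<in> cg_projective"
    using g by (simp_all add: represents_def represents_chain_mod[unfolded represents_def]
        chain_mod_cg_projective)
  have self: "P \<in> CP_class P" "Q \<in> CP_class Q"
    using equiv_class_self[OF equiv_CP] e f by blast+
  have "CP_class P \<otimes>\<^bsub>CP_monoid\<^esub> CP_class Q = {U \<in> cg_projective. \<exists>P'\<in>CP_class P. \<exists>Q'\<in>CP_class Q.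
      U \<lesssim>\<^sub>C\<^sub>P direct_sum P' Q' \<and> direct_sum P' Q' \<lesssim>\<^sub>C\<^sub>P U}" by (simp add: CP_monoid_def)
  also have "\<dots> = CP_class (chain_mod g)"
  proof (intro equalityI subsetI)
    fix U :: "('a, nat \<Rightarrow> 'a) rmod" assume "U \<in> {U \<in> cg_projective. \<exists>P'\<in>CP_class P. \<exists>Q'\<in>CP_class Q.
      U \<lesssim>\<^sub>C\<^sub>P direct_sum P' Q' \<and> direct_sum P' Q' \<lesssim>\<^sub>C\<^sub>P U}"
    then obtain P' Q' where U: "U \<in> cg_projective" "P' \<in> CP_class P" "Q' \<in> CP_class Q"
      "U \<lesssim>\<^sub>C\<^sub>P direct_sum P' Q'" "direct_sum P' Q' \<lesssim>\<^sub>C\<^sub>P U" by blast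
    obtain u where u: "represents u U" using cg_projective_represents[OF U(1)] by blast
    obtain e' where e': "represents e' P'" "seq_le e e'" "seq_le e' e" using CP_class_mem(2)[OF e U(2)] by blast
    obtain f' where f': "represents f' Q'" "seq_le f f'" "seq_le f' f" using CP_class_mem(2)[OF f U(3)] by blast
    obtain g' where g': "represents g' (direct_sum P' Q')" using direct_sum_represents[OF e'(1) f'(1)] by blast
    have "seq_le g g'" by (rule direct_sum_represents_le[OF e(1) f(1) e'(1) f'(1) e'(2) f'(2) g g'])
    moreover have "seq_le g' g" by (rule direct_sum_represents_le[OF e'(1) f'(1) e(1) f(1) e'(3) f'(3) g' g])
    moreover have "seq_le u g'" "seq_le g' u"
      using U(4,5) represents_cp_le[OF u g'] represents_cp_le[OF g' u] by blast+
    ultimately have "seq_le g u" "seq_le u g" by (blast intro: seq_le_trans)+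
    then show "U \<in> CP_class (chain_mod g)" using CP_rel_iff[OF gc(1) u gc(2) U(1)] by simp
  next
    fix U assume U: "U \<in> CP_class (chain_mod g)"
    obtain u where u: "U \<in> cg_projective" "represents u U" "seq_le g u" "seq_le u g"
      using CP_class_mem[OF gc U] by blast
    then have "U \<lesssim>\<^sub>C\<^sub>P direct_sum P Q" "direct_sum P Q \<lesssim>\<^sub>C\<^sub>P U"
      using represents_cp_le[OF u(2) g] represents_cp_le[OF g u(2)] by blast+
    then show "U \<in> {U \<in> cg_projective. \<exists>P'\<in>CP_class P. \<exists>Q'\<in>CP_class Q.
      U \<lesssim>\<^sub>C\<^sub>P direct_sum P' Q' \<and> direct_sum P' Q' \<lesssim>\<^sub>C\<^sub>P U}" using u(1) self by blast
  qed
  finally show ?thesis .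
qed

text \<open>The classes coincide, so the natural map is the identity. What remains is that the
  conditions defining the two sums agree although direct sums have another type; representing chains
  settle this.\<close>

lemma Vstar_CP_iso:
  "(\<lambda>X. CP_rel `` X) \<in> iso (Vstar_monoid :: ('a, nat \<Rightarrow> 'a) rmod set monoid) CP_monoid"
  unfolding iso_def hom_def mem_Collect_eq
proof (intro conjI ballI)
  let ?V = "Vstar_monoid :: ('a, nat \<Rightarrow> 'a) rmod set monoid"
    and ?C = "CP_monoid :: ('a, nat \<Rightarrow> 'a) rmod set ordered_monoid"
  have car: "carrier ?V = carrier ?C" by (simp add: Vstar_monoid_def CP_monoid_def Vstar_rel_eq)
  have id: "CP_rel `` X = X" if X: "X \<in> carrier ?C" for X
  proof -
    obtain P where P: "P \<in> cg_projective" "X = CP_class P" using CP_classE[OF X] by blast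
    have "(P, P) \<in> CP_rel" using equiv_class_self[OF equiv_CP P(1)] by simp
    then show ?thesis unfolding P(2) by (intro equiv_class_image[OF equiv_CP]) auto
  qed
  show "(\<lambda>X. CP_rel `` X) \<in> carrier ?V \<rightarrow> carrier ?C" by (auto simp: car id)
  show "bij_betw (\<lambda>X. CP_rel `` X) (carrier ?V) (carrier ?C)"
    unfolding car by (rule bij_betw_byWitness[where f' = "\<lambda>X. X"]) (auto simp: id)
  fix X Y assume XY: "X \<in> carrier ?V" "Y \<in> carrier ?V"
  obtain P e where P: "P \<in> cg_projective" "represents e P" "X = CP_class P"
    using CP_classE[of X] XY(1) unfolding car by blast
  obtain Q f where Q: "Q \<in> cg_projective" "represents f Q" "Y = CP_class Q"
    using CP_classE[of Y] XY(2) unfolding car by blast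
  obtain g where g: "represents g (direct_sum P Q)" using direct_sum_represents[OF P(2) Q(2)] by blast
  have iso: "rmod_iso U (direct_sum P' Q') \<longleftrightarrow> U \<lesssim>\<^sub>C\<^sub>P direct_sum P' Q' \<and> direct_sum P' Q' \<lesssim>\<^sub>C\<^sub>P U"
    if mem: "U \<in> cg_projective" "P' \<in> X" "Q' \<in> Y" for U P' Q'
  proof -
    obtain u where u: "represents u U" using cg_projective_represents[OF mem(1)] by blast
    obtain e' where e': "represents e' P'" using CP_class_mem(2)[OF P(2,1)] mem(2) P(3) by blast
    obtain f' where f': "represents f' Q'" using CP_class_mem(2)[OF Q(2,1)] mem(3) Q(3) by blast
    obtain g' where g': "represents g' (direct_sum P' Q')" using direct_sum_represents[OF e' f'] by blast
    show ?thesis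
      unfolding represents_iso[OF u g'] represents_cp_le[OF u g'] represents_cp_le[OF g' u] ..
  qed
  have "X \<otimes>\<^bsub>?V\<^esub> Y = X \<otimes>\<^bsub>?C\<^esub> Y" 
    by (simp add: Vstar_monoid_def CP_monoid_def) (intro Collect_cong conj_cong bex_cong refl iso)
  moreover have "X \<otimes>\<^bsub>?C\<^esub> Y = CP_class (chain_mod g)"
    unfolding P(3) Q(3) by (rule CP_mult[OF P(2,1) Q(2,1) g])
  moreover have "CP_class (chain_mod g) \<in> carrier ?C"
    using g by (auto simp: CP_monoid_def represents_def intro!: quotientI chain_mod_cg_projective)
  ultimately show "CP_rel `` (X \<otimes>\<^bsub>?V\<^esub> Y) = CP_rel `` X \<otimes>\<^bsub>?C\<^esub> CP_rel `` Y"
    using XY unfolding car by (simp add: id)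
qed

text \<open>Two presentations of one module compare in both directions by reflexivity of the
  comparison, so the union runs over a single class.\<close>

lemma CP_to_S_class:
  fixes P :: "('a, nat \<Rightarrow> 'a) rmod"
  assumes e: "represents e P" "P \<in> cg_projective"
  shows "CP_to_S (CP_class P) = Lambda_class e"
proof -
  let ?S = "{Lambda_class x | P' n x. P' \<in> CP_class P \<and> split_system n x \<and> is_limit_of P' n x}"
  have "CP_to_S (CP_class P) = \<Union>?S" by (simp add: CP_to_S_def split_system_def)
  also have "\<dots> = Lambda_class e"
  proof (rule Union_eqI)
    obtain n where "split_system n e" "is_limit_of P n e" using represents_limit[OF e(1)] by blast
    moreover have "P \<in> CP_class P" by (rule equiv_class_self[OF equiv_CP e(2)])
    ultimately have "Lambda_class e \<in> ?S" by blast
    then show "?S \<noteq> {}" by blast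
  next
    fix X assume "X \<in> ?S"
    then obtain P' n x where X: "X = Lambda_class x" and P': "P' \<in> CP_class P"
      and x: "split_system n x" "is_limit_of P' n x" by blast
    obtain e' where e': "represents e' P'" "seq_le e e'" "seq_le e' e" using CP_class_mem(2)[OF e P'] by blast
    obtain n' where n': "split_system n' e'" "is_limit_of P' n' e'" using represents_limit[OF e'(1)] by blast
    have P'r: "P' \<lesssim>\<^sub>C\<^sub>P P'" using e'(1) by (simp add: represents_def cp_le_refl)
    have "seq_le x e'" by (rule represents_limit_equiv[OF e'(1) e'(1) P'r x n'])
    moreover have "seq_le e' x" by (rule represents_limit_equiv[OF e'(1) e'(1) P'r n' x])
    ultimately have "seq_le x e" "seq_le e x" using e'(2,3) by (blast intro: seq_le_trans)+
    moreover have "x \<in> T_seqs" by (rule split_system_T_seqs[OF x(1)])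
    moreover have "e \<in> T_seqs" using e(1) by (simp add: represents_def idem_chain_T_seqs)
    ultimately show "X = Lambda_class e" unfolding X by (simp add: Lambda_class_eq_iff)
  qed
  finally show ?thesis .
qed

text \<open>The target is \<open>Lambda_monoid\<close>, which \<open>S_eq_Lambda\<close> identifies
  with \<open>S_monoid\<close>. Surjectivity comes from replacing a sequence by an equivalent chain
  and taking its chain module.\<close>

lemma CP_S_iso:
  "CP_to_S \<in> ordered_iso (CP_monoid :: ('a, nat \<Rightarrow> 'a) rmod set ordered_monoid) Lambda_monoid"
  unfolding ordered_iso_def iso_def hom_def mem_Collect_eq
proof (intro conjI ballI)
  let ?C = "CP_monoid :: ('a, nat \<Rightarrow> 'a) rmod set ordered_monoid"
  have T: "e \<in> T_seqs" if "represents e P" for e and P :: "('a, nat \<Rightarrow> 'a) rmod"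
    using that by (simp add: represents_def idem_chain_T_seqs)
  show car: "CP_to_S \<in> carrier ?C \<rightarrow> carrier Lambda_monoid"
  proof
    fix X assume "X \<in> carrier ?C"
    then obtain P e where P: "P \<in> cg_projective" "represents e P" "X = CP_class P" by (rule CP_classE)
    show "CP_to_S X \<in> carrier Lambda_monoid"
      unfolding P(3) CP_to_S_class[OF P(2,1)] Lambda_carrier using T[OF P(2)] by blast
  qed
  show "bij_betw CP_to_S (carrier ?C) (carrier Lambda_monoid)"
    unfolding bij_betw_def
  proof
    show "inj_on CP_to_S (carrier ?C)"
    proof (rule inj_onI)
      fix X Y assume XY: "X \<in> carrier ?C" "Y \<in> carrier ?C" "CP_to_S X = CP_to_S Y"
      obtain P e where P: "P \<in> cg_projective" "represents e P" "X = CP_class P" using CP_classE[OF XY(1)] .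
      obtain Q f where Q: "Q \<in> cg_projective" "represents f Q" "Y = CP_class Q" using CP_classE[OF XY(2)] .
      have "seq_le e f \<and> seq_le f e"
        using XY(3) Lambda_class_eq_iff[OF T[OF P(2)] T[OF Q(2)]]
        unfolding P(3) Q(3) CP_to_S_class[OF P(2,1)] CP_to_S_class[OF Q(2,1)] by blast
      then have "(P, Q) \<in> CP_rel" using CP_rel_iff[OF P(2) Q(2) P(1) Q(1)] by blast
      then show "X = Y" unfolding P(3) Q(3) by (rule equiv_class_eq[OF equiv_CP])
    qed
    show "CP_to_S ` carrier ?C = carrier Lambda_monoid"
    proof (intro equalityI subsetI)
      fix Z assume "Z \<in> carrier (Lambda_monoid :: (nat \<Rightarrow> 'a minf) set ordered_monoid)"
      then obtain x where x: "x \<in> T_seqs" "Z = Lambda_class x" unfolding Lambda_carrier by blast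
      obtain e where e: "idem_chain e" "seq_le x e" "seq_le e x" using idem_chain_exists[OF ur x(1)] by blast
      have "Z = Lambda_class e"
        unfolding x(2) using e Lambda_class_eq_iff[OF x(1) idem_chain_T_seqs[OF e(1)]] by blast
      then have "Z = CP_to_S (CP_class (chain_mod e))"
        using CP_to_S_class[OF represents_chain_mod chain_mod_cg_projective] e(1) by blast
      moreover have "CP_class (chain_mod e) \<in> carrier ?C"
        using e(1) by (auto simp: CP_monoid_def intro!: quotientI chain_mod_cg_projective)
      ultimately show "Z \<in> CP_to_S ` carrier ?C" by blast
    qed (use car in blast)
  qed
  show "CP_to_S \<one>\<^bsub>?C\<^esub> = \<one>\<^bsub>Lambda_monoid\<^esub>"
  proof -
    have 0: "idem_chain (\<lambda>_. 0 :: 'a minf)" by (simp add: idem_chain_def)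
    have "free_rmod {} = chain_mod (\<lambda>_. 0 :: 'a minf)"
      by (auto simp: chain_mod_def free_rmod_def)
    then have "CP_to_S (CP_class (free_rmod {})) = Lambda_class (\<lambda>_. 0)"
      using CP_to_S_class[OF represents_chain_mod[OF 0] chain_mod_cg_projective[OF 0]] by simp
    then show ?thesis by (simp add: CP_monoid_def Lambda_monoid_def)
  qed
  fix X Y assume XY: "X \<in> carrier ?C" "Y \<in> carrier ?C"
  obtain P e where P: "P \<in> cg_projective" "represents e P" "X = CP_class P" using CP_classE[OF XY(1)] .
  obtain Q f where Q: "Q \<in> cg_projective" "represents f Q" "Y = CP_class Q" using CP_classE[OF XY(2)] .
  show "mle ?C X Y \<longleftrightarrow> mle Lambda_monoid (CP_to_S X) (CP_to_S Y)"
  proof -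
    have "mle ?C X Y \<longleftrightarrow> (\<exists>P'\<in>X. \<exists>Q'\<in>Y. P' \<lesssim>\<^sub>C\<^sub>P Q')" by (simp add: CP_monoid_def)
    also have "\<dots> \<longleftrightarrow> seq_le e f"
    proof
      assume "\<exists>P'\<in>X. \<exists>Q'\<in>Y. P' \<lesssim>\<^sub>C\<^sub>P Q'"
      then obtain P' Q' where PQ': "P' \<in> CP_class P" "Q' \<in> CP_class Q" "P' \<lesssim>\<^sub>C\<^sub>P Q'"
        unfolding P(3) Q(3) by blast
      obtain e' where e': "represents e' P'" "seq_le e e'" using CP_class_mem(2)[OF P(2,1) PQ'(1)] by blast
      obtain f' where f': "represents f' Q'" "seq_le f' f" using CP_class_mem(2)[OF Q(2,1) PQ'(2)] by blast
      have "seq_le e' f'" using PQ'(3) represents_cp_le[OF e'(1) f'(1)] by blast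
      then show "seq_le e f" using e'(2) f'(2) by (blast intro: seq_le_trans)
    next
      assume "seq_le e f"
      then have "P \<lesssim>\<^sub>C\<^sub>P Q" using represents_cp_le[OF P(2) Q(2)] by blast
      then show "\<exists>P'\<in>X. \<exists>Q'\<in>Y. P' \<lesssim>\<^sub>C\<^sub>P Q'"
        using equiv_class_self[OF equiv_CP P(1)] equiv_class_self[OF equiv_CP Q(1)] unfolding P(3) Q(3) by blast
    qed
    also have "\<dots> \<longleftrightarrow> mle Lambda_monoid (CP_to_S X) (CP_to_S Y)"
      unfolding P(3) Q(3) CP_to_S_class[OF P(2,1)] CP_to_S_class[OF Q(2,1)]
      by (rule Lambda_mle[OF T[OF P(2)] T[OF Q(2)], symmetric])
    finally show ?thesis .
  qed
  show "CP_to_S (X \<otimes>\<^bsub>?C\<^esub> Y) = CP_to_S X \<otimes>\<^bsub>Lambda_monoid\<^esub> CP_to_S Y"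
  proof -
    obtain k where k: "sized k e" using sized_exists[OF T[OF P(2)]] by blast
    obtain g where g: "represents g (direct_sum P Q)" "seq_le g (seq_sum k e f)" "seq_le (seq_sum k e f) g"
      using direct_sum_represents[OF P(2) Q(2)] k by blast
    have gc: "idem_chain g" using g(1) by (simp add: represents_def)
    have "CP_to_S (X \<otimes>\<^bsub>?C\<^esub> Y) = Lambda_class g"
      unfolding P(3) Q(3) CP_mult[OF P(2,1) Q(2,1) g(1)]
      by (rule CP_to_S_class[OF represents_chain_mod[OF gc] chain_mod_cg_projective[OF gc]])
    also have "\<dots> = Lambda_class (seq_sum k e f)"
      using g(2,3) Lambda_class_eq_iff[OF idem_chain_T_seqs[OF gc] seq_sum_T_seqs[OF k T[OF Q(2)]]] by blast
    also have "\<dots> = CP_to_S X \<otimes>\<^bsub>Lambda_monoid\<^esub> CP_to_S Y"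
      unfolding P(3) Q(3) CP_to_S_class[OF P(2,1)] CP_to_S_class[OF Q(2,1)]
      by (rule Lambda_mult[OF k T[OF Q(2)], symmetric])
    finally show ?thesis .
  qed
qed

end

theorem proposition6p11:
  assumes "unit_regular TYPE('a::{ring,monoid_mult})"
  shows
    "(\<lambda>X. W_rel `` X) \<in> ordered_iso (V_monoid :: 'a minf set ordered_monoid) W_monoid \<and>
     (\<lambda>X. WM_rel `` X) \<in> ordered_iso (W_monoid :: 'a minf set ordered_monoid) WM_monoid \<and>
     (\<forall>X\<in>carrier (W_monoid :: 'a minf set ordered_monoid). \<forall>Y\<in>carrier W_monoid.
        mle W_monoid X Y \<longleftrightarrow> algebraic_le W_monoid X Y) \<and>
     (\<forall>X\<in>carrier (WM_monoid :: 'a minf set ordered_monoid). \<forall>Y\<in>carrier WM_monoid.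
        mle WM_monoid X Y \<longleftrightarrow> algebraic_le WM_monoid X Y) \<and>
     (\<lambda>X. CP_rel `` X) \<in>
       iso (Vstar_monoid :: ('a, nat \<Rightarrow> 'a) rmod set monoid) CP_monoid \<and>
     CP_to_S \<in>
       ordered_iso (CP_monoid :: ('a, nat \<Rightarrow> 'a) rmod set ordered_monoid) S_monoid \<and>
     LambdaW_to_Lambda \<in>
       ordered_iso (LambdaW_monoid :: 'a minf set set ordered_monoid) S_monoid \<and>
     (\<forall>(P :: ('a, 'p) rmod) (Q :: ('a, 'q) rmod).
        P \<in> cg_projective \<longrightarrow> Q \<in> cg_projective \<longrightarrow>
        (P \<lesssim>\<^sub>C\<^sub>P Q \<longleftrightarrow> (\<exists>X. rsubmodule Q X \<and> rmod_iso P (Q\<lparr>carrier := X\<rparr>)))) \<and>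
     (S_monoid :: (nat \<Rightarrow> 'a minf) set ordered_monoid) = Lambda_monoid"
proof -
  have embed: "P \<lesssim>\<^sub>C\<^sub>P Q \<longleftrightarrow> (\<exists>X. rsubmodule Q X \<and> rmod_iso P (Q\<lparr>carrier := X\<rparr>))"
    if PQ: "P \<in> cg_projective" "Q \<in> cg_projective" for P :: "('a, 'p) rmod" and Q :: "('a, 'q) rmod"
  proof -
    obtain e where e: "represents e P" using cg_projective_represents[OF assms PQ(1)] by blast
    obtain f where f: "represents f Q" using cg_projective_represents[OF assms PQ(2)] by blast
    show ?thesis unfolding represents_cp_le[OF e f] represents_embed[OF assms e f] ..
  qed
  show ?thesis
    unfolding S_eq_Lambda[OF assms] W_WM[OF assms]
    using V_W_iso[OF assms] W_WM_iso[OF assms, unfolded W_WM[OF assms]] W_mle_algebraic[OF assms]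
      Vstar_CP_iso[OF assms] CP_S_iso[OF assms] LambdaW_Lambda_iso embed
    by (intro conjI ballI allI impI refl)
qed

end
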